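(* Up to isomorphism, there are exactly $35$ normal $3$-pseudomanifolds on $8$ vertices which are not combinatorial $3$-manifolds. These are the complexes $N_1,\dots,N_{35}$ defined in the context.
   Context: All simplicial complexes are finite; isomorphic complexes are identified. A simplicial complex is a collection of non-empty finite sets closed under taking non-empty subsets. A $d$-dimensional complex is pure if every face is contained in a $d$-face; its $d$-faces are then called facets. A weak $d$-pseudomanifold is a $d$-dimensional pure complex in which each $(d-1)$-face is in exactly two facets. The link of a face $\sigma$ in $K$ is $\mathrm{lk}_K(\sigma)=\{\tau\in K:\tau\cap\sigma=\emptyset,\ \tau\cup\sigma\in K\}$. A normal $d$-pseudomanifold ($d\ge1$) is a connected weak $d$-pseudomanifold in which the links of all simplices of dimension $\le d-2$ are connected. A combinatorial $3$-manifold is a normal $3$-pseudomanifold in which the link of each vertex triangulates the $2$-sphere. Bistellar moves on a weak $3$-pseudomanifold $M$: let $\alpha$ be a $(3-i)$-face of $M$, $i\in\{1,2\}$, such that $\mathrm{lk}_M(\alpha)$ consists of all non-empty proper subsets of a set $\beta$ with $|\beta|=i+1$ and $\beta$ is not a face of $M$. Then $\kappa_\alpha(M)$ is the weak $3$-pseudomanifold with facet set $\{\sigma:\sigma\text{ a facet of }M,\ \alpha\not\subseteq\sigma\}\cup\{\beta\cup\alpha\setminus\{v\}:v\in\alpha\}$ (a bistellar $i$-move). A complex is identified with its set of facets, and $abcd$ denotes $\{a,b,c,d\}$ (similarly $ab$, $abc$). The complexes, all with vertex set $\{1,\dots,8\}$, are: $N_1=\{1248,1268,1348,1378,1568,1578,2358,2378,2458,2678,3468,3568,4578,4678,1247,1257,1367,1467,2347,2567,3457,3567,1236,2346,1345,1235,1456,2456\}$,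 $N_2=\{1248,2458,2358,3568,3468,4678,4578,1578,1568,1268,2678,2378,1378,1348,1247,2457,2357,3567,3467,1567,1267,1347\}$, $N_3=\{1248,1268,1348,1378,1568,1578,2358,2378,2458,2678,3468,3568,4578,4678,1234,2347,2456,2467,3456,3457,1235,1256,1357\}$, $N_4=\{1248,1268,1348,1378,1568,1578,2358,2378,2458,2678,3468,3568,4578,4678,1245,1256,2356,2367,3467,1347,1457\}$, $N_5=\{1258,1268,1358,1378,1468,1478,2368,2378,2458,2478,3458,3468,1257,1267,1367,1457,2357,2467,3457,3467,2356,2456,1356,1456\}$, $N_6=\{1358,1378,1468,1478,1568,2368,2378,2458,2478,2568,3458,3468,1235,1245,1457,1567,2357,2567,3457,1236,1246,1367,2467,3467\}$, $N_7=\{1268,1258,1358,1378,1478,1468,2378,2368,2458,2478,3468,3458,1356,1367,2357,2356,3467,3457,1256,1467,2457\}$, $N_8=\kappa_{348}(\kappa_{238}(\kappa_{56}(\kappa_{67}(N_7))))$, $N_9=\kappa_{235}(\kappa_{67}(N_7))$, $N_{10}=\kappa_{148}(\kappa_{67}(N_7))$, $N_{11}=\kappa_{348}(\kappa_{56}(N_{10}))$, $N_{12}=\kappa_{457}(\kappa_{23}(N_9))$, $N_{13}=\kappa_{567}(\kappa_{23}(N_9))$, $N_{14}=\kappa_{138}(\kappa_{57}(N_8))$, $N_{15}=\kappa_{158}(\kappa_{23}(N_9))$, $N_{16}=\kappa_{67}(N_7)$, $N_{17}=\kappa_{24}(N_8)$, $N_{18}=\kappa_{238}(\kappa_{56}(\kappa_{67}(N_7)))$,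 $N_{19}=\kappa_{57}(N_8)$, $N_{20}=\kappa_{56}(N_{10})$, $N_{21}=\kappa_{12}(N_9)$, $N_{22}=\kappa_{14}(N_{11})$, $N_{23}=\kappa_{23}(N_9)$, $N_{24}=\kappa_{38}(N_{14})$, $N_{25}=\kappa_{56}(N_{16})$, $N_{26}=\kappa_{12}(N_{16})$, $N_{27}=\kappa_{56}(N_{17})$, $N_{28}=\kappa_{57}(N_{18})$, $N_{29}=\kappa_{15}(N_{18})$, $N_{30}=\kappa_{12}(N_{23})$, $N_{31}=\kappa_{24}(N_{22})$, $N_{32}=\kappa_{24}(N_{26})$, $N_{33}=\kappa_{57}(N_{25})$, $N_{34}=\kappa_{45}(N_{28})$, $N_{35}=\kappa_{58}(N_{29})$. *)

theory Defs
  imports "HOL-Analysis.Analysis"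
begin

text \<open>The empty set is not a face, so links do not contain it either.\<close>

definition abstract_complex :: "'a set set \<Rightarrow> bool" where
  "abstract_complex K \<longleftrightarrow>
     finite K \<and> (\<forall>\<sigma>\<in>K. finite \<sigma> \<and> \<sigma> \<noteq> {}) \<and>
     (\<forall>\<sigma>\<in>K. \<forall>\<tau>. \<tau> \<noteq> {} \<and> \<tau> \<subseteq> \<sigma> \<longrightarrow> \<tau> \<in> K)"

definition vertices :: "'a set set \<Rightarrow> 'a set" where
  "vertices K = \<Union>K"

definition isomorphic :: "'a set set \<Rightarrow> 'b set set \<Rightarrow> bool" where
  "isomorphic K L \<longleftrightarrow>
     (\<exists>f. bij_betw f (vertices K) (vertices L) \<and> (\<lambda>\<sigma>. f ` \<sigma>) ` K = L)"

definition faces_of_dim :: "nat \<Rightarrow> 'a set set \<Rightarrow> 'a set set" where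
  "faces_of_dim d K = {\<sigma> \<in> K. card \<sigma> = d + 1}"

definition pure_complex :: "nat \<Rightarrow> 'a set set \<Rightarrow> bool" where
  "pure_complex d K \<longleftrightarrow>
     abstract_complex K \<and> faces_of_dim d K \<noteq> {} \<and> (\<forall>\<sigma>\<in>K. card \<sigma> \<le> d + 1) \<and>
     (\<forall>\<sigma>\<in>K. \<exists>\<tau>\<in>faces_of_dim d K. \<sigma> \<subseteq> \<tau>)"

definition link :: "'a set set \<Rightarrow> 'a set \<Rightarrow> 'a set set" where
  "link K \<sigma> = {\<tau> \<in> K. \<tau> \<inter> \<sigma> = {} \<and> \<tau> \<union> \<sigma> \<in> K}"

text \<open>Geometric carrier, in barycentric coordinates. The ambient function space carries the
  product topology; on the carrier of a finite complex this is the usual Euclidean topology.\<close>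

definition carrier_space :: "'a set set \<Rightarrow> ('a \<Rightarrow> real) set" where
  "carrier_space K =
     {x. (\<forall>v. 0 \<le> x v) \<and> {v. x v \<noteq> 0} \<in> K \<and> (\<Sum>v\<in>{v. x v \<noteq> 0}. x v) = 1}"

definition connected_complex :: "'a set set \<Rightarrow> bool" where
  "connected_complex K \<longleftrightarrow> connected (carrier_space K)"

definition triangulates :: "'a set set \<Rightarrow> 'b::topological_space set \<Rightarrow> bool" where
  "triangulates K X \<longleftrightarrow> carrier_space K homeomorphic X"

definition weak_pseudomanifold :: "nat \<Rightarrow> 'a set set \<Rightarrow> bool" where
  "weak_pseudomanifold d K \<longleftrightarrow>
     pure_complex d K \<and>
     (\<forall>\<rho>\<in>K. card \<rho> = d \<longrightarrow> card {\<sigma> \<in> faces_of_dim d K. \<rho> \<subseteq> \<sigma>} = 2)"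

text \<open>A simplex has dimension at most \<open>d - 2\<close> iff it has at most \<open>d - 1\<close> vertices; here \<open>d \<ge> 1\<close>, so
  truncated subtraction is harmless.\<close>

definition normal_pseudomanifold :: "nat \<Rightarrow> 'a set set \<Rightarrow> bool" where
  "normal_pseudomanifold d K \<longleftrightarrow>
     1 \<le> d \<and> weak_pseudomanifold d K \<and> connected_complex K \<and>
     (\<forall>\<sigma>\<in>K. card \<sigma> \<le> d - 1 \<longrightarrow> connected_complex (link K \<sigma>))"

definition combinatorial_3_manifold :: "'a set set \<Rightarrow> bool" where
  "combinatorial_3_manifold K \<longleftrightarrow>
     normal_pseudomanifold 3 K \<and>
     (\<forall>v\<in>vertices K. triangulates (link K {v}) (sphere (0 :: real ^ 3) 1))"

definition complex_of :: "'a set set \<Rightarrow> 'a set set" where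
  "complex_of F = {\<tau>. \<tau> \<noteq> {} \<and> (\<exists>\<sigma>\<in>F. \<tau> \<subseteq> \<sigma>)}"

definition admissible_move :: "nat \<Rightarrow> 'a set set \<Rightarrow> 'a set \<Rightarrow> 'a set \<Rightarrow> bool" where
  "admissible_move i M \<alpha> \<beta> \<longleftrightarrow>
     i \<in> {1, 2} \<and> \<alpha> \<in> faces_of_dim (3 - i) M \<and> card \<beta> = i + 1 \<and>
     link M \<alpha> = {\<tau>. \<tau> \<noteq> {} \<and> \<tau> \<subset> \<beta>} \<and> \<beta> \<notin> M"

text \<open>An admissible \<open>\<beta>\<close> is unique, being the vertex set of the link of \<open>\<alpha>\<close>. If there is none,
  the value of \<open>bistellar\<close> is unspecified.\<close>

definition bistellar :: "'a set \<Rightarrow> 'a set set \<Rightarrow> 'a set set" where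
  "bistellar \<alpha> M =
     (let \<beta> = (THE \<beta>. \<exists>i. admissible_move i M \<alpha> \<beta>)
      in complex_of ({\<sigma> \<in> faces_of_dim 3 M. \<not> \<alpha> \<subseteq> \<sigma>} \<union> {(\<beta> \<union> \<alpha>) - {v} | v. v \<in> \<alpha>}))"

text \<open>The face \<open>{a, b, c, d}\<close> is encoded by the decimal numeral \<open>abcd\<close>.\<close>

fun digits :: "nat \<Rightarrow> nat set" where
  "digits n = (if n = 0 then {} else insert (n mod 10) (digits (n div 10)))"

declare digits.simps [simp del]

lemma "digits 1248 = {1, 2, 4, 8}"
  by (auto simp: digits.simps)

abbreviation of_facets :: "nat set \<Rightarrow> nat set set" where
  "of_facets F \<equiv> complex_of (digits ` F)"

abbreviation move :: "nat \<Rightarrow> nat set set \<Rightarrow> nat set set" where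
  "move a M \<equiv> bistellar (digits a) M"

definition N1 :: "nat set set" where
  "N1 = of_facets
      {1248, 1268, 1348, 1378, 1568, 1578, 2358, 2378, 2458, 2678, 3468, 3568,
       4578, 4678, 1247, 1257, 1367, 1467, 2347, 2567, 3457, 3567, 1236, 2346,
       1345, 1235, 1456, 2456}"

definition N2 :: "nat set set" where
  "N2 = of_facets
      {1248, 2458, 2358, 3568, 3468, 4678, 4578, 1578, 1568, 1268, 2678, 2378,
       1378, 1348, 1247, 2457, 2357, 3567, 3467, 1567, 1267, 1347}"

definition N3 :: "nat set set" where
  "N3 = of_facets
      {1248, 1268, 1348, 1378, 1568, 1578, 2358, 2378, 2458, 2678, 3468, 3568,
       4578, 4678, 1234, 2347, 2456, 2467, 3456, 3457, 1235, 1256, 1357}"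

definition N4 :: "nat set set" where
  "N4 = of_facets
      {1248, 1268, 1348, 1378, 1568, 1578, 2358, 2378, 2458, 2678, 3468, 3568,
       4578, 4678, 1245, 1256, 2356, 2367, 3467, 1347, 1457}"

definition N5 :: "nat set set" where
  "N5 = of_facets
      {1258, 1268, 1358, 1378, 1468, 1478, 2368, 2378, 2458, 2478, 3458, 3468,
       1257, 1267, 1367, 1457, 2357, 2467, 3457, 3467, 2356, 2456, 1356, 1456}"

definition N6 :: "nat set set" where
  "N6 = of_facets
      {1358, 1378, 1468, 1478, 1568, 2368, 2378, 2458, 2478, 2568, 3458, 3468,
       1235, 1245, 1457, 1567, 2357, 2567, 3457, 1236, 1246, 1367, 2467, 3467}"

definition N7 :: "nat set set" where
  "N7 = of_facets
      {1268, 1258, 1358, 1378, 1478, 1468, 2378, 2368, 2458, 2478, 3468, 3458,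
       1356, 1367, 2357, 2356, 3467, 3457, 1256, 1467, 2457}"

definition N8 :: "nat set set" where
  "N8 = move 348 (move 238 (move 56 (move 67 N7)))"

definition N9 :: "nat set set" where
  "N9 = move 235 (move 67 N7)"

definition N10 :: "nat set set" where
  "N10 = move 148 (move 67 N7)"

definition N11 :: "nat set set" where
  "N11 = move 348 (move 56 N10)"

definition N12 :: "nat set set" where
  "N12 = move 457 (move 23 N9)"

definition N13 :: "nat set set" where
  "N13 = move 567 (move 23 N9)"

definition N14 :: "nat set set" where
  "N14 = move 138 (move 57 N8)"

definition N15 :: "nat set set" where
  "N15 = move 158 (move 23 N9)"

definition N16 :: "nat set set" where
  "N16 = move 67 N7"

definition N17 :: "nat set set" where
  "N17 = move 24 N8"

definition N18 :: "nat set set" where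
  "N18 = move 238 (move 56 (move 67 N7))"

definition N19 :: "nat set set" where
  "N19 = move 57 N8"

definition N20 :: "nat set set" where
  "N20 = move 56 N10"

definition N21 :: "nat set set" where
  "N21 = move 12 N9"

definition N22 :: "nat set set" where
  "N22 = move 14 N11"

definition N23 :: "nat set set" where
  "N23 = move 23 N9"

definition N24 :: "nat set set" where
  "N24 = move 38 N14"

definition N25 :: "nat set set" where
  "N25 = move 56 N16"

definition N26 :: "nat set set" where
  "N26 = move 12 N16"

definition N27 :: "nat set set" where
  "N27 = move 56 N17"

definition N28 :: "nat set set" where
  "N28 = move 57 N18"

definition N29 :: "nat set set" where
  "N29 = move 15 N18"

definition N30 :: "nat set set" where
  "N30 = move 12 N23"

definition N31 :: "nat set set" where
  "N31 = move 24 N22"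

definition N32 :: "nat set set" where
  "N32 = move 24 N26"

definition N33 :: "nat set set" where
  "N33 = move 57 N25"

definition N34 :: "nat set set" where
  "N34 = move 45 N28"

definition N35 :: "nat set set" where
  "N35 = move 58 N29"

definition N_complex :: "nat \<Rightarrow> nat set set" where
  "N_complex i =
     [N1, N2, N3, N4, N5, N6, N7, N8, N9, N10, N11, N12, N13, N14, N15, N16,
      N17, N18, N19, N20, N21, N22, N23, N24, N25, N26, N27, N28, N29, N30, N31,
      N32, N33, N34, N35] ! (i - 1)"

end

theory Submission
  imports Defs
begin

text \<open>
A normal 3-pseudomanifold is determined by its facets, and a connectedness argument shows that no
proper nonempty set of its facets is closed in the sense that every triangle of it lies in exactly
two of its members; the same holds for vertex links one dimension lower. Hence, once the link of
one vertex is fixed, all completions are found by a finite search that repeatedly picks a ridge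
lying in only one chosen facet and branches over the second facet. Applied in dimension 1, 2 and 3
in turn, this yields the cycles with at most 6 vertices, the closed surfaces with at most 7 vertices
(the link of a vertex of maximal degree being a cycle), and the 8-vertex pseudomanifolds containing
one of the five surfaces that are not spheres as a vertex link.

A surface is recognised as a sphere by bistellar moves leading to the boundary of a tetrahedron;
such a move, trading a face \<open>\<alpha>\<close> for a face \<open>\<beta>\<close>, changes the carrier by the homeomorphism that
subtracts the minimum of the coordinates on \<open>\<alpha>\<close> from each of them and redistributes the mass equally
over \<open>\<beta>\<close>. The five other surfaces,
triangulating the projective plane and the torus, contain a triangle of edges whose complement is
connected, contradicting the Jordan curve theorem on the sphere. The 35 complexes are told apart by
a numerical invariant of the numbers of facets containing two given vertices.
\<close>

section \<open>Topology of geometric carriers\<close>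

text \<open>The definitions speak of connected and homeomorphic carriers, neither of which can be
  evaluated, so both are first replaced by finite statements about facets. Sphere recognition is
  needed in both directions. The positive one shows that a link which is not a sphere must be one of
  the five surfaces. The negative one shows that none of the 35 complexes is a combinatorial
  manifold. The search only has to be complete: every pseudomanifold with the prescribed link occurs
  as a leaf, while a leaf may well violate normality. Bad leaves are thrown out by tests that no
  genuine solution can fail, and each leaf that survives is matched with a stored certificate.
  Certificates, moves and relabellings are data that are checked, so nothing depends on how they
  were found. All evaluation is done by rewriting inside the logic. This is why vertex sets become
  words of \<open>In\<close> and \<open>Out\<close>, and why lists and Boolean connectives are
  handled by small functions of their own.\<close>

definition supp :: "('a \<Rightarrow> real) \<Rightarrow> 'a set" where
  "supp x = {v. x v \<noteq> 0}"

lemma carrier_space_iff: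
  "x \<in> carrier_space K \<longleftrightarrow> (\<forall>v. 0 \<le> x v) \<and> supp x \<in> K \<and> sum x (supp x) = 1"
  by (simp add: carrier_space_def supp_def)

lemma sum_supp:
  assumes "finite W" "supp x \<subseteq> W"
  shows "sum x (supp x) = sum x W"
  using assms by (intro sum.mono_neutral_left) (auto simp: supp_def)

section \<open>Bistellar flips and homeomorphic carriers\<close>

definition flip :: "'a set \<Rightarrow> 'a set \<Rightarrow> 'a set set \<Rightarrow> 'a set set" where
  "flip \<alpha> \<beta> F = {f \<in> F. \<not> \<alpha> \<subseteq> f} \<union> (\<lambda>a. \<beta> \<union> \<alpha> - {a}) ` \<alpha>"

text \<open>The star of \<alpha> is the join of \<alpha> with the boundary of \<beta>. The dimension
  is left open: \<alpha> and \<beta> have 4 vertices together in surfaces and 5 in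
  3-pseudomanifolds. A single vertex \<alpha> of degree three is allowed, and flipping it deletes
  the vertex.\<close>

definition flippable :: "'a set \<Rightarrow> 'a set \<Rightarrow> 'a set set \<Rightarrow> bool" where
  "flippable \<alpha> \<beta> F \<longleftrightarrow> finite \<alpha> \<and> finite \<beta> \<and> \<alpha> \<noteq> {} \<and> \<beta> \<noteq> {} \<and> \<alpha> \<inter> \<beta> = {} \<and>
     {f \<in> F. \<alpha> \<subseteq> f} = (\<lambda>b. \<alpha> \<union> \<beta> - {b}) ` \<beta> \<and> (\<forall>f\<in>F. \<not> \<beta> \<subseteq> f)"

text \<open>No old facet contains \<beta>, so after the flip the star of \<beta> consists of exactly
  the new facets, and flipping back restores the old star of \<alpha>.\<close>

lemma flip_flip:
  assumes "flippable \<alpha> \<beta> F"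
  shows "flippable \<beta> \<alpha> (flip \<alpha> \<beta> F)" "flip \<beta> \<alpha> (flip \<alpha> \<beta> F) = F"
proof -
  have eq: "{f \<in> flip \<alpha> \<beta> F. \<beta> \<subseteq> f} = (\<lambda>a. \<beta> \<union> \<alpha> - {a}) ` \<alpha>"
    using assms unfolding flip_def flippable_def by auto
  show "flippable \<beta> \<alpha> (flip \<alpha> \<beta> F)"
    unfolding flippable_def eq using assms unfolding flip_def flippable_def by auto
  have "{f \<in> flip \<alpha> \<beta> F. \<not> \<beta> \<subseteq> f} = {f \<in> F. \<not> \<alpha> \<subseteq> f}"
    using assms unfolding flip_def flippable_def by auto
  then have "flip \<beta> \<alpha> (flip \<alpha> \<beta> F) = {f \<in> F. \<not> \<alpha> \<subseteq> f} \<union> {f \<in> F. \<alpha> \<subseteq> f}"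
    using assms by (simp add: flip_def[of \<beta>] flippable_def)
  then show "flip \<beta> \<alpha> (flip \<alpha> \<beta> F) = F" by auto
qed

lemma continuous_on_Min:
  fixes f :: "'i \<Rightarrow> 'a::topological_space \<Rightarrow> real"
  assumes "finite A" "A \<noteq> {}" "\<And>i. i \<in> A \<Longrightarrow> continuous_on S (f i)"
  shows "continuous_on S (\<lambda>x. Min ((\<lambda>i. f i x) ` A))"
  using assms by (induction A rule: finite_ne_induct) (auto intro!: continuous_on_min)

definition shift :: "'a set \<Rightarrow> 'a set \<Rightarrow> ('a \<Rightarrow> real) \<Rightarrow> 'a \<Rightarrow> real" where
  "shift \<alpha> \<beta> x = (\<lambda>v. x v - (if v \<in> \<alpha> then Min (x ` \<alpha>) else 0)
     + (if v \<in> \<beta> then Min (x ` \<alpha>) * card \<alpha> / card \<beta> else 0))"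

lemma continuous_on_coordinate: "continuous_on S (\<lambda>x. x v)"
  for S :: "('a \<Rightarrow> 'b::topological_space) set"
  by (rule continuous_on_product_then_coordinatewise) (rule continuous_on_id)

lemma continuous_on_shift:
  assumes "finite \<alpha>" "\<alpha> \<noteq> {}"
  shows "continuous_on S (shift \<alpha> \<beta>)"
proof (rule continuous_on_coordinatewise_then_product)
  fix v
  have m: "continuous_on S (\<lambda>x. Min (x ` \<alpha>))"
    using assms by (rule continuous_on_Min) (rule continuous_on_coordinate)
  show "continuous_on S (\<lambda>x. shift \<alpha> \<beta> x v)"
    unfolding shift_def using m continuous_on_coordinate[of S v]
    by (cases "v \<in> \<alpha>"; cases "v \<in> \<beta>") (auto simp: divide_inverse intro!: continuous_intros)
qed

text \<open>If the facet carrying \<open>x\<close> does not contain \<alpha>, the minimum over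
  \<alpha> is 0 and nothing moves. Otherwise a vertex of \<alpha> attaining the minimum drops out of
  the support, which then fits into a new facet. For the inverse: \<open>x\<close> vanishes at some
  vertex of \<beta>, so after the shift the minimum over \<beta> is exactly the amount that was
  added there.\<close>

lemma shift_in_carrier:
  assumes F: "flippable \<alpha> \<beta> F" and fin: "\<forall>f\<in>F. finite f"
    and x: "x \<in> carrier_space (complex_of F)"
  shows "shift \<alpha> \<beta> x \<in> carrier_space (complex_of (flip \<alpha> \<beta> F))"
    and "shift \<beta> \<alpha> (shift \<alpha> \<beta> x) = x"
proof -
  have ab: "finite \<alpha>" "finite \<beta>" "\<alpha> \<noteq> {}" "\<beta> \<noteq> {}" "\<alpha> \<inter> \<beta> = {}"
    using F by (auto simp: flippable_def)
  have x0: "\<forall>v. 0 \<le> x v" and sx: "supp x \<noteq> {}" "sum x (supp x) = 1"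
    and "\<exists>f\<in>F. supp x \<subseteq> f"
    using x by (auto simp: carrier_space_iff complex_of_def)
  then obtain f where f: "f \<in> F" "supp x \<subseteq> f" by blast
  then have finx: "finite (supp x)" using fin finite_subset by blast
  define m where "m = Min (x ` \<alpha>)"
  define t where "t = m * card \<alpha> / card \<beta>"
  have y: "shift \<alpha> \<beta> x = (\<lambda>v. x v - (if v \<in> \<alpha> then m else 0) + (if v \<in> \<beta> then t else 0))"
    unfolding shift_def m_def t_def ..
  have m_le: "m \<le> x v" if "v \<in> \<alpha>" for v using ab that by (simp add: m_def)
  have "m \<in> x ` \<alpha>" using ab unfolding m_def by (intro Min_in) auto
  then obtain a where a: "a \<in> \<alpha>" "x a = m" by auto
  have m0: "0 \<le> m" using a x0 by metis
  have t0: "0 \<le> t" using m0 by (simp add: t_def)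
  have cb: "0 < card \<beta>" "0 < card \<alpha>" using ab by (simp_all add: card_gt_0_iff)
  have y0: "0 \<le> shift \<alpha> \<beta> x v" for v
    using m_le[of v] x0 t0 by (simp add: y)
  have sum_y: "sum (shift \<alpha> \<beta> x) W = sum x W" if "finite W" "\<alpha> \<union> \<beta> \<subseteq> W" for W
  proof -
    have "sum (shift \<alpha> \<beta> x) W = sum x W - (\<Sum>v\<in>W. if v \<in> \<alpha> then m else 0) + (\<Sum>v\<in>W. if v \<in> \<beta> then t else 0)"
      by (simp add: y sum.distrib sum_subtractf)
    also have "(\<Sum>v\<in>W. if v \<in> \<alpha> then m else 0) = card \<alpha> * m"
      using that by (simp add: sum.If_cases Int_absorb1)
    also have "(\<Sum>v\<in>W. if v \<in> \<beta> then t else 0) = card \<beta> * t"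
      using that by (simp add: sum.If_cases Int_absorb1)
    finally show ?thesis using cb by (simp add: t_def)
  qed
  have supp_le: "supp (shift \<alpha> \<beta> x) \<subseteq> supp x \<union> \<alpha> \<union> \<beta>"
    by (auto simp: y supp_def)
  have sum1: "sum (shift \<alpha> \<beta> x) (supp (shift \<alpha> \<beta> x)) = 1"
    using sum_y[of "supp x \<union> \<alpha> \<union> \<beta>"] sum_supp[of "supp x \<union> \<alpha> \<union> \<beta>"] supp_le finx ab sx
    by (metis finite_Un sup.cobounded1 sup.cobounded2 sup_assoc)
  have supp_ne: "supp (shift \<alpha> \<beta> x) \<noteq> {}"
    using sum1 by auto
  have "\<exists>g\<in>flip \<alpha> \<beta> F. supp (shift \<alpha> \<beta> x) \<subseteq> g"
  proof (cases "\<alpha> \<subseteq> f")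
    case False
    then obtain c where "c \<in> \<alpha>" "c \<notin> f" by blast
    then have "x c = 0" using f by (auto simp: supp_def)
    then have "m = 0" using m_le[OF \<open>c \<in> \<alpha>\<close>] m0 by simp
    then have "shift \<alpha> \<beta> x = x" by (simp add: y t_def fun_eq_iff)
    then show ?thesis using f False by (auto simp: flip_def)
  next
    case True
    then have "f \<in> (\<lambda>b. \<alpha> \<union> \<beta> - {b}) ` \<beta>" using F f unfolding flippable_def by blast
    then have "supp x \<subseteq> \<alpha> \<union> \<beta>" using f by blast
    moreover have "shift \<alpha> \<beta> x a = 0" using a ab by (auto simp: y)
    ultimately have "supp (shift \<alpha> \<beta> x) \<subseteq> \<beta> \<union> \<alpha> - {a}"
      using supp_le by (auto simp: supp_def)
    then show ?thesis using a by (auto simp: flip_def)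
  qed
  then show "shift \<alpha> \<beta> x \<in> carrier_space (complex_of (flip \<alpha> \<beta> F))"
    using y0 sum1 supp_ne by (auto simp: carrier_space_iff complex_of_def)
  have "\<not> \<beta> \<subseteq> f" using F f by (simp add: flippable_def)
  then obtain b where b: "b \<in> \<beta>" "b \<notin> f" by blast
  then have "x b = 0" using f by (auto simp: supp_def)
  then have yb: "shift \<alpha> \<beta> x b = t" using b ab by (auto simp: y)
  have "shift \<alpha> \<beta> x v = x v + t" if "v \<in> \<beta>" for v
    using that ab by (auto simp: y)
  then have "Min (shift \<alpha> \<beta> x ` \<beta>) = t"
    using ab b yb x0 by (intro Min_eqI) (auto simp: image_iff)
  then show "shift \<beta> \<alpha> (shift \<alpha> \<beta> x) = x"
    using ab cb unfolding shift_def[of \<beta> \<alpha>]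
    by (auto simp: y t_def fun_eq_iff)
qed

lemma carrier_flip_homeomorphic:
  assumes F: "flippable \<alpha> \<beta> F" and fin: "\<forall>f\<in>F. finite f"
  shows "carrier_space (complex_of F) homeomorphic carrier_space (complex_of (flip \<alpha> \<beta> F))"
proof -
  note F' = flip_flip[OF F]
  have fin': "\<forall>f\<in>flip \<alpha> \<beta> F. finite f"
    using fin F by (auto simp: flip_def flippable_def)
  have ab: "finite \<alpha>" "finite \<beta>" "\<alpha> \<noteq> {}" "\<beta> \<noteq> {}"
    using F by (auto simp: flippable_def)
  show ?thesis
    unfolding homeomorphic_minimal
  proof (intro exI conjI ballI)
    show "continuous_on S (shift \<alpha> \<beta>)" "continuous_on S (shift \<beta> \<alpha>)" for S
      using ab by (simp_all add: continuous_on_shift)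
  qed (use shift_in_carrier[OF F fin] shift_in_carrier[OF F'(1) fin', unfolded F'(2)] in auto)
qed

section \<open>Relabelled carriers and boundaries of simplices\<close>

lemma carrier_image_homeomorphic:
  assumes h: "inj_on h (\<Union>K)"
  shows "carrier_space K homeomorphic carrier_space ((`) h ` K)"
proof -
  define V where "V = \<Union>K"
  define A where "A x = (\<lambda>w. if w \<in> h ` V then x (inv_into V h w) else 0)" for x :: "'a \<Rightarrow> real"
  define B where "B y = (\<lambda>v. if v \<in> V then y (h v) else 0)" for y :: "'b \<Rightarrow> real"
  have inj: "inj_on h V" using h by (simp add: V_def)
  have sub: "\<sigma> \<subseteq> V" if "\<sigma> \<in> K" for \<sigma> using that by (auto simp: V_def)
  have suppA: "supp (A x) = h ` supp x" if "supp x \<subseteq> V" for x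
    using that inj by (auto simp: supp_def A_def image_iff subset_iff) (metis inj_onD)
  have AxK: "A x \<in> carrier_space ((`) h ` K) \<and> B (A x) = x" if "x \<in> carrier_space K" for x
  proof -
    have s: "supp x \<subseteq> V" using that sub by (simp add: carrier_space_iff)
    have "sum (A x) (h ` supp x) = sum x (supp x)"
      using inj s by (subst sum.reindex) (auto simp: A_def intro: inj_on_subset intro!: sum.cong)
    then have "A x \<in> carrier_space ((`) h ` K)"
      using that suppA[OF s] by (auto simp: carrier_space_iff A_def)
    moreover have "B (A x) = x"
      using s inj by (auto simp: A_def B_def fun_eq_iff supp_def)
    ultimately show ?thesis ..
  qed
  have ByK: "B y \<in> carrier_space K \<and> A (B y) = y" if y: "y \<in> carrier_space ((`) h ` K)" for y
  proof -
    obtain \<sigma> where \<sigma>: "\<sigma> \<in> K" "supp y = h ` \<sigma>" using y by (auto simp: carrier_space_iff)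
    have suppB: "supp (B y) = \<sigma>"
      using \<sigma> sub[OF \<sigma>(1)] inj by (auto simp: supp_def B_def set_eq_iff image_iff inj_on_def subset_iff)
    have "sum (B y) \<sigma> = sum y (h ` \<sigma>)"
      using inj sub[OF \<sigma>(1)] by (subst sum.reindex) (auto simp: B_def intro: inj_on_subset intro!: sum.cong)
    then have "B y \<in> carrier_space K"
      using y \<sigma> suppB by (auto simp: carrier_space_iff B_def)
    moreover have "A (B y) = y"
    proof
      fix w
      show "A (B y) w = y w"
      proof (cases "w \<in> h ` V")
        case True
        then show ?thesis by (simp add: A_def B_def inv_into_into f_inv_into_f)
      next
        case False
        then have "w \<notin> supp y" using \<sigma> sub[OF \<sigma>(1)] by auto
        then show ?thesis using False by (simp add: A_def supp_def)
      qed
    qed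
    ultimately show ?thesis ..
  qed
  have "continuous_on S A" for S
  proof (rule continuous_on_coordinatewise_then_product)
    show "continuous_on S (\<lambda>x. A x i)" for i
      by (cases "i \<in> h ` V") (simp_all add: A_def continuous_on_coordinate)
  qed
  moreover have "continuous_on S B" for S
  proof (rule continuous_on_coordinatewise_then_product)
    show "continuous_on S (\<lambda>x. B x i)" for i
      by (cases "i \<in> V") (simp_all add: B_def continuous_on_coordinate)
  qed
  ultimately show ?thesis
    unfolding homeomorphic_minimal using AxK ByK
    by (intro exI[of _ A] exI[of _ B]) blast
qed

text \<open>Forgetting one barycentric coordinate identifies the carrier with the frontier of the
  standard simplex, and bounded convex sets of equal affine dimension have homeomorphic relative
  frontiers. The lemma is applied to a tetrahedron, giving the 2-sphere, and to a triangle, giving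
  the circle.\<close>

lemma carrier_simplex_boundary:
  fixes B :: "'a set"
  assumes B: "finite B" "card B = Suc DIM('b::euclidean_space)"
  shows "carrier_space {\<tau>. \<tau> \<noteq> {} \<and> \<tau> \<subset> B} homeomorphic sphere (0::'b) 1"
proof -
  let ?K = "{\<tau>. \<tau> \<noteq> {} \<and> \<tau> \<subset> B}"
  let ?S = "{y::'b. (\<forall>i\<in>Basis. 0 \<le> y \<bullet> i) \<and> sum ((\<bullet>) y) Basis \<le> 1}"
  have SS: "?S = convex hull (insert 0 Basis)" by (rule std_simplex[symmetric])
  have int: "interior ?S = {y. (\<forall>i\<in>Basis. 0 < y \<bullet> i) \<and> sum ((\<bullet>) y) Basis < 1}"
    unfolding SS by (rule interior_std_simplex)
  have cS: "compact ?S" unfolding SS by (intro compact_convex_hull finite_imp_compact) simp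
  have convS: "convex ?S" unfolding SS by (rule convex_convex_hull)
  have "interior ?S \<noteq> {}"
    unfolding SS using interior_std_simplex_nonempty by blast
  then have "aff_dim ?S = DIM('b)"
    by (rule aff_dim_nonempty_interior)
  then have "rel_frontier ?S homeomorphic rel_frontier (cball (0::'b) 1)"
    using cS convS by (intro homeomorphic_rel_frontiers_convex_bounded_sets)
      (auto simp: compact_imp_bounded aff_dim_cball)
  moreover have "rel_frontier ?S = frontier ?S"
    using \<open>interior ?S \<noteq> {}\<close> by (rule rel_frontier_nonempty_interior)
  moreover have "rel_frontier (cball (0::'b) 1) = sphere 0 1" by simp
  moreover have "frontier ?S = {y \<in> ?S. (\<exists>i\<in>Basis. y \<bullet> i = 0) \<or> sum ((\<bullet>) y) Basis = 1}" (is "_ = ?T")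
    unfolding frontier_def int using cS
    by (auto simp: compact_imp_closed less_le)
  ultimately have TS: "?T homeomorphic sphere (0::'b) 1" by simp
  obtain b where b: "b \<in> B" using B by fastforce
  have "card (B - {b}) = card (Basis :: 'b set)" using B b by simp
  then obtain e where e: "bij_betw e (Basis :: 'b set) (B - {b})"
    using B finite_same_card_bij by (metis finite_Basis finite_Diff)
  \<comment> \<open>\<open>P\<close> drops the coordinate of the vertex \<open>b\<close>;
    \<open>Q\<close> recovers it from the total mass 1.\<close>
  define P where "P x = (\<Sum>i\<in>Basis. x (e i) *\<^sub>R i)" for x :: "'a \<Rightarrow> real"
  define Q where "Q y = (\<lambda>v. if v = b then 1 - sum ((\<bullet>) y) Basis else
      if v \<in> B then y \<bullet> inv_into Basis e v else 0)" for y :: 'b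
  have Pi: "P x \<bullet> i = x (e i)" if "i \<in> Basis" for x i
    using that by (simp add: P_def)
  have eB: "e i \<in> B" "e i \<noteq> b" if "i \<in> Basis" for i
    using e that by (auto simp: bij_betw_def)
  have inv: "inv_into Basis e (e i) = i" if "i \<in> Basis" for i
    using e that by (simp add: bij_betw_def)
  have invB: "inv_into Basis e v \<in> Basis" "e (inv_into Basis e v) = v" if "v \<in> B" "v \<noteq> b" for v
    using e that by (auto simp: bij_betw_def inv_into_into f_inv_into_f)
  have sumB: "sum x B = x b + (\<Sum>i\<in>Basis. x (e i))" for x :: "'a \<Rightarrow> real"
  proof -
    have "sum x (B - {b}) = (\<Sum>i\<in>Basis. x (e i))"
      using sum.reindex_bij_betw[OF e, of x] by simp
    then show ?thesis using B b by (simp add: sum.remove)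
  qed
  have P1: "P x \<in> ?T \<and> Q (P x) = x" if x: "x \<in> carrier_space ?K" for x
  proof -
    have x0: "\<forall>v. 0 \<le> x v" and sx: "supp x \<subset> B" "sum x (supp x) = 1"
      using x by (auto simp: carrier_space_iff)
    have s1: "x b + (\<Sum>i\<in>Basis. x (e i)) = 1"
      using sumB[of x] sum_supp[OF B(1)] sx by auto
    have sP: "sum ((\<bullet>) (P x)) Basis = (\<Sum>i\<in>Basis. x (e i))" by (simp add: Pi)
    obtain c where c: "c \<in> B" "x c = 0" using sx by (auto simp: supp_def)
    have "(\<exists>i\<in>Basis. P x \<bullet> i = 0) \<or> sum ((\<bullet>) (P x)) Basis = 1"
    proof (cases "c = b")
      case True then show ?thesis using s1 sP c by simp
    next
      case False then show ?thesis using invB[OF c(1)] c Pi by metis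
    qed
    moreover have "(\<Sum>i\<in>Basis. x (e i)) \<le> 1" using s1 x0[rule_format, of b] by linarith
    ultimately have "P x \<in> ?T" using x0 s1 sP Pi
      by auto
    moreover have "Q (P x) v = x v" for v
      using s1 sP invB Pi sx by (auto simp: Q_def supp_def)
    ultimately show ?thesis by auto
  qed
  have Q1: "Q y \<in> carrier_space ?K \<and> P (Q y) = y" if y: "y \<in> ?T" for y
  proof -
    have Qe: "Q y (e i) = y \<bullet> i" if "i \<in> Basis" for i
      using that eB inv by (simp add: Q_def)
    have Qb: "Q y b = 1 - sum ((\<bullet>) y) Basis" by (simp add: Q_def)
    have Q0: "0 \<le> Q y v" for v using y invB by (auto simp: Q_def)
    have "sum (Q y) B = 1" using sumB[of "Q y"] Qe Qb by simp
    moreover have sQ: "supp (Q y) \<subseteq> B" using b by (auto simp: supp_def Q_def)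
    ultimately have s1: "sum (Q y) (supp (Q y)) = 1" using sum_supp[OF B(1)] by metis
    have "(\<exists>i\<in>Basis. y \<bullet> i = 0) \<or> sum ((\<bullet>) y) Basis = 1" using y by blast
    then have "\<exists>c\<in>B. Q y c = 0"
    proof
      assume "\<exists>i\<in>Basis. y \<bullet> i = 0"
      then show ?thesis using Qe eB by metis
    next
      assume "sum ((\<bullet>) y) Basis = 1"
      then show ?thesis using Qb b by (intro bexI[of _ b]) simp_all
    qed
    then have "supp (Q y) \<subset> B" using sQ by (auto simp: supp_def)
    moreover have "supp (Q y) \<noteq> {}" using s1 by auto
    ultimately have "Q y \<in> carrier_space ?K" using Q0 s1 by (simp add: carrier_space_iff)
    moreover have "P (Q y) = y" by (rule euclidean_eqI) (simp add: Pi Qe)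
    ultimately show ?thesis ..
  qed
  have "continuous_on X P" for X
    unfolding P_def by (intro continuous_intros continuous_on_coordinate)
  moreover have "continuous_on X Q" for X
  proof (rule continuous_on_coordinatewise_then_product)
    show "continuous_on X (\<lambda>y. Q y v)" for v
      unfolding Q_def by (cases "v = b"; cases "v \<in> B") (simp_all, (intro continuous_intros)+)
  qed
  ultimately have "carrier_space ?K homeomorphic ?T"
    unfolding homeomorphic_minimal using P1 Q1
    by (intro exI[of _ P] exI[of _ Q]) blast
  then show ?thesis using TS homeomorphic_trans by blast
qed

section \<open>Connected carriers and the Jordan curve theorem\<close>

definition face_connected :: "'a set set \<Rightarrow> bool" where
  "face_connected M \<longleftrightarrow> (\<forall>S\<subseteq>M. S \<noteq> {} \<and>
     (\<forall>\<sigma>\<in>S. \<forall>\<tau>\<in>M. \<sigma> \<subseteq> \<tau> \<or> \<tau> \<subseteq> \<sigma> \<longrightarrow> \<tau> \<in> S) \<longrightarrow> S = M)"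

definition bary :: "'a set \<Rightarrow> 'a \<Rightarrow> real" where
  "bary \<sigma> = (\<lambda>v. if v \<in> \<sigma> then 1 / card \<sigma> else 0)"

lemma supp_bary: "finite \<sigma> \<Longrightarrow> supp (bary \<sigma>) = \<sigma>"
  by (auto simp: supp_def bary_def)

lemma bary_in_carrier: "\<sigma> \<in> M \<Longrightarrow> finite \<sigma> \<Longrightarrow> \<sigma> \<noteq> {} \<Longrightarrow> bary \<sigma> \<in> carrier_space M"
  by (simp add: carrier_space_iff supp_bary) (simp add: bary_def)

text \<open>On the straight segment from \<open>x\<close> to the barycentre of \<tau>, every point
  after the start has support exactly \<tau>. Hence the segment stays in the carrier even if
  \<open>M\<close> is not closed under subfaces, as happens for a surface with a triangle of edges
  removed.\<close>

lemma connected_component_bary: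
  assumes x: "x \<in> carrier_space M" and \<tau>: "supp x \<subseteq> \<tau>" "\<tau> \<in> M" "finite \<tau>" "\<tau> \<noteq> {}"
  shows "connected_component (carrier_space M) x (bary \<tau>)"
proof -
  define g where "g t = (\<lambda>v. (1 - t) * x v + t * bary \<tau> v)" for t :: real
  have "continuous_on {0..1} g"
    unfolding g_def by (intro continuous_on_coordinatewise_then_product continuous_intros)
  then have con: "connected (g ` {0..1})"
    by (rule connected_continuous_image) simp
  have x0: "\<And>v. 0 \<le> x v" and sx: "sum x (supp x) = 1"
    using x by (auto simp: carrier_space_iff)
  have "g t \<in> carrier_space M" if t: "0 \<le> t" "t \<le> 1" for t
  proof (cases "t = 0")
    case True
    then show ?thesis using x by (simp add: g_def)
  next
    case False
    have s: "supp (g t) = \<tau>"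
    proof (rule set_eqI)
      fix v
      have "0 < g t v" if "v \<in> \<tau>"
        using that t False x0[of v] \<tau> unfolding g_def bary_def
        by (intro add_nonneg_pos) (auto simp: card_gt_0_iff)
      moreover have "g t v = 0" if "v \<notin> \<tau>"
        using that \<tau>(1) by (auto simp: g_def bary_def supp_def)
      ultimately show "v \<in> supp (g t) \<longleftrightarrow> v \<in> \<tau>" by (force simp: supp_def)
    qed
    have "sum x \<tau> = 1" using sum_supp[OF \<tau>(3,1)] sx by simp
    moreover have "sum (bary \<tau>) \<tau> = 1" using \<tau> by (simp add: bary_def)
    ultimately have "sum (g t) \<tau> = 1"
      unfolding g_def by (simp add: sum.distrib flip: sum_distrib_left)
    moreover have "0 \<le> g t v" for v
      using t x0[of v] by (simp add: g_def bary_def)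
    ultimately show ?thesis using s \<tau> by (simp add: carrier_space_iff)
  qed
  then have "g ` {0..1} \<subseteq> carrier_space M" by auto
  moreover have "x = g 0" "bary \<tau> = g 1" by (simp_all add: g_def)
  then have "x \<in> g ` {0..1}" "bary \<tau> \<in> g ` {0..1}" by auto
  ultimately show ?thesis using con unfolding connected_component_def by blast
qed

lemma connected_carrier:
  assumes fin: "\<And>\<sigma>. \<sigma> \<in> M \<Longrightarrow> finite \<sigma> \<and> \<sigma> \<noteq> {}" and M: "face_connected M"
  shows "connected (carrier_space M)"
proof (rule connected_iff_connected_component[THEN iffD2], intro ballI)
  fix x y assume x: "x \<in> carrier_space M" and y: "y \<in> carrier_space M"
  let ?c = "connected_component (carrier_space M)"
  have own: "?c z (bary (supp z))" "supp z \<in> M" if "z \<in> carrier_space M" for z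
    using that fin connected_component_bary[OF that order_refl] by (auto simp: carrier_space_iff)
  have step: "?c (bary \<sigma>) (bary \<tau>)" if "\<sigma> \<subseteq> \<tau>" "\<sigma> \<in> M" "\<tau> \<in> M" for \<sigma> \<tau>
    using that fin by (intro connected_component_bary bary_in_carrier) (auto simp: supp_bary)
  define S where "S = {\<sigma> \<in> M. ?c x (bary \<sigma>)}"
  have "S = M"
  proof (rule M[unfolded face_connected_def, rule_format])
    show "S \<noteq> {} \<and> (\<forall>\<sigma>\<in>S. \<forall>\<tau>\<in>M. \<sigma> \<subseteq> \<tau> \<or> \<tau> \<subseteq> \<sigma> \<longrightarrow> \<tau> \<in> S)"
      using own[OF x] step unfolding S_def
      by (blast intro: connected_component_trans connected_component_sym)
  qed (simp add: S_def)
  then have "?c x (bary (supp y))" using own[OF y] by (auto simp: S_def)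
  then show "?c x y" using own[OF y] by (blast intro: connected_component_trans connected_component_sym)
qed

text \<open>Puncturing the sphere at a point \<open>p\<close> off the curve reduces the claim to the
  plane. There the inside of the curve is nonempty; pulled back, it is open and closed in the
  complement of \<open>J\<close> but misses \<open>p\<close>.\<close>

lemma Jordan_sphere:
  fixes J :: "(real ^ 3) set"
  assumes J: "J \<subseteq> sphere 0 1" "J \<noteq> sphere 0 1" "J homeomorphic sphere (0::complex) 1"
  shows "\<not> connected (sphere 0 1 - J)"
proof
  let ?S = "sphere (0 :: real ^ 3) 1"
  assume con: "connected (?S - J)"
  obtain p where p: "p \<in> ?S" "p \<notin> J" using J by blast
  have "?S - {p} homeomorphic (UNIV :: complex set)"
    using p by (intro homeomorphic_punctured_sphere_affine) (auto simp: aff_dim_UNIV)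
  then obtain f g where fg: "homeomorphism (?S - {p}) (UNIV :: complex set) f g"
    unfolding homeomorphic_def by blast
  have cf: "continuous_on (?S - {p}) f" and cg: "continuous_on UNIV g"
    and gf: "\<And>x. x \<in> ?S - {p} \<Longrightarrow> g (f x) = x" and fg': "\<And>y. f (g y) = y"
    and gS: "\<And>y. g y \<in> ?S - {p}"
    using fg unfolding homeomorphism_def by blast+
  have JS: "J \<subseteq> ?S - {p}" using p J by auto
  have "J homeomorphic f ` J"
    using homeomorphism_of_subsets[OF fg JS] unfolding homeomorphic_def by blast
  then have hom: "f ` J homeomorphic sphere (0::complex) 1"
    using J(3) homeomorphic_sym homeomorphic_trans by blast
  have cpt: "compact (f ` J)" using homeomorphic_compactness[OF hom] by simp
  define I where "I = inside (f ` J)"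
  have "\<not> connected (- (f ` J))"
    using Jordan_Brouwer_separation[OF hom] by simp
  moreover have "connected (outside (f ` J))"
    using cpt by (intro connected_outside) (auto simp: compact_imp_bounded)
  ultimately have I: "I \<noteq> {}"
    using inside_Un_outside[of "f ` J"] unfolding I_def by (metis sup_bot_left)
  have "compact (f ` J \<union> I)"
  proof -
    have "closed (f ` J \<union> I)" unfolding I_def
      using open_outside[of "f ` J"] cpt by (simp add: union_with_inside open_closed compact_imp_closed)
    moreover have "bounded (f ` J \<union> I)"
      unfolding I_def using cpt by (simp add: bounded_inside compact_imp_bounded)
    ultimately show ?thesis using compact_eq_bounded_closed by blast
  qed
  then have "closed (g ` (f ` J \<union> I))"
    by (intro compact_imp_closed compact_continuous_image continuous_on_subset[OF cg]) auto
  moreover have IJ: "I \<inter> f ` J = {}" unfolding I_def by simp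
  \<comment> \<open>\<open>I\<close> together with the planar curve is compact, so this equation
    exhibits the pulled-back inside as closed relative to the complement of
    \<open>J\<close>.\<close>
  have eq: "g ` I = (?S - J) \<inter> g ` (f ` J \<union> I)"
  proof -
    have "g ` f ` J = J" using gf JS by force
    moreover have "g ` I \<subseteq> ?S" using gS by blast
    moreover have "g y \<notin> J" if "y \<in> I" for y
      using that IJ imageI[of "g y" J f] unfolding fg' by blast
    then have "g ` I \<inter> J = {}" by blast
    ultimately show ?thesis by (auto simp: image_Un)
  qed
  ultimately have clo: "closedin (top_of_set (?S - J)) (g ` I)"
    by (metis closedin_closed_Int)
  have "openin (top_of_set (?S - {p})) ((?S - {p}) \<inter> f -` I)"
    using open_inside[of "f ` J"] cpt cf unfolding I_def
    by (intro continuous_openin_preimage_gen) (auto simp: compact_imp_closed)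
  moreover have "(?S - {p}) \<inter> f -` I = g ` I"
    using gS fg' gf by (force simp: image_iff)
  moreover have "openin (top_of_set ?S) (?S - {p})"
    by (intro openin_delete) simp
  ultimately have "openin (top_of_set ?S) (g ` I)"
    using openin_trans by metis
  then have "openin (top_of_set (?S - J)) (g ` I)"
    by (rule openin_subset_trans) (use eq in blast)+
  then have "g ` I = {} \<or> g ` I = ?S - J"
    using con clo unfolding connected_clopen by blast
  moreover have "p \<notin> g ` I" "p \<in> ?S - J" using gS p by auto
  ultimately show False using I by blast
qed

text \<open>The support decides whether a point lies on the three edges, so removing their carrier
  leaves exactly the carrier of \<open>K - T\<close>. On a sphere this would be the connected
  complement of a circle.\<close>

lemma nonseparating_triangle_not_sphere:
  assumes fin: "\<And>\<sigma>. \<sigma> \<in> K \<Longrightarrow> finite \<sigma> \<and> \<sigma> \<noteq> {}"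
    and B: "card B = 3" "T = {\<tau>. \<tau> \<noteq> {} \<and> \<tau> \<subset> B}" "T \<subseteq> K" "K \<noteq> T"
    and con: "face_connected (K - T)"
  shows "\<not> carrier_space K homeomorphic sphere (0 :: real ^ 3) 1"
proof
  assume "carrier_space K homeomorphic sphere (0 :: real ^ 3) 1"
  then obtain h k where h: "homeomorphism (carrier_space K) (sphere (0 :: real ^ 3) 1) h k"
    unfolding homeomorphic_def by blast
  have sub: "carrier_space T \<subseteq> carrier_space K" "carrier_space (K - T) \<subseteq> carrier_space K"
    using B(3) by (auto simp: carrier_space_iff)
  have inj: "inj_on h (carrier_space K)" and im: "h ` carrier_space K = sphere 0 1"
    and ch: "continuous_on (carrier_space K) h"
    using h by (auto simp: homeomorphism_def intro: inj_on_inverseI)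
  have diff: "carrier_space K - carrier_space T = carrier_space (K - T)"
    by (auto simp: carrier_space_iff)
  have eq: "sphere 0 1 - h ` carrier_space T = h ` carrier_space (K - T)"
    using inj_on_image_set_diff[OF inj, of "carrier_space K" "carrier_space T"] sub im diff by simp
  have "finite B" using B(1) card.infinite by fastforce
  then have "carrier_space T homeomorphic sphere (0 :: complex) 1"
    using carrier_simplex_boundary[where 'b = complex, of B] B by simp
  moreover have "carrier_space T homeomorphic h ` carrier_space T"
    using homeomorphism_of_subsets[OF h sub(1)] unfolding homeomorphic_def by blast
  ultimately have "h ` carrier_space T homeomorphic sphere (0 :: complex) 1"
    using homeomorphic_sym homeomorphic_trans by blast
  moreover have "h ` carrier_space T \<subseteq> sphere 0 1" using sub im by blast
  moreover obtain \<sigma> where "\<sigma> \<in> K - T" using B by blast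
  then have "bary \<sigma> \<in> carrier_space (K - T)" using fin by (intro bary_in_carrier) auto
  then have "h ` carrier_space (K - T) \<noteq> {}" by blast
  then have "h ` carrier_space T \<noteq> sphere 0 1" using eq by blast
  moreover have "connected (sphere 0 1 - h ` carrier_space T)"
    unfolding eq using fin con sub
    by (intro connected_continuous_image continuous_on_subset[OF ch] connected_carrier) auto
  ultimately show False using Jordan_sphere by blast
qed

text \<open>The total mass on \<open>S\<close> is a continuous function that takes only the values 0
  and 1 on the carrier, so it is constant when the carrier is connected.\<close>

lemma connected_carrier_vertex_split:
  assumes con: "connected (carrier_space K)" and fin: "\<And>\<sigma>. \<sigma> \<in> K \<Longrightarrow> finite \<sigma> \<and> \<sigma> \<noteq> {}"
    and S: "finite S" "\<And>\<sigma>. \<sigma> \<in> K \<Longrightarrow> \<sigma> \<subseteq> S \<or> \<sigma> \<inter> S = {}" and \<sigma>: "\<sigma> \<in> K" "\<sigma> \<subseteq> S" and \<tau>: "\<tau> \<in> K"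
  shows "\<tau> \<subseteq> S"
proof (rule ccontr)
  assume "\<not> \<tau> \<subseteq> S"
  then have \<tau>S: "\<tau> \<inter> S = {}" using S \<tau> by blast
  define g where "g x = sum x S" for x :: "'a \<Rightarrow> real"
  have g: "g x = (if supp x \<subseteq> S then 1 else 0)" if "x \<in> carrier_space K" for x
  proof -
    have "supp x \<in> K" "sum x (supp x) = 1" using that by (auto simp: carrier_space_iff)
    moreover have "sum x S = 0" if "supp x \<inter> S = {}"
      using that by (intro sum.neutral) (auto simp: supp_def)
    moreover have "supp x \<noteq> {}" using \<open>supp x \<in> K\<close> fin by blast
    ultimately show ?thesis
      using S(2)[of "supp x"] sum_supp[OF S(1), of x] unfolding g_def by (auto simp: Int_absorb2)
  qed
  have "continuous_on (carrier_space K) g"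
    unfolding g_def by (intro continuous_intros continuous_on_coordinate)
  then have "connected (g ` carrier_space K)" using con connected_continuous_image by blast
  moreover have "g (bary \<sigma>) = 1" "g (bary \<tau>) = 0"
    using g[OF bary_in_carrier] \<sigma> \<tau> fin[OF \<sigma>(1)] fin[OF \<tau>] \<tau>S by (auto simp: supp_bary)
  moreover have "bary \<sigma> \<in> carrier_space K" "bary \<tau> \<in> carrier_space K"
    using bary_in_carrier \<sigma> \<tau> fin by blast+
  ultimately have "connected (g ` carrier_space K)" "1 \<in> g ` carrier_space K" "0 \<in> g ` carrier_space K"
    by (metis imageI)+
  then have "1/2 \<in> g ` carrier_space K"
    using connectedD_interval[of "g ` carrier_space K" 0 1 "1/2"] by simp
  then obtain x where "x \<in> carrier_space K" "g x = 1/2" by (metis imageE)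
  then show False using g[of x] by (simp split: if_splits)
qed

section \<open>Families of facets\<close>

definition closed_family :: "nat \<Rightarrow> 'a set set \<Rightarrow> bool" where
  "closed_family k F \<longleftrightarrow> finite F \<and> (\<forall>f\<in>F. finite f \<and> card f = k) \<and>
     (\<forall>f\<in>F. \<forall>v\<in>f. card {g \<in> F. f - {v} \<subseteq> g} = 2)"

lemma closed_familyD:
  assumes "closed_family k F"
  shows "finite F" "f \<in> F \<Longrightarrow> finite f" "f \<in> F \<Longrightarrow> card f = k"
    "f \<in> F \<Longrightarrow> v \<in> f \<Longrightarrow> card {g \<in> F. f - {v} \<subseteq> g} = 2"
  using assms by (simp_all add: closed_family_def)

definition lk :: "'a \<Rightarrow> 'a set set \<Rightarrow> 'a set set" where
  "lk v F = (\<lambda>f. f - {v}) ` {f \<in> F. v \<in> f}"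

text \<open>The set \<open>S\<close> ranges over unions of components of the vertex set. This is the
  combinatorial form of connectedness of the carrier.\<close>

definition conn :: "'a set set \<Rightarrow> bool" where
  "conn F \<longleftrightarrow> (\<forall>S\<subseteq>\<Union>F. (\<forall>f\<in>F. f \<subseteq> S \<or> f \<inter> S = {}) \<longrightarrow> S = {} \<or> S = \<Union>F)"

primrec conn_links :: "nat \<Rightarrow> 'a set set \<Rightarrow> bool" where
  "conn_links 0 F \<longleftrightarrow> True"
| "conn_links (Suc k) F \<longleftrightarrow> conn F \<and> (\<forall>v\<in>\<Union>F. conn_links k (lk v F))"

text \<open>Here \<open>k\<close> is the number of vertices of a facet, one more than the dimension.
  The \<open>k - 1\<close> levels of connectedness concern the family itself and its iterated vertex
  links down to graphs; links of edges appear as links inside links.\<close>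

definition normal_family :: "nat \<Rightarrow> 'a set set \<Rightarrow> bool" where
  "normal_family k F \<longleftrightarrow> closed_family k F \<and> F \<noteq> {} \<and> conn_links (k - 1) F"

lemma in_lk_iff: "f \<in> lk v F \<longleftrightarrow> v \<notin> f \<and> insert v f \<in> F"
proof
  assume "f \<in> lk v F"
  then show "v \<notin> f \<and> insert v f \<in> F" by (auto simp: lk_def insert_absorb)
next
  assume "v \<notin> f \<and> insert v f \<in> F"
  then show "f \<in> lk v F" unfolding lk_def by (intro image_eqI[of _ _ "insert v f"]) auto
qed

lemma Union_lk_subset: "\<Union>(lk v F) \<subseteq> \<Union>F - {v}"
  by (auto simp: lk_def)

lemma lk_mono: "G \<subseteq> F \<Longrightarrow> lk v G \<subseteq> lk v F"
  by (auto simp: lk_def)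

lemma lk_empty_iff: "lk v F = {} \<longleftrightarrow> v \<notin> \<Union>F"
  by (auto simp: lk_def)

lemma closed_family_lk:
  assumes F: "closed_family (Suc k) F"
  shows "closed_family k (lk v F)"
  unfolding closed_family_def
proof (intro conjI ballI)
  show "finite (lk v F)" using F by (auto simp: closed_family_def lk_def)
next
  fix f assume "f \<in> lk v F"
  then have f: "v \<notin> f" "insert v f \<in> F" by (auto simp: in_lk_iff)
  then have "finite (insert v f)" "card (insert v f) = Suc k"
    using closed_familyD(2,3)[OF F f(2)] by (simp_all only:)
  then show "finite f" "card f = k" using f by auto
  fix u assume u: "u \<in> f"
  have "card {g \<in> F. insert v f - {u} \<subseteq> g} = 2"
    using closed_familyD(4)[OF F f(2)] u by simp
  moreover have "bij_betw (\<lambda>g. g - {v}) {g \<in> F. insert v f - {u} \<subseteq> g} {g \<in> lk v F. f - {u} \<subseteq> g}"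
  proof (rule bij_betw_imageI)
    show "inj_on (\<lambda>g. g - {v}) {g \<in> F. insert v f - {u} \<subseteq> g}"
      using f u by (auto simp: inj_on_def)
    show "(\<lambda>g. g - {v}) ` {g \<in> F. insert v f - {u} \<subseteq> g} = {g \<in> lk v F. f - {u} \<subseteq> g}"
    proof (intro set_eqI iffI)
      fix g assume "g \<in> (\<lambda>g. g - {v}) ` {g \<in> F. insert v f - {u} \<subseteq> g}"
      then show "g \<in> {g \<in> lk v F. f - {u} \<subseteq> g}" using f u by (auto simp: lk_def)
    next
      fix g assume "g \<in> {g \<in> lk v F. f - {u} \<subseteq> g}"
      then show "g \<in> (\<lambda>g. g - {v}) ` {g \<in> F. insert v f - {u} \<subseteq> g}"
        by (intro image_eqI[of _ _ "insert v g"]) (auto simp: in_lk_iff)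
    qed
  qed
  ultimately show "card {g \<in> lk v F. f - {u} \<subseteq> g} = 2"
    using bij_betw_same_card by fastforce
qed

lemma normal_family_lk:
  assumes F: "normal_family (Suc k) F" and k: "1 \<le> k" and v: "v \<in> \<Union>F"
  shows "normal_family k (lk v F)"
proof -
  obtain j where "k = Suc j" using k by (cases k) auto
  then show ?thesis
    using F v closed_family_lk by (auto simp: normal_family_def lk_empty_iff)
qed

text \<open>By induction, \<open>G\<close> and \<open>F\<close> have the same link at every vertex
  of \<open>G\<close>. So every facet of \<open>F\<close> that meets the vertex set of
  \<open>G\<close> belongs to \<open>G\<close>, and connectedness spreads this to all vertices. In
  the base case both families consist of two points.\<close>

lemma normal_family_indecomposable:
  assumes "normal_family k F" "1 \<le> k" "G \<subseteq> F" "G \<noteq> {}" "closed_family k G"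
  shows "G = F"
  using assms
proof (induction k arbitrary: F G)
  case (Suc k)
  have cF: "closed_family (Suc k) F" using Suc.prems by (simp add: normal_family_def)
  then have finF: "finite F" by (simp add: closed_family_def)
  show ?case
  proof (cases "k = 0")
    case True
    have two: "card H = 2" if H: "closed_family (Suc k) H" "H \<noteq> {}" for H :: "'a set set"
    proof -
      obtain f where f: "f \<in> H" using H by blast
      then have "card f = 1" using H True by (simp add: closed_family_def)
      then obtain a where "f = {a}" using card_1_singletonE by blast
      then have "card {g \<in> H. {} \<subseteq> g} = 2" using closed_familyD(4)[OF H(1) f, of a] by simp
      then show ?thesis by simp
    qed
    have "F \<noteq> {}" using Suc.prems by blast
    then have "card G = card F" using two[OF Suc.prems(5,4)] two[OF cF] by simp
    then show ?thesis by (rule card_subset_eq[OF finF Suc.prems(3)])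
  next
    case False
    have sub: "f \<in> G" if f: "f \<in> F" "v \<in> f" "v \<in> \<Union>G" for f v
    proof -
      have "v \<in> \<Union>F" using f by blast
      then have "lk v G = lk v F"
        using False Suc.prems f by (intro Suc.IH normal_family_lk closed_family_lk lk_mono) (auto simp: lk_empty_iff)
      then have "f - {v} \<in> lk v G" using f by (auto simp: lk_def)
      then show ?thesis using f by (simp add: in_lk_iff insert_absorb)
    qed
    have "conn F" using Suc.prems False by (cases k) (auto simp: normal_family_def)
    moreover have "\<Union>G \<subseteq> \<Union>F" using Suc.prems by blast
    moreover have "\<forall>f\<in>F. f \<subseteq> \<Union>G \<or> f \<inter> \<Union>G = {}" using sub by blast
    ultimately have "\<Union>G = {} \<or> \<Union>G = \<Union>F" unfolding conn_def by blast
    moreover have ne: "f \<noteq> {}" if "f \<in> F" for f using that cF by (auto simp: closed_family_def)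
    then have "\<Union>G \<noteq> {}" using Suc.prems by blast
    ultimately have eq: "\<Union>G = \<Union>F" by blast
    show ?thesis
    proof
      show "F \<subseteq> G"
      proof
        fix f assume f: "f \<in> F"
        then obtain v where "v \<in> f" using ne by blast
        then show "f \<in> G" using sub[OF f] f unfolding eq by blast
      qed
    qed (use Suc.prems in blast)
  qed
qed simp

section \<open>Isomorphisms of facet families\<close>

definition fam_iso :: "'a set set \<Rightarrow> 'b set set \<Rightarrow> bool" where
  "fam_iso F G \<longleftrightarrow> (\<exists>h. inj_on h (\<Union>F) \<and> G = (`) h ` F)"

lemma Union_image_image: "\<Union>((`) h ` F) = h ` \<Union>F"
  by auto

lemma fam_iso_trans: "fam_iso F G \<Longrightarrow> fam_iso G H \<Longrightarrow> fam_iso F H"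
proof -
  assume "fam_iso F G" "fam_iso G H"
  then obtain h g where "inj_on h (\<Union>F)" "G = (`) h ` F" "inj_on g (\<Union>G)" "H = (`) g ` G"
    unfolding fam_iso_def by blast
  then show ?thesis unfolding fam_iso_def
    by (intro exI[of _ "g \<circ> h"]) (auto simp: image_comp Union_image_image intro: comp_inj_on)
qed

lemma fam_iso_sym:
  assumes "fam_iso F G"
  shows "fam_iso G F"
proof -
  obtain h where h: "inj_on h (\<Union>F)" "G = (`) h ` F" using assms unfolding fam_iso_def by blast
  have "inv_into (\<Union>F) h ` h ` f = f" if "f \<in> F" for f
    using h that by (intro inv_into_image_cancel) auto
  then have "(`) (inv_into (\<Union>F) h) ` G = F" unfolding h image_image by simp
  moreover have "inj_on (inv_into (\<Union>F) h) (\<Union>G)"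
    unfolding h Union_image_image by (rule inj_on_inv_into) simp
  ultimately show ?thesis unfolding fam_iso_def by metis
qed

lemma fam_iso_image: "inj_on h (\<Union>F) \<Longrightarrow> fam_iso F ((`) h ` F)"
  unfolding fam_iso_def by blast

lemma lk_image:
  assumes h: "inj_on h (\<Union>F)" and v: "v \<in> \<Union>F"
  shows "lk (h v) ((`) h ` F) = (`) h ` lk v F"
proof -
  have *: "h v \<in> h ` f \<longleftrightarrow> v \<in> f" "h ` (f - {v}) = h ` f - {h v}" if "f \<in> F" for f
    using that h v inj_on_image_mem_iff[OF h v, of f] inj_on_image_set_diff[OF h, of f "{v}"] by auto
  have "lk (h v) ((`) h ` F) = (\<lambda>f. h ` f - {h v}) ` {f \<in> F. v \<in> f}"
    unfolding lk_def using * by (auto simp: image_iff)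
  also have "\<dots> = (`) h ` lk v F"
    unfolding lk_def image_image using * by (intro image_cong) auto
  finally show ?thesis .
qed

lemma inj_on_image_family: "inj_on h (\<Union>F) \<Longrightarrow> inj_on ((`) h) F"
  using inj_on_subset[OF inj_on_image_Pow[of h "\<Union>F"]] by blast

lemma closed_family_image:
  assumes h: "inj_on h (\<Union>F)" and F: "closed_family k F"
  shows "closed_family k ((`) h ` F)"
proof -
  have sub: "f \<subseteq> \<Union>F" if "f \<in> F" for f using that by blast
  have "card {g \<in> (`) h ` F. h ` f - {h v} \<subseteq> g} = 2" if f: "f \<in> F" "v \<in> f" for f v
  proof -
    have d: "h ` f - {h v} = h ` (f - {v})"
    proof -
      have "h ` (f - {v}) = h ` f - h ` {v}"
        by (rule inj_on_image_set_diff[OF h]) (use f in blast)+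
      then show ?thesis by simp
    qed
    have "h ` (f - {v}) \<subseteq> h ` g \<longleftrightarrow> f - {v} \<subseteq> g" if "g \<in> F" for g
      by (rule inj_on_image_subset_iff[OF h]) (use sub[OF f(1)] sub[OF that] in blast)+
    then have "{g \<in> F. f - {v} \<subseteq> g} = {g \<in> F. h ` (f - {v}) \<subseteq> h ` g}"
      by blast
    then have "{g \<in> (`) h ` F. h ` (f - {v}) \<subseteq> g} = (`) h ` {g \<in> F. f - {v} \<subseteq> g}"
      by (simp only:) blast
    moreover have "inj_on ((`) h) {g \<in> F. f - {v} \<subseteq> g}"
      using inj_on_image_family[OF h] by (rule inj_on_subset) blast
    ultimately show ?thesis using F f by (simp add: d card_image closed_family_def)
  qed
  moreover have "card (h ` f) = card f" if "f \<in> F" for f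
    using inj_on_subset[OF h sub[OF that]] by (rule card_image)
  ultimately show ?thesis using F by (auto simp: closed_family_def)
qed

lemma conn_image:
  assumes h: "inj_on h (\<Union>F)" and F: "conn F"
  shows "conn ((`) h ` F)"
  unfolding conn_def Union_image_image
proof (intro allI impI)
  fix S assume S: "S \<subseteq> h ` \<Union>F" and sep: "\<forall>f\<in>(`) h ` F. f \<subseteq> S \<or> f \<inter> S = {}"
  define T where "T = {v \<in> \<Union>F. h v \<in> S}"
  have ST: "S = h ` T"
  proof (intro equalityI subsetI)
    fix x assume "x \<in> S"
    then have "x \<in> h ` \<Union>F" using S by (rule rev_subsetD)
    then obtain v where "v \<in> \<Union>F" "x = h v" by (rule imageE)
    then show "x \<in> h ` T" using \<open>x \<in> S\<close> by (simp add: T_def)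
  qed (auto simp: T_def)
  have "T \<subseteq> \<Union>F" by (auto simp: T_def)
  moreover have "f \<subseteq> T \<or> f \<inter> T = {}" if f: "f \<in> F" for f
  proof -
    have "h ` f \<subseteq> S \<or> h ` f \<inter> S = {}" using sep f by simp
    then show ?thesis using f unfolding T_def by blast
  qed
  ultimately have "T = {} \<or> T = \<Union>F" using F unfolding conn_def by blast
  then show "S = {} \<or> S = h ` \<Union>F" using ST by blast
qed

lemma conn_links_image:
  "inj_on h (\<Union>F) \<Longrightarrow> conn_links k F \<Longrightarrow> conn_links k ((`) h ` F)"
proof (induction k arbitrary: F)
  case (Suc k)
  have A: "conn_links k (lk w ((`) h ` F))" if wF: "w \<in> h ` \<Union>F" for w
  proof -
    obtain v where v: "v \<in> \<Union>F" and w: "w = h v" using wF by (rule imageE)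
    show ?thesis unfolding w lk_image[OF Suc.prems(1) v]
      using Suc.prems v Union_lk_subset[of v F] by (intro Suc.IH inj_on_subset[OF Suc.prems(1)]) auto
  qed
  have C: "conn F" using Suc.prems(2) by simp
  show ?case
    unfolding conn_links.simps
  proof (intro conjI ballI)
    show "conn ((`) h ` F)" by (rule conn_image[OF Suc.prems(1) C])
    fix w assume "w \<in> \<Union>((`) h ` F)"
    then have "w \<in> h ` \<Union>F" by (simp only: Union_image_image)
    then show "conn_links k (lk w ((`) h ` F))" by (rule A)
  qed
next
  case 0
  show ?case by (rule conn_links.simps(1)[THEN iffD2, OF TrueI])
qed

lemma normal_family_iso:
  assumes "fam_iso F G" "normal_family k F"
  shows "normal_family k G"
proof -
  obtain h where h: "inj_on h (\<Union>F)" "G = (`) h ` F" using assms(1) unfolding fam_iso_def by blast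
  have F: "closed_family k F" "F \<noteq> {}" "conn_links (k - 1) F"
    using assms(2) unfolding normal_family_def by blast+
  have "(`) h ` F \<noteq> {}" using F(2) by (simp only: image_is_empty not_False_eq_True)
  then show ?thesis
    using closed_family_image[OF h(1) F(1)] conn_links_image[OF h(1) F(3)]
    unfolding normal_family_def h(2) by blast
qed

section \<open>The passage between facet families and complexes\<close>

lemma complex_of_image: "complex_of ((`) h ` F) = (`) h ` complex_of F"
proof (intro set_eqI iffI)
  fix t assume "t \<in> complex_of ((`) h ` F)"
  then obtain f where f: "f \<in> F" "t \<subseteq> h ` f" "t \<noteq> {}" by (auto simp: complex_of_def)
  then have "t = h ` {x \<in> f. h x \<in> t}" "{x \<in> f. h x \<in> t} \<in> complex_of F"
    by (auto simp: complex_of_def)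
  then show "t \<in> (`) h ` complex_of F" by (rule image_eqI)
next
  fix t assume "t \<in> (`) h ` complex_of F"
  then obtain s where "s \<in> complex_of F" "t = h ` s" by (elim imageE)
  then show "t \<in> complex_of ((`) h ` F)" by (auto simp: complex_of_def)
qed

lemma vertices_complex_of: "vertices (complex_of F) = \<Union>F"
proof
  show "vertices (complex_of F) \<subseteq> \<Union>F" unfolding vertices_def complex_of_def by blast
  show "\<Union>F \<subseteq> vertices (complex_of F)" unfolding vertices_def complex_of_def
  proof
    fix x assume "x \<in> \<Union>F"
    then have "{x} \<in> {\<tau>. \<tau> \<noteq> {} \<and> (\<exists>\<sigma>\<in>F. \<tau> \<subseteq> \<sigma>)}" by blast
    then show "x \<in> \<Union>{\<tau>. \<tau> \<noteq> {} \<and> (\<exists>\<sigma>\<in>F. \<tau> \<subseteq> \<sigma>)}" by blast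
  qed
qed

lemma isomorphic_complex_of:
  assumes "fam_iso F G"
  shows "isomorphic (complex_of F) (complex_of G)"
proof -
  obtain h where h: "inj_on h (\<Union>F)" "G = (`) h ` F" using assms unfolding fam_iso_def by blast
  then have "bij_betw h (\<Union>F) (\<Union>G)" by (intro bij_betw_imageI) (simp_all only: Union_image_image)
  then show ?thesis
    unfolding isomorphic_def vertices_complex_of by (intro exI[of _ h]) (simp only: h(2) complex_of_image)
qed

lemma carrier_iso:
  assumes "fam_iso F G"
  shows "carrier_space (complex_of F) homeomorphic carrier_space (complex_of G)"
proof -
  obtain h where h: "inj_on h (\<Union>F)" "G = (`) h ` F" using assms unfolding fam_iso_def by blast
  moreover have "\<Union>(complex_of F) = \<Union>F" using vertices_complex_of unfolding vertices_def .
  ultimately show ?thesis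
    using carrier_image_homeomorphic[of h "complex_of F"] by (simp add: complex_of_image)
qed

lemma link_complex_of: "link (complex_of F) {v} = complex_of (lk v F)"
proof (intro set_eqI iffI)
  fix t assume "t \<in> link (complex_of F) {v}"
  then show "t \<in> complex_of (lk v F)"
    unfolding link_def complex_of_def lk_def by auto
next
  fix t assume "t \<in> complex_of (lk v F)"
  then obtain f where f: "f \<in> F" "v \<in> f" "t \<subseteq> f - {v}" "t \<noteq> {}"
    unfolding complex_of_def lk_def by auto
  then have "t \<union> {v} \<subseteq> f" by blast
  then show "t \<in> link (complex_of F) {v}"
    using f unfolding link_def complex_of_def by auto
qed

lemma link_link_complex_of:
  assumes "u \<noteq> v"
  shows "link (complex_of F) {v, u} = complex_of (lk u (lk v F))"
proof (intro set_eqI iffI)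
  fix t assume "t \<in> link (complex_of F) {v, u}"
  then obtain f where f: "t \<noteq> {}" "t \<inter> {v, u} = {}" "f \<in> F" "t \<union> {v, u} \<subseteq> f"
    unfolding link_def complex_of_def by auto
  then have "f - {v} - {u} \<in> lk u (lk v F)" unfolding lk_def using assms by blast
  moreover have "t \<subseteq> f - {v} - {u}" using f by blast
  ultimately show "t \<in> complex_of (lk u (lk v F))" using f(1) unfolding complex_of_def by blast
next
  fix t assume "t \<in> complex_of (lk u (lk v F))"
  then obtain f where f: "f \<in> F" "v \<in> f" "u \<in> f" "t \<subseteq> f - {v} - {u}" "t \<noteq> {}"
    unfolding complex_of_def lk_def by auto
  then have "t \<union> {v, u} \<subseteq> f" by blast
  then show "t \<in> link (complex_of F) {v, u}"
    using f unfolding link_def complex_of_def by auto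
qed

text \<open>From topology to combinatorics, a splitting of the vertices would split the carrier.
  Conversely, in a class of faces closed under incidence the vertices form a set that no facet cuts,
  hence all vertices.\<close>

lemma connected_complex_of_iff:
  assumes fin: "finite F" "\<And>f. f \<in> F \<Longrightarrow> finite f \<and> f \<noteq> {}"
  shows "connected_complex (complex_of F) \<longleftrightarrow> conn F"
proof
  have finK: "finite \<sigma> \<and> \<sigma> \<noteq> {}" if "\<sigma> \<in> complex_of F" for \<sigma>
    using that fin unfolding complex_of_def by (auto intro: finite_subset)
  have FK: "f \<in> complex_of F" if "f \<in> F" for f using that fin unfolding complex_of_def by blast
  {
    assume con: "connected_complex (complex_of F)"
    show "conn F"
      unfolding conn_def
    proof (intro allI impI)
      fix S assume S: "S \<subseteq> \<Union>F" and sep: "\<forall>f\<in>F. f \<subseteq> S \<or> f \<inter> S = {}"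
      have finS: "finite S" using S fin by (meson finite_Union finite_subset)
      have sep': "\<sigma> \<subseteq> S \<or> \<sigma> \<inter> S = {}" if "\<sigma> \<in> complex_of F" for \<sigma>
        using that sep unfolding complex_of_def by blast
      show "S = {} \<or> S = \<Union>F"
      proof (cases "S = {}")
        case False
        then obtain f where f: "f \<in> F" "f \<subseteq> S" using S sep by blast
        have "g \<subseteq> S" if "g \<in> F" for g
          using connected_carrier_vertex_split[OF con[unfolded connected_complex_def] finK finS sep' FK[OF f(1)] f(2) FK[OF that]] .
        then show ?thesis using S by blast
      qed simp
    qed
  next
    assume con: "conn F"
    have "face_connected (complex_of F)"
      unfolding face_connected_def
    proof (intro allI impI)
      fix S assume S: "S \<subseteq> complex_of F" and
        "S \<noteq> {} \<and> (\<forall>\<sigma>\<in>S. \<forall>\<tau>\<in>complex_of F. \<sigma> \<subseteq> \<tau> \<or> \<tau> \<subseteq> \<sigma> \<longrightarrow> \<tau> \<in> S)"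
      then have ne: "S \<noteq> {}"
        and cl: "\<And>\<sigma> \<tau>. \<sigma> \<in> S \<Longrightarrow> \<tau> \<in> complex_of F \<Longrightarrow> \<sigma> \<subseteq> \<tau> \<or> \<tau> \<subseteq> \<sigma> \<Longrightarrow> \<tau> \<in> S" by blast+
      define W where "W = {v. {v} \<in> S}"
      have vK: "{v} \<in> complex_of F" if "v \<in> \<sigma>" "\<sigma> \<in> complex_of F" for v \<sigma>
        using that unfolding complex_of_def by auto
      have sub: "\<sigma> \<subseteq> W" if "\<sigma> \<in> S" for \<sigma>
        using that cl[OF that] vK S by (auto simp: W_def)
      have WF: "W \<subseteq> \<Union>F" using S by (auto simp: W_def complex_of_def)
      have sepW: "\<forall>f\<in>F. f \<subseteq> W \<or> f \<inter> W = {}"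
      proof (intro ballI)
        fix f assume f: "f \<in> F"
        show "f \<subseteq> W \<or> f \<inter> W = {}"
        proof (cases "f \<inter> W = {}")
          case False
          then obtain v where "v \<in> f" "{v} \<in> S" by (auto simp: W_def)
          then have "f \<in> S" using cl[of "{v}" f] FK[OF f] by blast
          then show ?thesis using sub by blast
        qed simp
      qed
      obtain \<sigma> where "\<sigma> \<in> S" using ne by blast
      moreover have "\<sigma> \<noteq> {}" using finK S \<open>\<sigma> \<in> S\<close> by blast
      ultimately have "W \<noteq> {}" using sub by blast
      moreover have "W = {} \<or> W = \<Union>F"
        using con[unfolded conn_def, THEN spec, THEN mp, OF WF, THEN mp, OF sepW] .
      ultimately have W: "W = \<Union>F" by simp
      have "\<tau> \<in> S" if "\<tau> \<in> complex_of F" for \<tau>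
      proof -
        obtain v where v: "v \<in> \<tau>" using finK[OF \<open>\<tau> \<in> complex_of F\<close>] by blast
        then have "{v} \<in> S" using W that by (auto simp: W_def complex_of_def)
        then show ?thesis using cl[of "{v}" \<tau>] that v by blast
      qed
      then show "S = complex_of F" using S by blast
    qed
    then show "connected_complex (complex_of F)"
      unfolding connected_complex_def using finK by (intro connected_carrier) auto
  }
qed

lemma complex_of_closed_family:
  assumes F: "closed_family (Suc d) F"
  shows "abstract_complex (complex_of F)" "faces_of_dim d (complex_of F) = F"
    "\<sigma> \<in> complex_of F \<Longrightarrow> card \<sigma> \<le> Suc d"
proof -
  have fF: "finite F" "\<And>f. f \<in> F \<Longrightarrow> finite f \<and> card f = Suc d"
    using F by (auto simp: closed_family_def)
  have "complex_of F \<subseteq> Pow (\<Union>F)" unfolding complex_of_def by blast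
  then have "finite (complex_of F)" using fF by (meson finite_Pow_iff finite_Union finite_subset)
  moreover have fin: "finite \<sigma> \<and> \<sigma> \<noteq> {} \<and> card \<sigma> \<le> Suc d" if sK: "\<sigma> \<in> complex_of F" for \<sigma>
  proof -
    obtain f where "f \<in> F" "\<sigma> \<subseteq> f" "\<sigma> \<noteq> {}" using sK unfolding complex_of_def by blast
    then show ?thesis using fF(2)[of f] finite_subset[of \<sigma> f] card_mono[of f \<sigma>] by simp
  qed
  moreover have "\<tau> \<in> complex_of F" if "\<sigma> \<in> complex_of F" "\<tau> \<noteq> {} \<and> \<tau> \<subseteq> \<sigma>" for \<sigma> \<tau>
    using that unfolding complex_of_def by blast
  ultimately show "abstract_complex (complex_of F)"
    unfolding abstract_complex_def by blast
  show le: "card \<sigma> \<le> Suc d" if "\<sigma> \<in> complex_of F" for \<sigma>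
    using fin that by blast
  show "faces_of_dim d (complex_of F) = F"
  proof (intro set_eqI iffI)
    fix \<sigma> assume "\<sigma> \<in> faces_of_dim d (complex_of F)"
    then obtain f where f: "f \<in> F" "\<sigma> \<subseteq> f" "card \<sigma> = Suc d"
      unfolding faces_of_dim_def complex_of_def by auto
    then have "\<sigma> = f" using fF by (metis card_subset_eq)
    then show "\<sigma> \<in> F" using f by simp
  next
    fix \<sigma> assume s: "\<sigma> \<in> F"
    then have "card \<sigma> = Suc d" "\<sigma> \<noteq> {}" using fF(2)[OF s] by auto
    then show "\<sigma> \<in> faces_of_dim d (complex_of F)"
      using s unfolding faces_of_dim_def complex_of_def by auto
  qed
qed

text \<open>After this equivalence the topological notions survive only in the question whether a
  vertex link is a sphere.\<close>

lemma normal_pseudomanifold_3_iff: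
  "normal_pseudomanifold 3 K \<longleftrightarrow> (\<exists>F. normal_family 4 F \<and> K = complex_of F)"
proof -
  have links: "conn_links 3 F \<longleftrightarrow> connected_complex (complex_of F) \<and>
      (\<forall>\<sigma>\<in>complex_of F. card \<sigma> \<le> 2 \<longrightarrow> connected_complex (link (complex_of F) \<sigma>))"
    (is "_ \<longleftrightarrow> ?R") if F: "closed_family 4 F" for F :: "'a set set"
  proof -
    have ne: "finite F" "finite f \<and> f \<noteq> {}" if "f \<in> F" for f
      using F that by (auto simp: closed_family_def)
    have F1: "closed_family 3 (lk v F)" for v using closed_family_lk[of 3 F] F by simp
    have F2: "closed_family 2 (lk u (lk v F))" for u v using closed_family_lk[of 2 "lk v F"] F1 by simp
    have c0: "connected_complex (complex_of F) \<longleftrightarrow> conn F"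
      using F by (intro connected_complex_of_iff) (auto simp: closed_family_def)
    have c1: "connected_complex (complex_of (lk v F)) \<longleftrightarrow> conn (lk v F)" for v
      using F1[of v] by (intro connected_complex_of_iff) (auto simp: closed_family_def)
    have c2: "connected_complex (complex_of (lk u (lk v F))) \<longleftrightarrow> conn (lk u (lk v F))" for u v
      using F2[of u v] by (intro connected_complex_of_iff) (auto simp: closed_family_def)
    have L: "conn_links 3 F \<longleftrightarrow> conn F \<and> (\<forall>v\<in>\<Union>F. conn (lk v F) \<and>
      (\<forall>u\<in>\<Union>(lk v F). conn (lk u (lk v F))))"
      by (simp add: numeral_3_eq_3)
    have v: "v \<in> \<Union>F \<longleftrightarrow> {v} \<in> complex_of F" for v by (auto simp: complex_of_def)
    have uv: "u \<in> \<Union>(lk v F) \<longleftrightarrow> u \<noteq> v \<and> {v, u} \<in> complex_of F" for u v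
      by (auto simp: complex_of_def lk_def)
    show ?thesis
    proof
      assume "conn_links 3 F"
      then have A: "conn F" "\<And>v. v \<in> \<Union>F \<Longrightarrow> conn (lk v F)"
        "\<And>u v. v \<in> \<Union>F \<Longrightarrow> u \<in> \<Union>(lk v F) \<Longrightarrow> conn (lk u (lk v F))"
        unfolding L by blast+
      show ?R
      proof (intro conjI ballI impI)
        show "connected_complex (complex_of F)" using A c0 by simp
        fix \<sigma> assume \<sigma>: "\<sigma> \<in> complex_of F" "card \<sigma> \<le> 2"
        then have "card \<sigma> \<noteq> 0" using complex_of_closed_family(1)[of 3 F] F
          by (auto simp: abstract_complex_def)
        then consider "card \<sigma> = 1" | "card \<sigma> = 2" using \<sigma> by linarith
        then show "connected_complex (link (complex_of F) \<sigma>)"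
        proof cases
          case 1
          then obtain v where "\<sigma> = {v}" using card_1_singletonE by blast
          then show ?thesis using \<sigma> A c1 v by (simp add: link_complex_of)
        next
          case 2
          then obtain u w where uw: "\<sigma> = {w, u}" "w \<noteq> u" by (meson card_2_iff)
          then have "w \<in> \<Union>F" "u \<in> \<Union>(lk w F)" using \<sigma> uv by (auto simp: complex_of_def)
          then show ?thesis using A c2 uw by (simp add: link_link_complex_of)
        qed
      qed
    next
      assume R: ?R
      show "conn_links 3 F"
        unfolding L
      proof (intro conjI ballI)
        show "conn F" using R c0 by simp
        fix w assume w: "w \<in> \<Union>F"
        then have "connected_complex (link (complex_of F) {w})"
          using R v by (metis card.empty card.insert empty_iff finite.emptyI one_le_numeral One_nat_def)
        then show "conn (lk w F)" using c1 by (simp add: link_complex_of)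
        fix u assume "u \<in> \<Union>(lk w F)"
        then have u: "u \<noteq> w" "{w, u} \<in> complex_of F" using uv by blast+
        then have "connected_complex (link (complex_of F) {w, u})"
          using R by (simp add: card_insert_if)
        then show "conn (lk u (lk w F))" using c2 u by (simp add: link_link_complex_of)
      qed
    qed
  qed
  show ?thesis
  proof
    assume N: "normal_pseudomanifold 3 K"
    define F where "F = faces_of_dim 3 K"
    have K: "abstract_complex K" "F \<noteq> {}" "\<forall>\<sigma>\<in>K. \<exists>\<tau>\<in>F. \<sigma> \<subseteq> \<tau>"
      "\<forall>\<rho>\<in>K. card \<rho> = 3 \<longrightarrow> card {\<sigma> \<in> F. \<rho> \<subseteq> \<sigma>} = 2"
      using N by (auto simp: normal_pseudomanifold_def weak_pseudomanifold_def pure_complex_def F_def)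
    have FK: "F \<subseteq> K" "\<And>f. f \<in> F \<Longrightarrow> finite f \<and> card f = 4"
      using K(1) by (auto simp: F_def faces_of_dim_def abstract_complex_def)
    have KF: "K = complex_of F"
    proof
      show "K \<subseteq> complex_of F" using K by (auto simp: complex_of_def abstract_complex_def)
      show "complex_of F \<subseteq> K"
      proof
        fix \<tau> assume "\<tau> \<in> complex_of F"
        then obtain f where "f \<in> F" "\<tau> \<noteq> {} \<and> \<tau> \<subseteq> f" unfolding complex_of_def by blast
        then show "\<tau> \<in> K" using K(1) FK(1) unfolding abstract_complex_def by (meson subsetD)
      qed
    qed
    have cF: "closed_family 4 F"
      unfolding closed_family_def
    proof (intro conjI ballI)
      have "finite K" using K(1) unfolding abstract_complex_def by blast
      with FK(1) show "finite F" by (rule finite_subset)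
      fix f assume f: "f \<in> F"
      then show "finite f" "card f = 4" using FK by auto
      fix v assume v: "v \<in> f"
      have c3: "card (f - {v}) = 3" using FK(2)[of f] f v by simp
      then have "f - {v} \<noteq> {}" by force
      moreover have "f \<in> K" "f - {v} \<subseteq> f" using FK(1) f by blast+
      ultimately have "f - {v} \<in> K" using K(1) unfolding abstract_complex_def by meson
      with c3 show "card {g \<in> F. f - {v} \<subseteq> g} = 2" using K(4) by blast
    qed
    have "conn_links 3 F"
      using links[OF cF] N unfolding KF[symmetric] normal_pseudomanifold_def by simp
    then show "\<exists>F. normal_family 4 F \<and> K = complex_of F"
      using cF K KF by (intro exI[of _ F]) (simp add: normal_family_def)
  next
    assume "\<exists>F. normal_family 4 F \<and> K = complex_of F"
    then obtain F where F: "closed_family 4 F" "F \<noteq> {}" "conn_links 3 F" and K: "K = complex_of F"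
      by (auto simp: normal_family_def)
    note cf = complex_of_closed_family[of 3 F, simplified, OF F(1)]
    have "card {\<sigma> \<in> F. \<rho> \<subseteq> \<sigma>} = 2" if \<rho>: "\<rho> \<in> complex_of F" "card \<rho> = 3" for \<rho>
    proof -
      obtain f where f: "f \<in> F" "\<rho> \<subseteq> f" using \<rho> by (auto simp: complex_of_def)
      have "finite f" "card f = 4" using F f by (auto simp: closed_family_def)
      then have "card (f - \<rho>) = 1" using f \<rho> by (simp add: card_Diff_subset finite_subset)
      then obtain v where "f - \<rho> = {v}" using card_1_singletonE by blast
      then have "\<rho> = f - {v}" "v \<in> f" using f by blast+
      then show ?thesis using F f by (simp add: closed_family_def)
    qed
    then have "weak_pseudomanifold 3 K"
      unfolding weak_pseudomanifold_def pure_complex_def K cf(2) using cf F(2)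
      by (auto simp: complex_of_def)
    then show "normal_pseudomanifold 3 K"
      using links[OF F(1)] F(3) unfolding normal_pseudomanifold_def K by simp
  qed
qed

section \<open>Searching for all completions of a vertex link\<close>

datatype bits = End | In bits | Out bits

text \<open>The letter at each position tells whether the corresponding vertex belongs to the set,
  and \<open>i\<close> is the number of the first position. Families are read from 1 and the link of
  the apex 1 is read from 2. Prefixing \<open>In\<close> therefore cones over the apex, and
  prefixing \<open>Out\<close> leaves the set unchanged.\<close>

primrec verts :: "nat \<Rightarrow> bits \<Rightarrow> nat set" where
  "verts i End = {}"
| "verts i (In x) = insert i (verts (Suc i) x)"
| "verts i (Out x) = verts (Suc i) x"

primrec len :: "bits \<Rightarrow> nat" where
  "len End = 0" | "len (In x) = Suc (len x)" | "len (Out x) = Suc (len x)"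

primrec weight :: "bits \<Rightarrow> nat" where
  "weight End = 0" | "weight (In x) = Suc (weight x)" | "weight (Out x) = weight x"

lemma verts_subset: "verts i x \<subseteq> {i..<i + len x}"
  by (induction x arbitrary: i) fastforce+

lemma verts_less: "v \<in> verts i x \<Longrightarrow> i \<le> v"
  using verts_subset[of i x] by auto

lemma notin_verts: "i < j \<Longrightarrow> i \<notin> verts j x"
  using verts_less by (meson leD)

lemma finite_verts [simp]: "finite (verts i x)"
  by (induction x arbitrary: i) auto

lemma card_verts: "card (verts i x) = weight x"
  by (induction x arbitrary: i) (auto simp: notin_verts)

lemma verts_Suc: "verts (Suc i) x = Suc ` verts i x"
  by (induction x arbitrary: i) auto

text \<open>Trailing letters \<open>Out\<close> do not change the set, so a word is determined by
  its vertices only among words of a fixed length.\<close>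

lemma verts_inj: "len x = len y \<Longrightarrow> verts i x = verts i y \<Longrightarrow> x = y"
proof (induction x arbitrary: y i)
  case End
  then show ?case by (cases y) auto
next
  case (In x)
  then obtain y' where y: "y = In y' \<or> y = Out y'" by (cases y) auto
  show ?case
  proof (cases "y = In y'")
    case True
    then have "verts (Suc i) x = verts (Suc i) y'"
      using In.prems insert_ident[OF notin_verts notin_verts, of i "Suc i" "Suc i" x y'] by simp
    then show ?thesis using In True by auto
  next
    case False
    then show ?thesis using In.prems y notin_verts[of i "Suc i" y'] by auto
  qed
next
  case (Out x)
  then obtain y' where y: "y = In y' \<or> y = Out y'" by (cases y) auto
  then show ?case using Out notin_verts[of i "Suc i" x] by auto
qed

lemma ex_verts: "S \<subseteq> {i..<i + n} \<Longrightarrow> \<exists>x. len x = n \<and> verts i x = S"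
proof (induction n arbitrary: i S)
  case 0
  then show ?case by (intro exI[of _ End]) simp
next
  case (Suc n)
  have "S - {i} \<subseteq> {Suc i..<Suc i + n}" using Suc.prems by (auto simp: subset_iff)
  then obtain x where x: "len x = n" "verts (Suc i) x = S - {i}" using Suc.IH by blast
  show ?case
    by (cases "i \<in> S") (use x in \<open>auto intro: exI[of _ "In x"] exI[of _ "Out x"]\<close>)
qed

fun sub :: "bits \<Rightarrow> bits \<Rightarrow> bool" where
  "sub (In x) (In y) = sub x y"
| "sub (Out x) (In y) = sub x y"
| "sub (Out x) (Out y) = sub x y"
| "sub (In x) (Out y) = False"
| "sub End y = True"
| "sub (Out x) End = sub x End"
| "sub (In x) End = False"

lemma sub_iff: "sub x y \<longleftrightarrow> verts i x \<subseteq> verts i y"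
proof (induction x y arbitrary: i rule: sub.induct)
  case (1 x y)
  then show ?case using notin_verts[of i "Suc i" x] by auto
next
  case (2 x y)
  then show ?case using notin_verts[of i "Suc i" x] by auto
next
  case (4 x y)
  then show ?case using notin_verts[of i "Suc i" y] by auto
qed auto

fun same :: "bits \<Rightarrow> bits \<Rightarrow> bool" where
  "same (In x) (In y) = same x y"
| "same (Out x) (Out y) = same x y"
| "same End End = True"
| "same x y = False"

lemma same_iff [simp]: "same x y \<longleftrightarrow> x = y"
  by (induction x y rule: same.induct) auto

text \<open>The functions evaluated below branch by pattern matching on Boolean arguments rather than
  with \<open>if\<close>, which lets the simplifier evaluate them innermost first.\<close>

primrec pick_if :: "bool \<Rightarrow> 'a \<Rightarrow> 'a list \<Rightarrow> 'a list" where
  "pick_if True x xs = x # xs" | "pick_if False x xs = xs"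

primrec or_else :: "bool \<Rightarrow> bool \<Rightarrow> bool" where
  "or_else True b = True" | "or_else False b = b"

lemma pick_if_conv: "pick_if b x xs = (if b then x # xs else xs)"
  by (cases b) auto

lemma or_else_iff [simp]: "or_else b c \<longleftrightarrow> b \<or> c"
  by (cases b) auto

primrec memb :: "bits \<Rightarrow> bits list \<Rightarrow> bool" where
  "memb x [] = False" | "memb x (y # ys) = or_else (same x y) (memb x ys)"

lemma memb_iff [simp]: "memb x ys \<longleftrightarrow> x \<in> set ys"
  by (induction ys) auto

primrec remove :: "bits \<Rightarrow> bits list \<Rightarrow> bits list" where
  "remove x [] = []" | "remove x (y # ys) = pick_if (\<not> same x y) y (remove x ys)"

lemma set_remove [simp]: "set (remove x ys) = set ys - {x}"
  by (induction ys) (auto simp: pick_if_conv)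

primrec supersets :: "bits \<Rightarrow> bits list \<Rightarrow> bits list" where
  "supersets r [] = []" | "supersets r (f # fs) = pick_if (sub r f) f (supersets r fs)"

lemma set_supersets [simp]: "set (supersets r fs) = {f \<in> set fs. sub r f}"
  by (induction fs) (auto simp: pick_if_conv)

primrec covers :: "bits list \<Rightarrow> bits \<Rightarrow> bool" where
  "covers [] f = False" | "covers (s # ss) f = or_else (sub s f) (covers ss f)"

lemma covers_iff [simp]: "covers ss f \<longleftrightarrow> (\<exists>s\<in>set ss. sub s f)"
  by (induction ss) auto

primrec prune :: "bits list \<Rightarrow> bits list \<Rightarrow> bits list" where
  "prune ss [] = []" | "prune ss (f # fs) = pick_if (\<not> covers ss f) f (prune ss fs)"

lemma prune_conv: "prune ss fs = filter (\<lambda>f. \<not> covers ss f) fs"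
  by (induction fs) (auto simp: pick_if_conv)

section \<open>Ridges and the search tree\<close>

primrec ridges :: "bits \<Rightarrow> bits list" where
  "ridges End = []"
| "ridges (In x) = Out x # map In (ridges x)"
| "ridges (Out x) = map Out (ridges x)"

lemma set_ridges: "set (ridges x) = {y. len y = len x \<and> (\<exists>v\<in>verts i x. verts i y = verts i x - {v})}"
proof (induction x arbitrary: i)
  case (In x)
  define R where "R y \<longleftrightarrow> y = Out x \<or> (\<exists>z. y = In z \<and> len z = len x \<and>
    (\<exists>v\<in>verts (Suc i) x. verts (Suc i) z = verts (Suc i) x - {v}))" for y
  have R: "len y = len (In x) \<and> (\<exists>v\<in>verts i (In x). verts i y = verts i (In x) - {v}) \<longleftrightarrow> R y"
    (is "?L y \<longleftrightarrow> _") for y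
  proof (cases y)
    case End
    then show ?thesis by (simp add: R_def)
  next
    case y: (In z)
    have n: "i \<notin> verts (Suc i) x" "i \<notin> verts (Suc i) z" by (simp_all add: notin_verts)
    have "insert i (verts (Suc i) z) = insert i (verts (Suc i) x) - {v} \<longleftrightarrow>
        v \<noteq> i \<and> verts (Suc i) z = verts (Suc i) x - {v}" for v
    proof (cases "v = i")
      case False
      then have "insert i (verts (Suc i) x) - {v} = insert i (verts (Suc i) x - {v})" by blast
      then show ?thesis using False n insert_ident[of i "verts (Suc i) z" "verts (Suc i) x - {v}"] by simp
    qed auto
    then show ?thesis using y n by (auto simp: R_def)
  next
    case y: (Out z)
    have n: "i \<notin> verts (Suc i) x" "i \<notin> verts (Suc i) z" by (simp_all add: notin_verts)
    have "?L y \<longleftrightarrow> len z = len x \<and> verts (Suc i) z = verts (Suc i) x"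
      using y n by auto
    also have "\<dots> \<longleftrightarrow> R y" using y verts_inj[of z x "Suc i"] by (auto simp: R_def)
    finally show ?thesis .
  qed
  have B: "y \<in> set (ridges (In x)) \<longleftrightarrow> R y" for y
    by (auto simp: R_def In[of "Suc i"])
  show ?case by (intro set_eqI) (simp only: mem_Collect_eq R B)
next
  case (Out x)
  have "len y = len (Out x) \<and> (\<exists>v\<in>verts i (Out x). verts i y = verts i (Out x) - {v}) \<longleftrightarrow>
    (\<exists>z. y = Out z \<and> len z = len x \<and> (\<exists>v\<in>verts (Suc i) x. verts (Suc i) z = verts (Suc i) x - {v}))" for y
    using notin_verts[of i "Suc i" x] by (cases y) auto
  then show ?case using Out[of "Suc i"] by auto
qed simp

lemma distinct_ridges: "distinct (ridges x)"
  by (induction x) (auto simp: distinct_map inj_on_def)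

lemma ridges_iff:
  assumes "len s = len c" "weight c = Suc (weight s)"
  shows "s \<in> set (ridges c) \<longleftrightarrow> sub s c"
proof -
  have "(\<exists>v\<in>verts 2 c. verts 2 s = verts 2 c - {v}) \<longleftrightarrow> verts 2 s \<subseteq> verts 2 c"
  proof
    assume le: "verts 2 s \<subseteq> verts 2 c"
    then have "card (verts 2 c - verts 2 s) = 1"
      using assms by (simp add: card_Diff_subset card_verts)
    then obtain v where "verts 2 c - verts 2 s = {v}" using card_1_singletonE by blast
    then have "v \<in> verts 2 c" "verts 2 s = verts 2 c - {v}" using le by blast+
    then show "\<exists>v\<in>verts 2 c. verts 2 s = verts 2 c - {v}" by blast
  qed blast
  then show ?thesis unfolding set_ridges[of c 2] using assms by (simp add: sub_iff[of s c 2])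
qed

lemma ridges_weight: "s \<in> set (ridges c) \<Longrightarrow> len s = len c \<and> weight c = Suc (weight s)"
proof -
  assume "s \<in> set (ridges c)"
  then obtain v where "len s = len c" "v \<in> verts 2 c" "verts 2 s = verts 2 c - {v}"
    unfolding set_ridges[of c 2] by blast
  moreover from this have "card (verts 2 c) = Suc (card (verts 2 s))"
    by (metis card_Suc_Diff1 finite_verts)
  ultimately show ?thesis unfolding card_verts by blast
qed

primrec toggle_one :: "bool \<Rightarrow> bits \<Rightarrow> bits list \<times> bits list \<Rightarrow> bits list \<times> bits list" where
  "toggle_one True r oc = (remove r (fst oc), r # snd oc)"
| "toggle_one False r oc = (r # fst oc, snd oc)"

text \<open>\<open>toggle opn rs\<close> is the symmetric difference of \<open>opn\<close> and \<open>rs\<close>, together with their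
  intersection.\<close>

primrec toggle :: "bits list \<Rightarrow> bits list \<Rightarrow> bits list \<times> bits list" where
  "toggle opn [] = (opn, [])"
| "toggle opn (r # rs) = toggle_one (memb r opn) r (toggle opn rs)"

lemma set_toggle:
  "distinct rs \<Longrightarrow> set (fst (toggle opn rs)) = (set opn - set rs) \<union> (set rs - set opn) \<and>
     set (snd (toggle opn rs)) = set opn \<inter> set rs"
proof (induction rs)
  case (Cons r rs)
  then show ?case by (cases "r \<in> set opn") auto
qed simp

primrec branch :: "(bits list \<times> bits list \<Rightarrow> bits list \<Rightarrow> bits list list) \<Rightarrow>
    bits list \<Rightarrow> bits list \<Rightarrow> bits list \<Rightarrow> bits list list" where
  "branch g opn A [] = []"
| "branch g opn A (f # fs) = g (toggle opn (ridges f)) (f # A) @ branch g opn A fs"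

lemma set_branch: "set (branch g opn A fs) = (\<Union>f\<in>set fs. set (g (toggle opn (ridges f)) (f # A)))"
  by (induction fs) auto

text \<open>The ridges in \<open>cl\<close> have just received their second facet, so every
  candidate through one of them is dropped.\<close>

fun resume :: "(bits list \<Rightarrow> bits list \<Rightarrow> bits list \<Rightarrow> bits list list) \<Rightarrow> bits list \<Rightarrow>
    bits list \<times> bits list \<Rightarrow> bits list \<Rightarrow> bits list list" where
  "resume g C (opn, cl) A = g (prune cl C) A opn"

text \<open>In any completion exactly one more facet contains the open ridge \<open>r\<close>, so
  the branches exclude one another and together miss nothing. Without open ridges the chosen set is
  complete.\<close>

primrec search_step :: "(bits list \<Rightarrow> bits list \<Rightarrow> bits list \<Rightarrow> bits list list) \<Rightarrow>
    bits list \<Rightarrow> bits list \<Rightarrow> bits list \<Rightarrow> bits list list" where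
  "search_step g C A [] = [A]"
| "search_step g C A (r # opn) = branch (resume g C) (r # opn) A (supersets r C)"

text \<open>The first argument is a counter bounding the depth. The list \<open>opn\<close> holds the ridges that
  lie in exactly one facet chosen so far, \<open>C\<close> the facets that may still be added.\<close>

primrec search :: "bits list \<Rightarrow> bits list \<Rightarrow> bits list \<Rightarrow> bits list \<Rightarrow> bits list list" where
  "search [] C A opn = []"
| "search (z # zs) C A opn = search_step (search zs) C A opn"

primrec zeros :: "bits \<Rightarrow> bits" where
  "zeros End = End" | "zeros (In x) = Out (zeros x)" | "zeros (Out x) = Out (zeros x)"

fun subfaces :: "nat \<Rightarrow> bits \<Rightarrow> bits list" where
  "subfaces 0 x = [zeros x]"
| "subfaces (Suc k) End = []"
| "subfaces (Suc k) (In x) = map In (subfaces k x) @ map Out (subfaces (Suc k) x)"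
| "subfaces (Suc k) (Out x) = map In (subfaces k x) @ map Out (subfaces (Suc k) x)"

lemma zeros_iff: "y = zeros x \<longleftrightarrow> len y = len x \<and> weight y = 0"
proof (induction x arbitrary: y)
  case End
  then show ?case by (cases y) auto
next
  case (In x)
  then show ?case by (cases y) auto
next
  case (Out x)
  then show ?case by (cases y) auto
qed

lemma set_subfaces: "y \<in> set (subfaces k x) \<longleftrightarrow> len y = len x \<and> weight y = k"
proof (induction k x arbitrary: y rule: subfaces.induct)
  case (1 x)
  then show ?case by (simp add: zeros_iff)
next
  case (2 k)
  then show ?case by (cases y) auto
next
  case (3 k x)
  then show ?case by (cases y) auto
next
  case (4 k x)
  then show ?case by (cases y) auto
qed

definition fam :: "bits list \<Rightarrow> nat set set" where
  "fam A = verts 1 ` set A"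

text \<open>Each facet of the link \<open>L\<close> is a ridge lying in one facet of the cone and in
  no other chosen facet, so \<open>L\<close> itself is the initial list of open ridges. Every step
  removes at least one candidate, hence a counter one longer than the list of candidates
  suffices.\<close>

definition cone_search :: "bits list \<Rightarrow> bits list list" where
  "cone_search L = (let C = subfaces (Suc (weight (hd L))) (hd L)
     in map (\<lambda>A. map In L @ map Out A) (search (End # C) C [] L))"

section \<open>Completeness of the search\<close>

locale cone_completion =
  fixes k m :: nat and F :: "nat set set" and L :: "bits list"
  assumes F: "normal_family (Suc k) F" and k: "1 \<le> k"
    and lk: "lk 1 F = verts 2 ` set L"
    and vF: "\<Union>F \<subseteq> {1..Suc m}"
    and lenL: "\<And>t. t \<in> set L \<Longrightarrow> len t = m"
begin

definition multi :: "bits list \<Rightarrow> bits \<Rightarrow> nat" where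
  "multi A s = (if s \<in> set L then 1 else 0) + card {f \<in> set A. sub s f}"

definition ridge :: "bits \<Rightarrow> bool" where
  "ridge s \<longleftrightarrow> len s = m \<and> weight s = k"

definition facet :: "bits \<Rightarrow> bool" where
  "facet f \<longleftrightarrow> len f = m \<and> weight f = Suc k"

lemma cF: "closed_family (Suc k) F"
  using F by (simp add: normal_family_def)

lemma ridge_L: "t \<in> set L \<Longrightarrow> ridge t"
  using closed_familyD(3)[OF closed_family_lk[OF cF], of "verts 2 t" 1] lenL
  by (simp add: lk ridge_def card_verts del: One_nat_def)

lemma facet_ex:
  assumes "f \<in> F" "1 \<notin> f"
  obtains c where "facet c" "verts 2 c = f"
proof -
  have "f \<subseteq> {2..<2 + m}"
  proof
    fix v assume "v \<in> f"
    then have "v \<in> {1..Suc m}" "v \<noteq> 1" using vF assms by blast+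
    then show "v \<in> {2..<2 + m}" by auto
  qed
  then obtain c where c: "len c = m" "verts 2 c = f" using ex_verts by blast
  then have "weight c = Suc k" using closed_familyD(3)[OF cF assms(1)] card_verts by metis
  then show ?thesis using that c by (simp add: facet_def)
qed

lemma ridge_in_facet:
  assumes "ridge s" "f \<in> F" "verts 2 s \<subseteq> f"
  shows "card {g \<in> F. verts 2 s \<subseteq> g} = 2"
proof -
  have "finite f" "card f = Suc k" using closed_familyD[OF cF] assms by auto
  then have "card (f - verts 2 s) = 1"
    using assms by (simp add: card_Diff_subset card_verts ridge_def)
  then obtain v where "f - verts 2 s = {v}" using card_1_singletonE by blast
  then have "v \<in> f" "verts 2 s = f - {v}" using assms by blast+
  then show ?thesis using closed_familyD(4)[OF cF assms(2)] by simp
qed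

lemma inj_verts: "inj_on (verts 2) {c. len c = m}"
  by (rule inj_onI) (auto intro: verts_inj)

text \<open>In a set \<open>A\<close> of facets of \<open>F\<close> avoiding the apex, \<open>multi A s\<close> counts the facets through
  \<open>s\<close> among these facets and the cone over \<open>L\<close>.\<close>

lemma multi_conv:
  assumes s: "ridge s" and A: "\<And>f. f \<in> set A \<Longrightarrow> facet f" and G: "\<And>g. g \<in> G \<longleftrightarrow> g \<in> F \<and> 1 \<in> g \<or> g \<in> verts 2 ` set A"
  shows "card {g \<in> G. verts 2 s \<subseteq> g} = multi A s"
proof -
  have n1: "1 \<notin> verts 2 x" for x by (simp add: notin_verts)
  have "{g \<in> G. verts 2 s \<subseteq> g} = {g \<in> F. 1 \<in> g \<and> verts 2 s \<subseteq> g} \<union> verts 2 ` {f \<in> set A. sub s f}"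
    using A s sub_iff[of s _ 2] by (auto simp: G facet_def ridge_def)
  moreover have "{g \<in> F. 1 \<in> g \<and> verts 2 s \<subseteq> g} \<inter> verts 2 ` {f \<in> set A. sub s f} = {}"
    using n1 by auto
  moreover have "card (verts 2 ` {f \<in> set A. sub s f}) = card {f \<in> set A. sub s f}"
    using A by (intro card_image inj_on_subset[OF inj_verts]) (auto simp: facet_def)
  moreover have "{g \<in> F. 1 \<in> g \<and> verts 2 s \<subseteq> g} = (if s \<in> set L then {insert 1 (verts 2 s)} else {})"
  proof -
    have "g = insert 1 (verts 2 s)" if g: "g \<in> F" "1 \<in> g" "verts 2 s \<subseteq> g" for g
    proof -
      have "finite g" "card g = Suc k" using closed_familyD[OF cF] g by auto
      moreover have "card (insert 1 (verts 2 s)) = Suc k"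
        using s n1 by (simp add: card_verts ridge_def)
      ultimately show ?thesis using g card_subset_eq[of g "insert 1 (verts 2 s)"] by simp
    qed
    moreover have "insert 1 (verts 2 s) \<in> F \<longleftrightarrow> s \<in> set L"
    proof -
      have "insert 1 (verts 2 s) \<in> F \<longleftrightarrow> verts 2 s \<in> verts 2 ` set L"
        using in_lk_iff[of "verts 2 s" 1 F] n1 by (simp add: lk del: One_nat_def)
      also have "\<dots> \<longleftrightarrow> s \<in> set L" using s lenL verts_inj by (auto simp: ridge_def image_iff) metis
      finally show ?thesis .
    qed
    ultimately show ?thesis by auto
  qed
  moreover have "finite F" using cF closed_familyD by blast
  ultimately show ?thesis by (subst card_Un_disjoint[symmetric] | simp add: card_Un_disjoint multi_def)+
qed

text \<open>The last two clauses express that this node of the search still leads to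
  \<open>F\<close>. Only ridges avoiding the apex are tracked: a ridge through the apex lies in cone
  facets alone, and all of these are present from the start.\<close>

definition invariant :: "bits list \<Rightarrow> bits list \<Rightarrow> bits list \<Rightarrow> bool" where
  "invariant C A opn \<longleftrightarrow>
     (\<forall>s. ridge s \<longrightarrow> (s \<in> set opn \<longleftrightarrow> multi A s = 1) \<and> multi A s \<le> 2) \<and>
     (\<forall>s\<in>set opn. ridge s) \<and>
     (\<forall>c\<in>set C. facet c \<and> c \<notin> set A \<and> (\<forall>s. ridge s \<longrightarrow> sub s c \<longrightarrow> multi A s \<noteq> 2)) \<and>
     (\<forall>f\<in>set A. facet f \<and> verts 2 f \<in> F) \<and>
     (\<forall>f\<in>F. 1 \<notin> f \<longrightarrow> f \<in> verts 2 ` set A \<union> verts 2 ` set C)"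

lemma invariantD:
  assumes "invariant C A opn"
  shows "ridge s \<Longrightarrow> s \<in> set opn \<longleftrightarrow> multi A s = 1" "ridge s \<Longrightarrow> multi A s \<le> 2"
    "s \<in> set opn \<Longrightarrow> ridge s"
    "c \<in> set C \<Longrightarrow> facet c" "c \<in> set C \<Longrightarrow> c \<notin> set A"
    "c \<in> set C \<Longrightarrow> ridge s \<Longrightarrow> sub s c \<Longrightarrow> multi A s \<noteq> 2"
    "f \<in> set A \<Longrightarrow> facet f" "f \<in> set A \<Longrightarrow> verts 2 f \<in> F"
    "g \<in> F \<Longrightarrow> 1 \<notin> g \<Longrightarrow> g \<in> verts 2 ` set A \<union> verts 2 ` set C"
  using assms unfolding invariant_def by (simp_all del: One_nat_def)

lemma multi_Cons:
  "c \<notin> set A \<Longrightarrow> multi (c # A) s = multi A s + (if sub s c then 1 else 0)"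
proof -
  assume "c \<notin> set A"
  then have "{f \<in> set (c # A). sub s f} = (if sub s c then insert c {f \<in> set A. sub s f} else {f \<in> set A. sub s f})"
    by auto
  then show ?thesis using \<open>c \<notin> set A\<close> by (simp add: multi_def)
qed

lemma ridge_sub: "ridge s \<Longrightarrow> facet c \<Longrightarrow> s \<in> set (ridges c) \<longleftrightarrow> sub s c"
  by (simp add: ridges_iff ridge_def facet_def)

text \<open>The new facet completes the open ridge \<open>r\<close>, so pruning removes at least the
  facet itself from the candidates. This gives the decreasing measure.\<close>

lemma invariant_step:
  assumes inv: "invariant C A opn" and r: "r \<in> set opn" and c: "c \<in> set C" "sub r c" "verts 2 c \<in> F"
    and t: "toggle opn (ridges c) = (opn', cl)"
  shows "invariant (prune cl C) (c # A) opn'" "length (prune cl C) < length C"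
proof -
  have opn': "set opn' = (set opn - set (ridges c)) \<union> (set (ridges c) - set opn)"
    and cl: "set cl = set opn \<inter> set (ridges c)"
    using set_toggle[OF distinct_ridges, of opn c] t by simp_all
  have I1: "\<And>s. ridge s \<Longrightarrow> s \<in> set opn \<longleftrightarrow> multi A s = 1" "\<And>s. ridge s \<Longrightarrow> multi A s \<le> 2"
    and I0: "\<And>s. s \<in> set opn \<Longrightarrow> ridge s"
    and I2: "\<And>c. c \<in> set C \<Longrightarrow> facet c" "\<And>c. c \<in> set C \<Longrightarrow> c \<notin> set A"
      "\<And>c s. c \<in> set C \<Longrightarrow> ridge s \<Longrightarrow> sub s c \<Longrightarrow> multi A s \<noteq> 2"
    and I3: "\<And>f. f \<in> set A \<Longrightarrow> facet f" "\<And>f. f \<in> set A \<Longrightarrow> verts 2 f \<in> F"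
      "\<And>f. f \<in> F \<Longrightarrow> 1 \<notin> f \<Longrightarrow> f \<in> verts 2 ` set A \<union> verts 2 ` set C"
    by (rule invariantD[OF inv]; assumption)+
  have fc: "facet c" and cA: "c \<notin> set A" using I2 c by auto
  have ridc: "s \<in> set (ridges c) \<longleftrightarrow> sub s c" if "ridge s" for s using ridge_sub[OF that fc] .
  have ridc': "ridge s" if "s \<in> set (ridges c)" for s
    using ridges_weight[OF that] fc by (simp add: ridge_def facet_def)
  note mc = multi_Cons[OF cA]
  have rcl: "r \<in> set cl" using r ridc[OF I0[OF r]] c by (simp add: cl)
  have clr: "ridge s \<and> multi A s = 1 \<and> sub s c" if "s \<in> set cl" for s
    using that I0 I1 ridc by (auto simp: cl)
  have "c \<notin> set (prune cl C)" using rcl c by (auto simp: prune_conv)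
  show "length (prune cl C) < length C"
    unfolding prune_conv by (rule length_filter_less[OF c(1)]) (use c(2) rcl in auto)
  have P1: "(s \<in> set opn' \<longleftrightarrow> multi (c # A) s = 1) \<and> multi (c # A) s \<le> 2" if s: "ridge s" for s
  proof (cases "sub s c")
    case True
    then have "multi A s \<noteq> 2" "multi A s \<le> 2" using I2(3)[OF c(1) s] I1(2)[OF s] by auto
    then have "multi A s = 0 \<or> multi A s = 1" by auto
    then show ?thesis using I1(1)[OF s] ridc[OF s] True by (auto simp: mc opn')
  next
    case False
    then show ?thesis using I1[OF s] ridc[OF s] by (auto simp: mc opn')
  qed
  have P0: "ridge s" if "s \<in> set opn'" for s using that I0 ridc' by (auto simp: opn')
  have P2: "facet d \<and> d \<notin> set (c # A) \<and> (\<forall>s. ridge s \<longrightarrow> sub s d \<longrightarrow> multi (c # A) s \<noteq> 2)"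
    if d: "d \<in> set (prune cl C)" for d
  proof -
    have dC: "d \<in> set C" and dcl: "\<And>s. s \<in> set cl \<Longrightarrow> \<not> sub s d" using d by (auto simp: prune_conv)
    have "d \<noteq> c" using d \<open>c \<notin> set (prune cl C)\<close> by blast
    moreover have "multi (c # A) s \<noteq> 2" if s: "ridge s" "sub s d" for s
    proof (cases "sub s c")
      case True
      then have "s \<notin> set cl" using dcl s by blast
      then have "multi A s \<noteq> 1" using True ridc[OF s(1)] I1(1)[OF s(1)] by (simp add: cl)
      then show ?thesis using True by (simp add: mc)
    next
      case False
      then show ?thesis using I2(3)[OF dC s] by (simp add: mc)
    qed
    ultimately show ?thesis using I2(1,2)[OF dC] by simp
  qed
  have P3: "facet f \<and> verts 2 f \<in> F" if "f \<in> set (c # A)" for f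
    using that I3 fc c by auto
  \<comment> \<open>A facet of \<open>F\<close> lost by pruning would be the third one through a
    ridge already contained in two chosen facets of \<open>F\<close>.\<close>
  have P4: "f \<in> verts 2 ` set (c # A) \<union> verts 2 ` set (prune cl C)" if f: "f \<in> F" "1 \<notin> f" for f
  proof (rule ccontr)
    assume no: "\<not> ?thesis"
    then obtain d where d: "d \<in> set C" "f = verts 2 d" using I3(3)[OF f] by auto
    then have "d \<notin> set (prune cl C)" "d \<noteq> c" "d \<notin> set A" using no by auto
    then obtain s where s: "s \<in> set cl" "sub s d" using d by (auto simp: prune_conv)
    then have sr: "ridge s" and s1: "multi A s = 1" and sc: "sub s c" using clr by auto
    have m2: "multi (c # A) s = 2" using s1 sc by (simp add: mc)
    define G where "G = {g \<in> F. 1 \<in> g} \<union> verts 2 ` set (c # A)"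
    have "card {g \<in> G. verts 2 s \<subseteq> g} = multi (c # A) s"
      by (rule multi_conv[OF sr]) (use P3 in \<open>auto simp: G_def\<close>)
    then have "card {g \<in> G. verts 2 s \<subseteq> g} = 2" using m2 by (rule trans)
    moreover have GF: "G \<subseteq> F" using P3 by (auto simp: G_def)
    moreover have sf: "verts 2 s \<subseteq> f"
      using sub_iff[of s d 2] s sr I2(1)[OF d(1)] d by (simp add: ridge_def facet_def)
    moreover have "f \<notin> G" using no f by (auto simp: G_def)
    moreover have finF: "finite F" using cF closed_familyD by blast
    ultimately have "card (insert f {g \<in> G. verts 2 s \<subseteq> g}) = 3"
      by (subst card_insert_disjoint) (auto intro: finite_subset)
    moreover have "insert f {g \<in> G. verts 2 s \<subseteq> g} \<subseteq> {g \<in> F. verts 2 s \<subseteq> g}"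
      using GF sf f by blast
    then have "card (insert f {g \<in> G. verts 2 s \<subseteq> g}) \<le> card {g \<in> F. verts 2 s \<subseteq> g}"
      using finF by (intro card_mono) auto
    ultimately show False using ridge_in_facet[OF sr f(1) sf] by simp
  qed
  show "invariant (prune cl C) (c # A) opn'"
    unfolding invariant_def using P0 P1 P2 P3 P4 by blast
qed

text \<open>When no ridge is open, the cone together with \<open>A\<close> is a closed subfamily of
  \<open>F\<close>, and indecomposability forces equality. This is why the search may stop here
  instead of trying further facets.\<close>

lemma invariant_closed:
  assumes inv: "invariant C A []" and L: "L \<noteq> []"
  shows "F = verts 1 ` (In ` set L \<union> Out ` set A)"
proof -
  define G where "G = {g \<in> F. 1 \<in> g} \<union> verts 2 ` set A"
  have A: "\<And>f. f \<in> set A \<Longrightarrow> facet f" "\<And>f. f \<in> set A \<Longrightarrow> verts 2 f \<in> F"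
    and I1: "\<And>s. ridge s \<Longrightarrow> multi A s \<noteq> 1" "\<And>s. ridge s \<Longrightarrow> multi A s \<le> 2"
    using invariantD[OF inv] by (simp_all del: One_nat_def)
  have GF: "G \<subseteq> F" using A by (auto simp: G_def)
  have finF: "finite F" using cF closed_familyD by blast
  have n1: "1 \<notin> verts 2 x" for x by (simp add: notin_verts)
  have v12: "verts 1 (In t) = insert 1 (verts 2 t)" "verts 1 (Out t) = verts 2 t" for t
    by (simp_all add: numeral_2_eq_2)
  have one: "{g \<in> F. 1 \<in> g} = verts 1 ` In ` set L"
  proof -
    have "{g \<in> F. 1 \<in> g} = insert 1 ` lk 1 F"
      unfolding lk_def image_image by (auto simp: insert_absorb)
    then show ?thesis by (simp only: lk image_image v12)
  qed
  have "closed_family (Suc k) G"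
    unfolding closed_family_def
  proof (intro conjI ballI)
    show "finite G" using GF finF finite_subset by blast
    fix f assume f: "f \<in> G"
    then have fF: "f \<in> F" using GF by blast
    then show "finite f" "card f = Suc k" using closed_familyD[OF cF] by auto
    fix v assume v: "v \<in> f"
    have c2: "card {g \<in> F. f - {v} \<subseteq> g} = 2" using closed_familyD(4)[OF cF fF v] .
    show "card {g \<in> G. f - {v} \<subseteq> g} = 2"
    proof (cases "1 \<in> f - {v}")
      case True
      \<comment> \<open>Every facet through such a ridge contains the apex and is therefore a cone
        facet.\<close>
      then have "{g \<in> G. f - {v} \<subseteq> g} = {g \<in> F. f - {v} \<subseteq> g}"
        using GF by (auto simp: G_def)
      then show ?thesis using c2 by simp
    next
      case False
      have "f - {v} \<subseteq> {2..<2 + m}"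
      proof
        fix w assume "w \<in> f - {v}"
        then have "w \<in> {1..Suc m}" "w \<noteq> 1" using vF fF False by blast+
        then show "w \<in> {2..<2 + m}" by auto
      qed
      then obtain s where s: "len s = m" "verts 2 s = f - {v}" using ex_verts by blast
      have "card (f - {v}) = k" using closed_familyD(2,3)[OF cF fF] v by simp
      then have "weight s = k" using s card_verts by metis
      then have rs: "ridge s" using s by (simp add: ridge_def)
      have m: "card {g \<in> G. verts 2 s \<subseteq> g} = multi A s"
        using multi_conv[OF rs, of A G] A by (auto simp: G_def)
      have "f \<in> {g \<in> G. verts 2 s \<subseteq> g}" using f s by auto
      then have "multi A s \<noteq> 0"
        unfolding m[symmetric] using \<open>finite G\<close> by auto
      then have "multi A s = 2" using I1[OF rs] by linarith
      then show ?thesis using m s by simp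
    qed
  qed
  moreover have "G \<noteq> {}" using L one by (auto simp: G_def)
  ultimately have "G = F" using normal_family_indecomposable[OF F _ GF] by simp
  then show ?thesis
    unfolding G_def one by (simp only: image_Un image_image v12)
qed

lemma search_complete:
  assumes "invariant C A opn" "length C < length zs" "L \<noteq> []"
  shows "\<exists>A'\<in>set (search zs C A opn). F = verts 1 ` (In ` set L \<union> Out ` set A')"
  using assms
proof (induction zs arbitrary: C A opn)
  case (Cons z zs)
  show ?case
  proof (cases opn)
    case Nil
    then show ?thesis using invariant_closed Cons.prems by simp
  next
    case (Cons r opn0)
    note inv = \<open>invariant C A opn\<close>
    have r: "r \<in> set opn" using Cons by simp
    then have rr: "ridge r" "multi A r = 1" using invariantD(1,3)[OF inv] by blast+
    have A: "\<And>f. f \<in> set A \<Longrightarrow> facet f" "\<And>f. f \<in> set A \<Longrightarrow> verts 2 f \<in> F"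
      using invariantD(7,8)[OF inv] by blast+
    define G where "G = {g \<in> F. 1 \<in> g} \<union> verts 2 ` set A"
    have GF: "G \<subseteq> F" using A by (auto simp: G_def)
    have G1: "card {g \<in> G. verts 2 r \<subseteq> g} = 1"
      using multi_conv[OF rr(1), of A G] A rr by (auto simp: G_def)
    then obtain g where "g \<in> G" "verts 2 r \<subseteq> g" by (metis (mono_tags, lifting) card_1_singletonE insertI1 mem_Collect_eq)
    then have "card {g \<in> F. verts 2 r \<subseteq> g} = 2" using ridge_in_facet[OF rr(1)] GF by blast
    \<comment> \<open>The open ridge lies in one chosen facet but in two facets of \<open>F\<close>;
      the missing one is still a candidate and tells which branch to follow.\<close>
    then have "{g \<in> F. verts 2 r \<subseteq> g} \<noteq> {g \<in> G. verts 2 r \<subseteq> g}" using G1 by force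
    then obtain f where f: "f \<in> F" "verts 2 r \<subseteq> f" "f \<notin> G" using GF by blast
    then have "1 \<notin> f" "f \<notin> verts 2 ` set A" by (auto simp: G_def)
    then have "f \<in> verts 2 ` set C" using invariantD(9)[OF inv] f by blast
    then obtain c where c: "c \<in> set C" "f = verts 2 c" by blast
    have "facet c" using invariantD(4)[OF inv c(1)] .
    then have sc: "sub r c" using f c rr sub_iff[of r c 2] by (simp add: ridge_def facet_def)
    obtain opn' cl where t: "toggle opn (ridges c) = (opn', cl)" by fastforce
    have cF': "verts 2 c \<in> F" using f c by simp
    note st = invariant_step[OF inv r c(1) sc cF' t]
    have "length (prune cl C) < length zs" using st(2) Cons.prems by simp
    then obtain A' where A': "A' \<in> set (search zs (prune cl C) (c # A) opn')"
      "F = verts 1 ` (In ` set L \<union> Out ` set A')"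
      using Cons.IH[OF st(1)] Cons.prems by blast
    have "A' \<in> set (resume (search zs) C (toggle opn (ridges c)) (c # A))" using A' t by simp
    then have "A' \<in> set (search (z # zs) C A opn)"
      using c sc Cons by (auto simp: set_branch)
    then show ?thesis using A' by blast
  qed
qed simp

lemma cone_search_complete:
  assumes L: "L \<noteq> []"
  shows "\<exists>A\<in>set (cone_search L). F = fam A"
proof -
  define C where "C = subfaces (Suc (weight (hd L))) (hd L)"
  have hd: "len (hd L) = m" "weight (hd L) = k"
    using ridge_L[of "hd L"] L by (auto simp: ridge_def)
  have C: "c \<in> set C \<longleftrightarrow> facet c" for c
    by (simp add: C_def set_subfaces hd facet_def)
  \<comment> \<open>At the root nothing is chosen outside the cone, so a ridge off the apex has
    multiplicity 1 if it belongs to \<open>L\<close> and 0 otherwise.\<close>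
  have "invariant C [] L"
    unfolding invariant_def
  proof (intro conjI allI impI ballI)
    fix f assume f: "f \<in> F" "1 \<notin> f"
    then obtain c where "facet c" "verts 2 c = f" using facet_ex by blast
    then show "f \<in> verts 2 ` set [] \<union> verts 2 ` set C" using C by auto
  qed (use ridge_L C in \<open>auto simp: multi_def\<close>)
  then obtain A' where A': "A' \<in> set (search (End # C) C [] L)"
    "F = verts 1 ` (In ` set L \<union> Out ` set A')"
    using search_complete[of C "[]" L "End # C"] L by auto
  show ?thesis
  proof
    show "map In L @ map Out A' \<in> set (cone_search L)"
      using A' by (auto simp: cone_search_def Let_def C_def[symmetric])
    show "F = fam (map In L @ map Out A')" using A'(2) by (simp add: fam_def)
  qed
qed

end

section \<open>Certificates for the leaves of the search\<close>

lemma relabel: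
  fixes F :: "'a set set"
  assumes F: "finite (\<Union>F)" and v: "v \<in> \<Union>F" and card: "card (\<Union>F) = Suc m"
    and iso: "fam_iso (lk v F) (fam L)" and len: "\<And>t. t \<in> set L \<Longrightarrow> len t = m"
  obtains G where "fam_iso F G" "lk 1 G = verts 2 ` set L" "\<Union>G = {1..Suc m}"
proof -
  define U W where "U = \<Union>(lk v F)" and "W = \<Union>F - {v}"
  obtain h where h: "inj_on h U" "fam L = (`) h ` lk v F"
    using iso unfolding fam_iso_def U_def by blast
  have UW: "U \<subseteq> W" unfolding U_def W_def by (rule Union_lk_subset)
  have W: "finite W" "card W = m" using F v card by (simp_all add: W_def)
  have "h ` U = \<Union>(fam L)" unfolding h(2) U_def by (rule Union_image_image[symmetric])
  moreover have "t \<subseteq> {1..m}" if "t \<in> fam L" for t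
  proof -
    obtain x where "x \<in> set L" "t = verts 1 x" using \<open>t \<in> fam L\<close> unfolding fam_def by blast
    then show ?thesis using verts_subset[of 1 x] len[of x] by auto
  qed
  ultimately have hU: "h ` U \<subseteq> {1..m}" by blast
  have finU: "finite U" using UW W finite_subset by blast
  have "card (W - U) = card ({1..m} - h ` U)"
    using UW W hU finU h(1) by (simp add: card_Diff_subset card_image)
  \<comment> \<open>Vertices outside the link of \<open>v\<close> may exist, for instance one when
    the 6-vertex projective plane is a link among 8 vertices. They receive the numbers left over, in
    any order.\<close>
  then obtain e where e: "bij_betw e (W - U) ({1..m} - h ` U)"
    using finite_same_card_bij W by (metis finite_Diff finite_atLeastAtMost)
  define d where "d w = (if w \<in> U then h w else e w)" for w
  have "bij_betw d U (h ` U)" using h(1) by (intro bij_betw_imageI) (auto simp: d_def inj_on_def)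
  moreover have "bij_betw d (W - U) ({1..m} - h ` U)"
    using e by (rule bij_betw_cong[THEN iffD1, rotated]) (simp add: d_def)
  ultimately have "bij_betw d (U \<union> (W - U)) (h ` U \<union> ({1..m} - h ` U))"
    by (rule bij_betw_combine) blast
  moreover have "U \<union> (W - U) = W" "h ` U \<union> ({1..m} - h ` U) = {1..m}" using UW hU by blast+
  ultimately have d: "bij_betw d W {1..m}" by simp
  define g where "g w = (if w = v then 1 else Suc (d w))" for w
  have gW: "g w = Suc (d w)" if "w \<in> W" for w using that by (simp add: g_def W_def)
  have FW: "\<Union>F = insert v W" using v by (auto simp: W_def)
  have "inj_on g W" using d gW by (auto simp: inj_on_def bij_betw_def)
  moreover have gWim: "g ` W = {2..Suc m}"
  proof -
    have "g ` W = Suc ` d ` W" unfolding image_image using gW by (intro image_cong) auto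
    also have "d ` W = {1..m}" using d by (simp add: bij_betw_def)
    finally show ?thesis by (simp add: image_Suc_atLeastAtMost numeral_2_eq_2)
  qed
  moreover have gv: "g v = 1" by (simp add: g_def)
  then have "g v \<notin> g ` W" unfolding gWim by simp
  moreover have "W - {v} = W" by (auto simp: W_def)
  ultimately have inj: "inj_on g (\<Union>F)" unfolding FW inj_on_insert by simp
  show ?thesis
  proof (rule that)
    show "fam_iso F ((`) g ` F)" using inj by (rule fam_iso_image)
    have "\<Union>((`) g ` F) = insert 1 (g ` W)" unfolding Union_image_image FW image_insert gv ..
    then show "\<Union>((`) g ` F) = {1..Suc m}" unfolding gWim by auto
    have "lk 1 ((`) g ` F) = (`) g ` lk v F" using lk_image[OF inj v] by (simp add: g_def)
    also have "\<dots> = (`) (\<lambda>w. Suc (h w)) ` lk v F"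
    proof (rule image_cong)
      fix f assume f: "f \<in> lk v F"
      have "g w = Suc (h w)" if "w \<in> f" for w
      proof -
        have "w \<in> U" using f that by (auto simp: U_def)
        then show ?thesis using gW[of w] UW by (auto simp: d_def)
      qed
      then show "g ` f = (\<lambda>w. Suc (h w)) ` f" by (intro image_cong) auto
    qed simp
    also have "\<dots> = (`) Suc ` fam L" unfolding h(2) image_image ..
    also have "\<dots> = verts 2 ` set L"
      unfolding fam_def image_image numeral_2_eq_2 verts_Suc[symmetric] by simp
    finally show "lk 1 ((`) g ` F) = verts 2 ` set L" .
  qed
qed

lemma finite_Union_normal: "normal_family k F \<Longrightarrow> finite (\<Union>F)"
  by (auto simp: normal_family_def closed_family_def)

lemma cone_classification:
  assumes F: "normal_family (Suc k) F" and k: "1 \<le> k" and v: "v \<in> \<Union>F" and card: "card (\<Union>F) = Suc m"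
    and iso: "fam_iso (lk v F) (fam L)" and len: "\<And>t. t \<in> set L \<Longrightarrow> len t = m"
  obtains A where "A \<in> set (cone_search L)" "fam_iso F (fam A)" "\<Union>(fam A) = {1..Suc m}"
proof -
  obtain G where G: "fam_iso F G" "lk 1 G = verts 2 ` set L" "\<Union>G = {1..Suc m}"
    by (rule relabel[OF finite_Union_normal[OF F] v card iso len])
  have "lk v F \<noteq> {}" using v by (simp add: lk_empty_iff)
  then have L: "L \<noteq> []" using iso unfolding fam_iso_def fam_def by auto
  interpret cone_completion k m G L
  proof
    show "normal_family (Suc k) G" using normal_family_iso[OF G(1) F] .
  qed (use k G len in auto)
  obtain A where "A \<in> set (cone_search L)" "G = fam A" using cone_search_complete[OF L] by blast
  then show ?thesis using that G by blast
qed

section \<open>Set operations on words\<close>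

primrec ones :: "bits \<Rightarrow> bits" where
  "ones End = End" | "ones (In x) = In (ones x)" | "ones (Out x) = In (ones x)"

lemma verts_ones: "verts i (ones x) = {i..<i + len x}"
proof (induction x arbitrary: i)
  case (In x)
  have "insert i {Suc i..<Suc i + len x} = {i..<i + Suc (len x)}" by auto
  then show ?case using In[of "Suc i"] by simp
next
  case (Out x)
  have "insert i {Suc i..<Suc i + len x} = {i..<i + Suc (len x)}" by auto
  then show ?case using Out[of "Suc i"] by simp
qed simp

lemma verts_zeros [simp]: "verts i (zeros x) = {}"
  by (induction x arbitrary: i) auto

fun bor :: "bits \<Rightarrow> bits \<Rightarrow> bits" where
  "bor (In x) (In y) = In (bor x y)"
| "bor (In x) (Out y) = In (bor x y)"
| "bor (Out x) (In y) = In (bor x y)"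
| "bor (Out x) (Out y) = Out (bor x y)"
| "bor End y = y"
| "bor (In x) End = In x"
| "bor (Out x) End = Out x"

lemma verts_bor [simp]: "verts i (bor x y) = verts i x \<union> verts i y"
  by (induction x y arbitrary: i rule: bor.induct) auto

fun del :: "bits \<Rightarrow> bits \<Rightarrow> bits" where
  "del (In x) (In y) = Out (del x y)"
| "del (In x) (Out y) = Out (del x y)"
| "del (Out x) (In y) = In (del x y)"
| "del (Out x) (Out y) = Out (del x y)"
| "del End y = y"
| "del (In x) End = End"
| "del (Out x) End = End"

lemma verts_del [simp]: "verts i (del x y) = verts i y - verts i x"
proof (induction x y arbitrary: i rule: del.induct)
  case (1 x y)
  then show ?case using notin_verts[of i "Suc i" y] by auto
next
  case (2 x y)
  then show ?case using notin_verts[of i "Suc i" y] by auto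
next
  case (3 x y)
  then show ?case using notin_verts[of i "Suc i" x] by auto
qed auto

fun disj :: "bits \<Rightarrow> bits \<Rightarrow> bool" where
  "disj (In x) (In y) = False"
| "disj (In x) (Out y) = disj x y"
| "disj (Out x) (In y) = disj x y"
| "disj (Out x) (Out y) = disj x y"
| "disj End y = True"
| "disj (In x) End = True"
| "disj (Out x) End = True"

lemma disj_iff: "disj x y \<longleftrightarrow> verts i x \<inter> verts i y = {}"
  by (induction x y arbitrary: i rule: disj.induct) (auto simp: notin_verts)

primrec support :: "bits list \<Rightarrow> bits" where
  "support [] = End" | "support (f # A) = bor f (support A)"

lemma verts_support: "verts 1 (support A) = \<Union>(fam A)"
  by (induction A) (auto simp: fam_def)

primrec and_also :: "bool \<Rightarrow> bool \<Rightarrow> bool" where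
  "and_also True b = b" | "and_also False b = False"

lemma and_also_iff [simp]: "and_also b c \<longleftrightarrow> b \<and> c"
  by (cases b) auto

primrec all_memb :: "bits list \<Rightarrow> bits list \<Rightarrow> bool" where
  "all_memb [] B = True" | "all_memb (f # A) B = and_also (memb f B) (all_memb A B)"

lemma all_memb_iff [simp]: "all_memb A B \<longleftrightarrow> set A \<subseteq> set B"
  by (induction A) auto

primrec misses :: "bits \<Rightarrow> bits list \<Rightarrow> bits list" where
  "misses r [] = []" | "misses r (f # fs) = pick_if (\<not> sub r f) f (misses r fs)"

lemma set_misses [simp]: "set (misses r fs) = {f \<in> set fs. \<not> sub r f}"
  by (induction fs) (auto simp: pick_if_conv)

text \<open>Vertices are counted from 1; \<open>vx 0\<close> is an empty placeholder, which explains
  the side conditions excluding 0.\<close>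

fun vx :: "nat \<Rightarrow> bits" where
  "vx 0 = End" | "vx (Suc 0) = In End" | "vx (Suc (Suc n)) = Out (vx (Suc n))"

lemma verts_vx: "verts i (vx (Suc n)) = {i + n}"
  by (induction n arbitrary: i) auto

lemma verts_1_vx: "0 < v \<Longrightarrow> verts 1 (vx v) = {v}"
  using verts_vx[of 1 "v - 1"] by simp

text \<open>The blank word \<open>z\<close> pads the result to a common length, so that faces with
  the same vertices are equal as words.\<close>

primrec face_bits :: "bits \<Rightarrow> nat list \<Rightarrow> bits" where
  "face_bits z [] = z" | "face_bits z (v # vs) = bor (vx v) (face_bits z vs)"

lemma verts_mask: "verts 1 z = {} \<Longrightarrow> 0 \<notin> set vs \<Longrightarrow> verts 1 (face_bits z vs) = set vs"
  by (induction vs) (auto simp: verts_1_vx simp del: One_nat_def)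

text \<open>The apex is switched off but its position is kept, so the link retains the vertex
  numbers of the whole family.\<close>

definition blink :: "bits \<Rightarrow> bits list \<Rightarrow> bits list" where
  "blink u A = map (del u) (supersets u A)"

lemma fam_blink: "verts 1 u = {v} \<Longrightarrow> fam (blink u A) = lk v (fam A)"
  by (auto simp: blink_def fam_def lk_def sub_iff[of _ _ 1] image_iff simp del: One_nat_def)

lemma verts_ridges: "verts i ` set (ridges x) = (\<lambda>v. verts i x - {v}) ` verts i x"
proof
  show "verts i ` set (ridges x) \<subseteq> (\<lambda>v. verts i x - {v}) ` verts i x"
    unfolding set_ridges[of x i] by auto
  show "(\<lambda>v. verts i x - {v}) ` verts i x \<subseteq> verts i ` set (ridges x)"
  proof
    fix S assume "S \<in> (\<lambda>v. verts i x - {v}) ` verts i x"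
    then obtain v where v: "v \<in> verts i x" "S = verts i x - {v}" by blast
    then have "S \<subseteq> {i..<i + len x}" using verts_subset[of i x] by blast
    then obtain y where "len y = len x" "verts i y = S" using ex_verts by blast
    then have "y \<in> set (ridges x)" using v unfolding set_ridges[of x i] by blast
    then show "S \<in> verts i ` set (ridges x)" using \<open>verts i y = S\<close> by blast
  qed
qed

section \<open>Flips and sphere recognition on words\<close>

definition bflip :: "bits \<Rightarrow> bits \<Rightarrow> bits list \<Rightarrow> bits list" where
  "bflip a b A = misses a A @ map (bor b) (ridges a)"

text \<open>This evaluates \<open>flippable\<close>; a word with a ridge is one whose vertex set is
  not empty.\<close>

definition bflippable :: "bits \<Rightarrow> bits \<Rightarrow> bits list \<Rightarrow> bool" where
  "bflippable a b A \<longleftrightarrow> and_also (disj a b) (and_also (all_memb (supersets a A) (map (bor a) (ridges b)))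
     (and_also (all_memb (map (bor a) (ridges b)) A) (and_also (supersets b A = [])
     (and_also (ridges a \<noteq> []) (ridges b \<noteq> [])))))"

lemma fam_bflip:
  assumes "bflippable a b A"
  shows "flippable (verts 1 a) (verts 1 b) (fam A)"
    "fam (bflip a b A) = flip (verts 1 a) (verts 1 b) (fam A)"
proof -
  have dis: "verts 1 a \<inter> verts 1 b = {}" and st: "set (supersets a A) \<subseteq> set (map (bor a) (ridges b))"
    "set (map (bor a) (ridges b)) \<subseteq> set A" and nob: "supersets b A = []"
    and ne: "ridges a \<noteq> []" "ridges b \<noteq> []"
    using assms by (simp_all add: bflippable_def disj_iff[of a b 1] del: set_map set_supersets)
  have star: "verts 1 ` set (map (bor x) (ridges y)) = (\<lambda>v. verts 1 x \<union> verts 1 y - {v}) ` verts 1 y"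
    if "verts 1 x \<inter> verts 1 y = {}" for x y
  proof -
    have "verts 1 ` set (map (bor x) (ridges y)) = (\<union>) (verts 1 x) ` verts 1 ` set (ridges y)"
      by (simp add: image_image)
    also have "\<dots> = (\<lambda>v. verts 1 x \<union> (verts 1 y - {v})) ` verts 1 y"
      unfolding verts_ridges image_image ..
    also have "\<dots> = (\<lambda>v. verts 1 x \<union> verts 1 y - {v}) ` verts 1 y"
      using that by (intro image_cong) auto
    finally show ?thesis .
  qed
  have sup: "verts 1 ` set (supersets x A) = {f \<in> fam A. verts 1 x \<subseteq> f}" for x
    by (auto simp: fam_def sub_iff[of _ _ 1] simp del: One_nat_def)
  have mis: "verts 1 ` set (misses x A) = {f \<in> fam A. \<not> verts 1 x \<subseteq> f}" for x
    by (auto simp: fam_def sub_iff[of _ _ 1] simp del: One_nat_def)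
  have "set (supersets a A) = set (map (bor a) (ridges b))"
  proof
    show "set (map (bor a) (ridges b)) \<subseteq> set (supersets a A)"
    proof
      fix f assume f: "f \<in> set (map (bor a) (ridges b))"
      then have "verts 1 a \<subseteq> verts 1 f" by auto
      moreover have "f \<in> set A" using f st(2) by blast
      ultimately show "f \<in> set (supersets a A)" by (simp add: sub_iff[of _ _ 1] del: One_nat_def)
    qed
  qed (rule st(1))
  then have "{f \<in> fam A. verts 1 a \<subseteq> f} = (\<lambda>v. verts 1 a \<union> verts 1 b - {v}) ` verts 1 b"
    using sup[of a] star[OF dis] by simp
  moreover have nonempty: "verts 1 x \<noteq> {}" if "ridges x \<noteq> []" for x
    using that verts_ridges[of 1 x] by auto
  moreover have "\<forall>f\<in>fam A. \<not> verts 1 b \<subseteq> f" using sup[of b] nob by auto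
  ultimately show "flippable (verts 1 a) (verts 1 b) (fam A)"
    using dis ne unfolding flippable_def by simp
  have "fam (bflip a b A) = verts 1 ` set (misses a A) \<union> verts 1 ` set (map (bor b) (ridges a))"
    unfolding bflip_def fam_def set_append image_Un ..
  also have "\<dots> = flip (verts 1 a) (verts 1 b) (fam A)"
    unfolding flip_def mis star[OF dis[unfolded Int_commute[of "verts 1 a"]]] ..
  finally show "fam (bflip a b A) = flip (verts 1 a) (verts 1 b) (fam A)" .
qed

text \<open>Each proposed move is checked for applicability before it is carried out. What remains
  at the end must be exactly the four triangles on four vertices.\<close>

primrec spherical :: "bits \<Rightarrow> bits list \<Rightarrow> (nat list \<times> nat list) list \<Rightarrow> bool" where
  "spherical z A [] = and_also (weight (support A) = 4)
     (and_also (all_memb A (ridges (support A))) (all_memb (ridges (support A)) A))"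
| "spherical z A (m # ms) = and_also (bflippable (face_bits z (fst m)) (face_bits z (snd m)) A)
     (spherical z (bflip (face_bits z (fst m)) (face_bits z (snd m)) A) ms)"

lemma spherical_triangulates:
  "spherical z A ms \<Longrightarrow> triangulates (complex_of (fam A)) (sphere (0 :: real ^ 3) 1)"
proof (induction ms arbitrary: A)
  case Nil
  define B where "B = verts 1 (support A)"
  have B: "finite B" "card B = 4" using Nil by (simp_all add: B_def card_verts)
  have eq: "set A = set (ridges (support A))" using Nil by (simp add: set_eq_subset)
  have fA: "fam A = (\<lambda>v. B - {v}) ` B" unfolding fam_def eq verts_ridges B_def ..
  have "complex_of (fam A) = {\<tau>. \<tau> \<noteq> {} \<and> \<tau> \<subset> B}"
    unfolding complex_of_def fA by auto
  then show ?case
    using carrier_simplex_boundary[where 'b = "real ^ 3", of B] B unfolding triangulates_def by simp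
next
  case (Cons m ms)
  let ?a = "face_bits z (fst m)" and ?b = "face_bits z (snd m)"
  have fl: "bflippable ?a ?b A" and sp: "spherical z (bflip ?a ?b A) ms" using Cons.prems by simp_all
  have "\<forall>f\<in>fam A. finite f" by (simp add: fam_def)
  from carrier_flip_homeomorphic[OF fam_bflip(1)[OF fl] this]
  show ?case using Cons.IH[OF sp] unfolding triangulates_def fam_bflip(2)[OF fl]
    by (rule homeomorphic_trans)
qed

text \<open>A relabelling is the list of the images of the vertices 1, 2, and so on;
  \<open>z\<close> supplies the length of the resulting word.\<close>

fun img :: "bits \<Rightarrow> nat list \<Rightarrow> bits \<Rightarrow> bits" where
  "img z (p # ps) (In x) = bor (vx p) (img z ps x)"
| "img z (p # ps) (Out x) = img z ps x"
| "img z ps x = z"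

lemma len_eq_0 [simp]: "len x = 0 \<longleftrightarrow> x = End"
  by (cases x) auto

lemma verts_img:
  "verts i x \<subseteq> {i..<i + length p} \<Longrightarrow> 0 \<notin> set p \<Longrightarrow> verts 1 z = {} \<Longrightarrow>
    verts 1 (img z p x) = (\<lambda>v. p ! (v - i)) ` verts i x"
proof (induction z p x arbitrary: i rule: img.induct)
  case (1 z p ps x)
  have "(\<lambda>v. (p # ps) ! (v - i)) ` verts (Suc i) x = (\<lambda>v. ps ! (v - Suc i)) ` verts (Suc i) x"
    by (intro image_cong) (auto dest!: verts_less simp: nth_Cons')
  moreover have "verts (Suc i) x \<subseteq> {Suc i..<Suc i + length ps}"
    using 1(2) verts_less[of _ "Suc i" x] by fastforce
  then have "verts 1 (img z ps x) = (\<lambda>v. ps ! (v - Suc i)) ` verts (Suc i) x"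
    using 1(3,4) by (intro 1(1)) auto
  moreover have "verts 1 (vx p) = {p}" using 1(3) by (intro verts_1_vx) auto
  ultimately show ?case by simp
next
  case (2 z p ps x)
  have "(\<lambda>v. (p # ps) ! (v - i)) ` verts (Suc i) x = (\<lambda>v. ps ! (v - Suc i)) ` verts (Suc i) x"
    by (intro image_cong) (auto dest!: verts_less simp: nth_Cons')
  moreover have "verts (Suc i) x \<subseteq> {Suc i..<Suc i + length ps}"
    using 2(2) verts_less[of _ "Suc i" x] by fastforce
  then have "verts 1 (img z ps x) = (\<lambda>v. ps ! (v - Suc i)) ` verts (Suc i) x"
    using 2(3,4) by (intro 2(1)) auto
  ultimately show ?case by simp
qed auto

section \<open>Components and the discarding of leaves\<close>

primrec absorb_one :: "bool \<Rightarrow> bits \<Rightarrow> bits \<Rightarrow> bits" where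
  "absorb_one True f S = S" | "absorb_one False f S = bor f S"

primrec absorb :: "bits list \<Rightarrow> bits \<Rightarrow> bits" where
  "absorb [] S = S" | "absorb (f # fs) S = absorb fs (absorb_one (disj f S) f S)"

text \<open>Three rounds reach the whole component in all cases that occur.\<close>

definition component :: "bits \<Rightarrow> bits list \<Rightarrow> bits" where
  "component f fs = absorb fs (absorb fs (absorb fs f))"

primrec splits :: "bits \<Rightarrow> bits list \<Rightarrow> bool" where
  "splits S [] = True" | "splits S (f # A) = and_also (or_else (sub f S) (disj f S)) (splits S A)"

text \<open>That \<open>S\<close> is a union of components is checked again here, so a component
  computed only in part would make the test fail but could never discard a connected family.\<close>

definition disconnected :: "bits \<Rightarrow> bits list \<Rightarrow> bool" where
  "disconnected S A \<longleftrightarrow> and_also (splits S A)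
     (and_also (\<not> disj S (support A)) (\<not> sub (support A) S))"

lemma disconnected_not_conn:
  assumes "disconnected S A"
  shows "\<not> conn (fam A)"
proof
  assume con: "conn (fam A)"
  have "splits S B \<Longrightarrow> f \<in> set B \<Longrightarrow> verts 1 f \<subseteq> verts 1 S \<or> verts 1 f \<inter> verts 1 S = {}" for f B
    by (induction B) (auto simp: sub_iff[of _ _ 1] disj_iff[of _ _ 1] simp del: One_nat_def)
  then have sep: "f \<subseteq> verts 1 S \<or> f \<inter> verts 1 S = {}" if "f \<in> fam A" for f
    using assms that by (auto simp: disconnected_def fam_def simp del: One_nat_def)
  have "\<forall>f\<in>fam A. f \<subseteq> verts 1 S \<inter> \<Union>(fam A) \<or> f \<inter> (verts 1 S \<inter> \<Union>(fam A)) = {}"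
  proof
    fix f assume f: "f \<in> fam A"
    then have "f \<subseteq> \<Union>(fam A)" by (rule Union_upper)
    then show "f \<subseteq> verts 1 S \<inter> \<Union>(fam A) \<or> f \<inter> (verts 1 S \<inter> \<Union>(fam A)) = {}"
      using sep[OF f] by blast
  qed
  then have "verts 1 S \<inter> \<Union>(fam A) = {} \<or> verts 1 S \<inter> \<Union>(fam A) = \<Union>(fam A)"
    using con[unfolded conn_def, THEN spec, THEN mp, THEN mp, OF Int_lower2] by simp
  moreover have "verts 1 S \<inter> \<Union>(fam A) \<noteq> {}" "\<not> \<Union>(fam A) \<subseteq> verts 1 S"
    using assms unfolding disconnected_def verts_support[symmetric]
    by (simp_all add: disj_iff[of _ _ 1] sub_iff[of _ _ 1] del: One_nat_def)
  ultimately show False by blast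
qed

fun split_off :: "bits list \<Rightarrow> bool" where
  "split_off [] = False" | "split_off (f # fs) = disconnected (component f fs) (f # fs)"

primrec any_link :: "(bits list \<Rightarrow> bool) \<Rightarrow> bits list \<Rightarrow> bits list \<Rightarrow> bool" where
  "any_link g [] A = False" | "any_link g (v # vs) A = or_else (g (blink v A)) (any_link g vs A)"

lemma any_link_iff: "any_link g vs A \<longleftrightarrow> (\<exists>v\<in>set vs. g (blink v A))"
  by (induction vs) auto

text \<open>Only links of depth exactly \<open>j\<close> are inspected. In the applications
  \<open>j\<close> is the dimension of the prescribed link, one less than that of the family, so
  these are the graphs among the iterated links. A leaf is rejected when one of them is
  disconnected.\<close>

primrec split_links :: "bits list \<Rightarrow> nat \<Rightarrow> bits list \<Rightarrow> bool" where
  "split_links vs 0 A = split_off A"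
| "split_links vs (Suc j) A = any_link (split_links vs j) vs A"

definition vertex_list :: "nat \<Rightarrow> bits list" where
  "vertex_list n = map vx [1..<Suc n]"

lemma set_vertex_list: "set (vertex_list n) = vx ` {1..<Suc n}"
  by (simp add: vertex_list_def del: upt_Suc)

lemma split_links_not_conn_links:
  "split_links (vertex_list n) j A \<Longrightarrow> \<not> conn_links (Suc j) (fam A)"
proof (induction j arbitrary: A)
  case 0
  then show ?case using disconnected_not_conn by (cases A) auto
next
  case (Suc j)
  have empty: "\<not> split_links vs i []" for vs i
    by (induction i) (simp_all add: any_link_iff blink_def)
  obtain v where v: "v \<in> {1..<Suc n}" "split_links (vertex_list n) j (blink (vx v) A)"
    using Suc.prems unfolding split_links.simps any_link_iff set_vertex_list by blast
  then have bl: "fam (blink (vx v) A) = lk v (fam A)" by (intro fam_blink verts_1_vx) auto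
  \<comment> \<open>An empty link never passes the test, so \<open>v\<close> is a vertex of the
    family and normality really speaks about its link.\<close>
  have "blink (vx v) A \<noteq> []" using v(2) empty by metis
  then have "lk v (fam A) \<noteq> {}" unfolding bl[symmetric] by (simp add: fam_def)
  then have "v \<in> \<Union>(fam A)" by (simp only: lk_empty_iff not_not)
  then show ?case using Suc.IH[OF v(2)] unfolding bl conn_links.simps(2)[of "Suc j"] by blast
qed

definition exceeds :: "nat \<Rightarrow> bits list \<Rightarrow> bool" where
  "exceeds d A \<longleftrightarrow> d < weight (support A)"

text \<open>Here \<open>u\<close> is the set of all vertices and \<open>d\<close> an upper bound for the vertex degrees.\<close>

definition discarded :: "bits \<Rightarrow> nat \<Rightarrow> nat \<Rightarrow> bits list \<Rightarrow> bool" where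
  "discarded u d j A \<longleftrightarrow> or_else (\<not> sub u (support A)) (or_else (split_links (vertex_list (len u)) j A)
     (any_link (exceeds d) (vertex_list (len u)) A))"

lemma discarded_sound:
  assumes u: "verts 1 u = {1..len u}" and A: "\<Union>(fam A) = {1..len u}"
    and conn: "conn_links (Suc j) (fam A)" and deg: "\<And>v. v \<in> \<Union>(fam A) \<Longrightarrow> card (\<Union>(lk v (fam A))) \<le> d"
  shows "\<not> discarded u d j A"
proof -
  have "sub u (support A)" unfolding sub_iff[of _ _ 1] verts_support u A ..
  moreover have "\<not> split_links (vertex_list (len u)) j A" using split_links_not_conn_links conn by blast
  moreover have "\<not> exceeds d (blink (vx v) A)" if v: "v \<in> {1..<Suc (len u)}" for v
  proof -
    have "verts 1 (support (blink (vx v) A)) = \<Union>(lk v (fam A))"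
      unfolding verts_support using v by (subst fam_blink[OF verts_1_vx]) auto
    then have "weight (support (blink (vx v) A)) = card (\<Union>(lk v (fam A)))" using card_verts by metis
    moreover have "v \<in> \<Union>(fam A)" using v unfolding A by auto
    ultimately show ?thesis using deg[of v] by (simp add: exceeds_def)
  qed
  ultimately show ?thesis
    by (auto simp: discarded_def any_link_iff set_vertex_list)
qed

section \<open>Leaf certificates\<close>

datatype cert = Sphere "(nat list \<times> nat list) list" | Iso "bits list" "nat list"

primrec check :: "bits \<Rightarrow> bits list \<Rightarrow> cert \<Rightarrow> bool" where
  "check u A (Sphere ms) = spherical (zeros u) A ms"
| "check u A (Iso G p) = and_also (len u = length p) (and_also (list_all ((<) 0) p)
     (and_also (sub u (face_bits (zeros u) p)) (and_also (sub (support G) u)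
     (and_also (all_memb A (map (img (zeros u) p) G)) (all_memb (map (img (zeros u) p) G) A)))))"

lemma check_Iso:
  assumes c: "check u A (Iso G p)" and u: "verts 1 u = {1..len u}"
  shows "fam_iso (fam G) (fam A)"
proof -
  have len: "len u = length p" and p0: "0 \<notin> set p" and pu: "sub u (face_bits (zeros u) p)"
    and Gu: "sub (support G) u"
    and eq: "set A = set (map (img (zeros u) p) G)"
    using c by (auto simp: list_all_iff)
  define h where "h v = p ! (v - 1)" for v
  have z: "verts 1 (zeros u) = {}" by simp
  have "{1..length p} \<subseteq> set p"
    using pu u len verts_mask[OF z p0] by (simp add: sub_iff[of _ _ 1] del: One_nat_def)
  \<comment> \<open>A list that takes as many values as it has entries is free of repetitions; hence
    \<open>h\<close> is injective.\<close>
  then have "length p \<le> card (set p)"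
    using card_mono[of "set p" "{1..length p}"] by simp
  then have "distinct p" using card_length[of p] card_distinct by (metis le_antisym)
  then have "inj_on h {1..length p}"
    unfolding h_def inj_on_def by (auto simp: nth_eq_iff_index_eq)
  moreover have G: "\<Union>(fam G) \<subseteq> {1..length p}"
    using Gu unfolding verts_support[symmetric] sub_iff[of _ _ 1] u len .
  ultimately have "inj_on h (\<Union>(fam G))" by (rule inj_on_subset)
  moreover have "fam A = (`) h ` fam G"
  proof -
    have "fam A = (\<lambda>x. verts 1 (img (zeros u) p x)) ` set G"
      unfolding fam_def eq set_map image_image ..
    also have "\<dots> = (\<lambda>x. h ` verts 1 x) ` set G"
    proof (rule image_cong)
      fix x assume "x \<in> set G"
      then have "verts 1 x \<subseteq> {1..<1 + length p}" using G by (auto simp: fam_def simp del: One_nat_def)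
      then show "verts 1 (img (zeros u) p x) = h ` verts 1 x"
        unfolding h_def using p0 z by (rule verts_img)
    qed simp
    finally show ?thesis unfolding fam_def image_image .
  qed
  ultimately show ?thesis unfolding fam_iso_def by blast
qed

primrec keep :: "bits \<Rightarrow> nat \<Rightarrow> nat \<Rightarrow> bits list list \<Rightarrow> bits list list" where
  "keep u d j [] = []"
| "keep u d j (A # As) = pick_if (\<not> discarded u d j A) A (keep u d j As)"

lemma set_keep: "set (keep u d j As) = {A \<in> set As. \<not> discarded u d j A}"
  by (induction As) (auto simp: pick_if_conv)

section \<open>The complexes and the certificates\<close>

definition blank7 :: bits where
  "blank7 = Out (Out (Out (Out (Out (Out (Out End))))))"

definition blank8 :: bits where
  "blank8 = Out blank7"

definition cycle_list :: "nat \<Rightarrow> bits list" where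
  "cycle_list n = map (\<lambda>i. face_bits blank7 [i, Suc i]) [1..<n] @ [face_bits blank7 [1, n]]"

text \<open>The 6-vertex projective plane, in which any two vertices are joined. Here and in the
  next four surfaces each triangle after the first shares with an earlier one an edge not lying on
  the cycle used later for cutting the surface.\<close>

definition RP6 :: "bits list" where
  "RP6 = map (face_bits blank7) [
     [2,5,6], [1,5,6], [1,4,6], [1,2,4], [2,3,6], [1,2,3], [1,3,5], [2,4,5], [3,4,5], [3,4,6]]"

text \<open>This list and the next two are the projective planes on 7 vertices: 12 triangles and 18
  edges give Euler characteristic 1.\<close>

definition RP7a :: "bits list" where
  "RP7a = map (face_bits blank7) [
     [2,5,7], [2,3,5], [2,6,7], [3,5,6], [3,6,7], [3,4,7], [1,3,4], [1,2,3], [1,2,4], [2,4,6],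
     [4,5,6], [4,5,7]]"

definition RP7b :: "bits list" where
  "RP7b = map (face_bits blank7) [
     [4,6,7], [2,4,7], [1,2,4], [1,4,5], [2,5,7], [3,5,7], [1,3,5], [1,2,3], [2,3,6], [2,5,6],
     [3,6,7], [4,5,6]]"

definition RP7c :: "bits list" where
  "RP7c = map (face_bits blank7) [
     [2,4,7], [1,2,4], [1,4,5], [2,5,7], [3,4,7], [3,4,6], [2,3,6], [1,2,3], [1,3,5], [2,5,6],
     [3,5,7], [4,5,6]]"

text \<open>The Moebius torus: 14 triangles whose 21 edges join all pairs of the 7 vertices.\<close>

definition T7 :: "bits list" where
  "T7 = map (face_bits blank7) [
     [1,6,7], [1,4,6], [1,2,4], [1,5,7], [2,4,7], [2,5,7], [3,4,7], [3,4,5], [1,3,5], [1,2,3],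
     [2,3,6], [2,5,6], [3,6,7], [4,5,6]]"

section \<open>Facet lists of the 35 complexes and their singular vertices\<close>

definition swap :: "nat list \<Rightarrow> nat list \<Rightarrow> bits list \<Rightarrow> bits list" where
  "swap \<alpha> \<beta> = bflip (face_bits blank8 \<alpha>) (face_bits blank8 \<beta>)"

definition M1 :: "bits list" where
  "M1 = map (face_bits blank8) [
     [1,2,4,8], [1,2,6,8], [1,3,4,8], [1,3,7,8], [1,5,6,8], [1,5,7,8], [2,3,5,8], [2,3,7,8],
     [2,4,5,8], [2,6,7,8], [3,4,6,8], [3,5,6,8], [4,5,7,8], [4,6,7,8], [1,2,4,7], [1,2,5,7],
     [1,3,6,7], [1,4,6,7], [2,3,4,7], [2,5,6,7], [3,4,5,7], [3,5,6,7], [1,2,3,6], [2,3,4,6],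
     [1,3,4,5], [1,2,3,5], [1,4,5,6], [2,4,5,6]]"

definition M2 :: "bits list" where
  "M2 = map (face_bits blank8) [
     [1,2,4,8], [2,4,5,8], [2,3,5,8], [3,5,6,8], [3,4,6,8], [4,6,7,8], [4,5,7,8], [1,5,7,8],
     [1,5,6,8], [1,2,6,8], [2,6,7,8], [2,3,7,8], [1,3,7,8], [1,3,4,8], [1,2,4,7], [2,4,5,7],
     [2,3,5,7], [3,5,6,7], [3,4,6,7], [1,5,6,7], [1,2,6,7], [1,3,4,7]]"

definition M3 :: "bits list" where
  "M3 = map (face_bits blank8) [
     [1,2,4,8], [1,2,6,8], [1,3,4,8], [1,3,7,8], [1,5,6,8], [1,5,7,8], [2,3,5,8], [2,3,7,8],
     [2,4,5,8], [2,6,7,8], [3,4,6,8], [3,5,6,8], [4,5,7,8], [4,6,7,8], [1,2,3,4], [2,3,4,7],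
     [2,4,5,6], [2,4,6,7], [3,4,5,6], [3,4,5,7], [1,2,3,5], [1,2,5,6], [1,3,5,7]]"

definition M4 :: "bits list" where
  "M4 = map (face_bits blank8) [
     [1,2,4,8], [1,2,6,8], [1,3,4,8], [1,3,7,8], [1,5,6,8], [1,5,7,8], [2,3,5,8], [2,3,7,8],
     [2,4,5,8], [2,6,7,8], [3,4,6,8], [3,5,6,8], [4,5,7,8], [4,6,7,8], [1,2,4,5], [1,2,5,6],
     [2,3,5,6], [2,3,6,7], [3,4,6,7], [1,3,4,7], [1,4,5,7]]"

definition M5 :: "bits list" where
  "M5 = map (face_bits blank8) [
     [1,2,5,8], [1,2,6,8], [1,3,5,8], [1,3,7,8], [1,4,6,8], [1,4,7,8], [2,3,6,8], [2,3,7,8],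
     [2,4,5,8], [2,4,7,8], [3,4,5,8], [3,4,6,8], [1,2,5,7], [1,2,6,7], [1,3,6,7], [1,4,5,7],
     [2,3,5,7], [2,4,6,7], [3,4,5,7], [3,4,6,7], [2,3,5,6], [2,4,5,6], [1,3,5,6], [1,4,5,6]]"

definition M6 :: "bits list" where
  "M6 = map (face_bits blank8) [
     [1,3,5,8], [1,3,7,8], [1,4,6,8], [1,4,7,8], [1,5,6,8], [2,3,6,8], [2,3,7,8], [2,4,5,8],
     [2,4,7,8], [2,5,6,8], [3,4,5,8], [3,4,6,8], [1,2,3,5], [1,2,4,5], [1,4,5,7], [1,5,6,7],
     [2,3,5,7], [2,5,6,7], [3,4,5,7], [1,2,3,6], [1,2,4,6], [1,3,6,7], [2,4,6,7], [3,4,6,7]]"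

definition M7 :: "bits list" where
  "M7 = map (face_bits blank8) [
     [1,2,6,8], [1,2,5,8], [1,3,5,8], [1,3,7,8], [1,4,7,8], [1,4,6,8], [2,3,7,8], [2,3,6,8],
     [2,4,5,8], [2,4,7,8], [3,4,6,8], [3,4,5,8], [1,3,5,6], [1,3,6,7], [2,3,5,7], [2,3,5,6],
     [3,4,6,7], [3,4,5,7], [1,2,5,6], [1,4,6,7], [2,4,5,7]]"

text \<open>From here on the opposite face \<beta> of each move is written out. The order follows
  the moves instead of the numbering: the intermediate results of the nested moves are themselves
  among the 35, for example \<open>M16\<close>, \<open>M25\<close> and \<open>M18\<close> on the way
  to \<open>M8\<close>.\<close>

definition M16 :: "bits list" where
  "M16 = swap [6,7] [1,3,4] M7"

definition M25 :: "bits list" where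
  "M25 = swap [5,6] [1,2,3] M16"

definition M18 :: "bits list" where
  "M18 = swap [2,3,8] [6,7] M25"

definition M8 :: "bits list" where
  "M8 = swap [3,4,8] [5,6] M18"

definition M9 :: "bits list" where
  "M9 = swap [2,3,5] [6,7] M16"

definition M10 :: "bits list" where
  "M10 = swap [1,4,8] [6,7] M16"

definition M20 :: "bits list" where
  "M20 = swap [5,6] [1,2,3] M10"

definition M11 :: "bits list" where
  "M11 = swap [3,4,8] [5,6] M20"

definition M23 :: "bits list" where
  "M23 = swap [2,3] [6,7,8] M9"

definition M12 :: "bits list" where
  "M12 = swap [4,5,7] [2,3] M23"

definition M13 :: "bits list" where
  "M13 = swap [5,6,7] [2,3] M23"

definition M19 :: "bits list" where
  "M19 = swap [5,7] [2,3,4] M8"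

definition M14 :: "bits list" where
  "M14 = swap [1,3,8] [5,7] M19"

definition M15 :: "bits list" where
  "M15 = swap [1,5,8] [2,3] M23"

definition M17 :: "bits list" where
  "M17 = swap [2,4] [5,7,8] M8"

definition M21 :: "bits list" where
  "M21 = swap [1,2] [5,6,8] M9"

definition M22 :: "bits list" where
  "M22 = swap [1,4] [3,6,7] M11"

definition M24 :: "bits list" where
  "M24 = swap [3,8] [5,6,7] M14"

definition M26 :: "bits list" where
  "M26 = swap [1,2] [5,6,8] M16"

definition M27 :: "bits list" where
  "M27 = swap [5,6] [3,4,8] M17"

definition M28 :: "bits list" where
  "M28 = swap [5,7] [2,3,4] M18"

definition M29 :: "bits list" where
  "M29 = swap [1,5] [2,3,8] M18"

definition M30 :: "bits list" where
  "M30 = swap [1,2] [5,6,8] M23"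

definition M31 :: "bits list" where
  "M31 = swap [2,4] [5,7,8] M22"

definition M32 :: "bits list" where
  "M32 = swap [2,4] [5,7,8] M26"

definition M33 :: "bits list" where
  "M33 = swap [5,7] [2,3,4] M25"

definition M34 :: "bits list" where
  "M34 = swap [4,5] [2,3,8] M28"

definition M35 :: "bits list" where
  "M35 = swap [5,8] [2,3,4] M29"

text \<open>An entry gives a complex, a vertex whose link is not a sphere, the surface that occurs
  there and a relabelling of that surface onto the link. The entries beyond the vertices of the
  surface only complete the list to a permutation: they are the apex and, for \<open>RP6\<close>,
  the vertex not joined to the apex.\<close>

definition singular_links :: "(bits list \<times> nat \<times> bits list \<times> nat list) list" where
  "singular_links = [
     (M1, 1, T7, [2,3,6,5,8,7,4,1]), (M2, 7, T7, [1,2,4,6,3,5,8,7]),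
     (M3, 2, RP7b, [7,4,3,6,8,1,5,2]), (M4, 8, T7, [1,2,4,6,3,5,7,8]),
     (M5, 1, RP7c, [2,5,7,8,6,4,3,1]), (M6, 1, RP7b, [2,5,3,4,6,8,7,1]),
     (M7, 3, RP7c, [1,5,6,8,7,2,4,3]), (M8, 3, RP7c, [2,1,5,6,7,8,4,3]),
     (M9, 3, RP7a, [2,6,7,8,5,4,1,3]), (M10, 3, RP7b, [2,5,6,7,8,1,4,3]),
     (M11, 3, RP7b, [4,1,6,7,5,2,8,3]), (M12, 3, RP7a, [2,4,5,7,8,1,6,3]),
     (M13, 3, RP7a, [2,5,6,7,1,4,8,3]), (M14, 3, RP7a, [8,5,6,7,4,1,2,3]),
     (M15, 3, RP7a, [2,1,5,8,6,7,4,3]), (M16, 3, RP7b, [2,5,6,7,8,1,4,3]),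
     (M17, 3, RP7c, [2,1,5,6,7,8,4,3]), (M18, 3, RP7b, [2,1,5,6,7,8,4,3]),
     (M19, 3, RP7b, [8,1,5,7,6,2,4,3]), (M20, 3, RP7b, [6,1,2,4,8,5,7,3]),
     (M21, 3, RP7a, [2,6,7,8,5,4,1,3]), (M22, 3, RP7a, [4,5,6,7,8,2,1,3]),
     (M23, 3, RP6, [1,4,6,7,5,8,2,3]), (M24, 3, RP6, [1,2,5,6,7,4,3,8]),
     (M25, 3, RP7b, [6,1,2,4,8,5,7,3]), (M26, 3, RP7b, [2,5,6,7,8,1,4,3]),
     (M27, 3, RP7b, [2,1,5,6,7,8,4,3]), (M28, 3, RP7b, [5,1,2,8,4,6,7,3]),
     (M29, 3, RP7b, [5,7,2,4,8,6,1,3]), (M30, 3, RP6, [1,4,6,7,5,8,2,3]),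
     (M31, 3, RP7a, [4,5,6,7,8,2,1,3]), (M32, 3, RP7b, [2,5,6,7,8,1,4,3]),
     (M33, 3, RP7c, [5,1,2,8,4,6,7,3]), (M34, 3, RP7a, [5,1,2,8,6,7,4,3]),
     (M35, 3, RP7a, [5,2,4,7,8,6,1,3])]"

definition Ms :: "bits list list" where
  "Ms = [
     M1, M2, M3, M4, M5, M6, M7, M8, M9, M10, M11, M12, M13, M14, M15, M16, M17, M18, M19, M20,
     M21, M22, M23, M24, M25, M26, M27, M28, M29, M30, M31, M32, M33, M34, M35]"

section \<open>Certificates, in the order in which the surviving leaves appear\<close>

definition certs_cycle3 :: "cert list" where
  "certs_cycle3 = [
     Iso (cycle_list 3) [1,2,3]]"

definition certs_cycle4 :: "cert list" where
  "certs_cycle4 = [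
     Iso (cycle_list 4) [1,2,4,3]]"

definition certs_cycle5 :: "cert list" where
  "certs_cycle5 = [
     Iso (cycle_list 5) [1,2,4,5,3], Iso (cycle_list 5) [1,2,5,4,3]]"

definition certs_cycle6 :: "cert list" where
  "certs_cycle6 = [
     Iso (cycle_list 6) [1,2,4,5,6,3], Iso (cycle_list 6) [1,2,4,6,5,3],
     Iso (cycle_list 6) [1,2,5,4,6,3], Iso (cycle_list 6) [1,2,5,6,4,3],
     Iso (cycle_list 6) [1,2,6,4,5,3], Iso (cycle_list 6) [1,2,6,5,4,3]]"

text \<open>The two digits are the number of vertices and the maximal vertex degree. An empty list
  records that no leaf survives, so that no surface has these parameters.\<close>

definition certs_surface43 :: "cert list" where
  "certs_surface43 = [
     Sphere []]"

definition certs_surface53 :: "cert list" where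
  "certs_surface53 = []"

definition certs_surface54 :: "cert list" where
  "certs_surface54 = [
     Sphere [([3],[1,2,4])], Sphere [([2],[1,3,5])]]"

definition certs_surface63 :: "cert list" where
  "certs_surface63 = []"

definition certs_surface64 :: "cert list" where
  "certs_surface64 = [
     Sphere [([1,2],[3,5]),([1],[3,4,5]),([2],[3,5,6])]]"

definition certs_surface65 :: "cert list" where
  "certs_surface65 = [
     Sphere [([3],[1,2,4]),([4],[1,2,5])], Sphere [([3],[1,2,4]),([2],[1,4,6])],
     Sphere [([4],[1,3,5]),([3],[1,2,5])], Iso RP6 [1,2,3,6,4,5],
     Sphere [([2],[1,3,6]),([3],[1,4,6])], Sphere [([2],[1,3,6]),([4],[1,3,5])]]"

definition certs_surface73 :: "cert list" where
  "certs_surface73 = []"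

definition certs_surface74 :: "cert list" where
  "certs_surface74 = []"

definition certs_surface75 :: "cert list" where
  "certs_surface75 = [
     Sphere [([3],[1,2,4]),([1,2],[4,6]),([1],[4,5,6]),([2],[4,6,7])],
     Sphere [([2],[1,3,6]),([1,3],[4,6]),([1],[4,5,6]),([3],[4,6,7])],
     Sphere [([6],[1,2,5]),([1,2],[3,5]),([1],[3,4,5]),([2],[3,5,7])],
     Sphere [([1,2],[3,6]),([2],[3,6,7]),([1,3],[4,6]),([1],[4,5,6]),([3],[4,6,7])],
     Sphere [([5],[1,4,6]),([1,2],[3,6]),([1],[3,4,6]),([2],[3,6,7])],
     Sphere [([4],[1,3,5]),([1,2],[3,6]),([1],[3,5,6]),([2],[3,6,7])]]"

definition certs_surface76 :: "cert list" where
  "certs_surface76 = [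
     Sphere [([3],[1,2,4]),([4],[1,2,5]),([5],[1,2,6])],
     Sphere [([3],[1,2,4]),([4],[1,2,5]),([2],[1,5,7])],
     Sphere [([3],[1,2,4]),([5],[1,4,6]),([4],[1,2,6])], Iso RP7a [3,1,2,4,7,5,6],
     Sphere [([3],[1,2,4]),([2],[1,4,7]),([4],[1,5,7])],
     Sphere [([3],[1,2,4]),([2],[1,4,7]),([5],[1,4,6])],
     Sphere [([4],[1,3,5]),([3],[1,2,5]),([5],[1,2,6])],
     Sphere [([4],[1,3,5]),([3],[1,2,5]),([2],[1,5,7])], Iso RP7a [7,1,2,6,3,5,4],
     Iso RP7b [7,1,2,6,4,3,5], Iso RP7b [2,1,3,7,5,4,6], Iso RP7b [6,1,5,7,3,4,2],
     Iso RP7c [2,1,3,7,5,4,6], Iso T7 [1,2,7,3,6,4,5], Iso RP7a [6,1,5,7,4,2,3],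
     Sphere [([5],[1,4,6]),([4],[1,3,6]),([3],[1,2,6])], Iso RP7c [3,1,2,4,6,7,5],
     Iso RP7b [3,1,2,4,6,7,5], Sphere [([4],[1,3,5]),([5],[1,3,6]),([3],[1,2,6])],
     Iso T7 [1,2,3,7,4,6,5], Iso RP7b [5,1,4,6,2,3,7], Iso RP7a [5,1,4,6,3,7,2],
     Iso RP7b [4,1,3,5,7,2,6], Iso RP7a [4,1,3,5,2,6,7],
     Sphere [([2],[1,3,7]),([3],[1,4,7]),([4],[1,5,7])],
     Sphere [([2],[1,3,7]),([3],[1,4,7]),([5],[1,4,6])], Iso RP7a [2,1,3,7,4,6,5],
     Sphere [([2],[1,3,7]),([4],[1,3,5]),([3],[1,5,7])],
     Sphere [([2],[1,3,7]),([5],[1,4,6]),([4],[1,3,6])],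
     Sphere [([2],[1,3,7]),([4],[1,3,5]),([5],[1,3,6])]]"

text \<open>The search does not identify isomorphic leaves, so one complex serves for many of them
  under different relabellings. Here and in the following four lists no leaf is certified as a
  sphere.\<close>

definition certs_RP6 :: "cert list" where
  "certs_RP6 = [
     Iso M35 [4,3,2,5,8,7,6,1], Iso M35 [3,4,2,6,8,7,5,1], Iso M30 [7,8,1,3,5,4,6,2],
     Iso M23 [3,8,1,7,5,6,4,2], Iso M35 [3,5,2,7,8,6,4,1], Iso M30 [3,8,1,6,4,7,5,2],
     Iso M35 [5,2,3,4,8,7,6,1], Iso M30 [7,8,1,2,4,5,6,3], Iso M35 [2,5,3,6,8,7,4,1],
     Iso M23 [2,8,1,7,4,6,5,3], Iso M35 [2,4,3,7,8,6,5,1], Iso M30 [2,8,1,6,5,7,4,3],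
     Iso M35 [5,3,2,4,8,6,7,1], Iso M30 [6,8,1,2,5,4,7,3], Iso M23 [2,8,1,6,5,7,4,3],
     Iso M30 [6,8,1,3,4,5,7,2], Iso M23 [3,8,1,6,4,7,5,2], Iso M35 [4,2,3,5,8,6,7,1],
     Iso M35 [2,6,4,5,8,7,3,1], Iso M35 [6,2,4,3,8,7,5,1], Iso M30 [7,8,1,2,3,6,5,4],
     Iso M30 [6,8,1,3,2,7,5,4], Iso M23 [6,8,1,7,5,3,2,4], Iso M35 [3,7,4,5,8,6,2,1],
     Iso M35 [5,4,6,2,8,7,3,1], Iso M35 [4,5,6,3,8,7,2,1], Iso M30 [7,8,1,4,2,5,3,6],
     Iso M30 [4,8,1,3,5,7,2,6], Iso M23 [4,8,1,7,2,3,5,6], Iso M35 [3,7,6,2,8,4,5,1],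
     Iso M35 [3,2,4,6,8,5,7,1], Iso M30 [3,8,1,5,7,6,2,4], Iso M23 [3,8,1,6,2,5,7,4],
     Iso M30 [3,8,1,2,7,4,5,6], Iso M23 [3,8,1,4,5,2,7,6], Iso M35 [2,4,6,5,8,3,7,1],
     Iso M35 [2,7,5,4,8,6,3,1], Iso M35 [6,3,5,2,8,7,4,1], Iso M30 [6,8,1,2,3,7,4,5],
     Iso M30 [7,8,1,3,2,6,4,5], Iso M23 [6,8,1,7,4,2,3,5], Iso M35 [3,6,5,4,8,7,2,1],
     Iso M35 [4,5,7,2,8,6,3,1], Iso M35 [5,4,7,3,8,6,2,1], Iso M30 [6,8,1,4,3,5,2,7],
     Iso M30 [5,8,1,3,4,6,2,7], Iso M35 [3,6,7,2,8,5,4,1], Iso M23 [5,8,1,6,2,3,4,7],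
     Iso M23 [3,8,1,5,4,2,6,7], Iso M30 [3,8,1,2,6,5,4,7], Iso M23 [3,8,1,7,2,4,6,5],
     Iso M30 [3,8,1,4,6,7,2,5], Iso M35 [3,2,5,7,8,4,6,1], Iso M35 [2,5,7,4,8,3,6,1],
     Iso M23 [5,8,1,7,6,4,2,3], Iso M30 [5,8,1,4,2,7,6,3], Iso M30 [4,8,1,5,3,7,6,2],
     Iso M23 [4,8,1,7,6,5,3,2], Iso M35 [4,7,3,6,8,5,2,1], Iso M35 [4,6,2,7,8,5,3,1],
     Iso M23 [4,8,1,5,3,7,6,2], Iso M30 [5,8,1,4,3,6,7,2], Iso M23 [2,8,1,5,6,7,3,4],
     Iso M30 [5,8,1,2,6,3,7,4], Iso M23 [2,8,1,3,6,4,5,7], Iso M23 [4,8,1,5,2,6,7,3],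
     Iso M30 [4,8,1,5,2,6,7,3], Iso M30 [4,8,1,2,7,3,6,5], Iso M23 [3,8,1,4,6,7,2,5],
     Iso M23 [5,8,1,6,7,4,3,2], Iso M24 [2,3,1,6,5,4,7,8], Iso M23 [4,8,1,6,7,5,2,3],
     Iso M23 [2,8,1,4,7,6,3,5], Iso M23 [3,8,1,5,7,6,2,4], Iso M23 [2,8,1,3,7,5,4,6],
     Iso M23 [2,8,1,7,3,5,6,4], Iso M30 [5,8,1,2,4,7,3,6], Iso M23 [5,8,1,7,3,2,4,6],
     Iso M30 [2,8,1,5,6,7,3,4], Iso M35 [2,7,6,3,8,5,4,1], Iso M35 [2,3,4,7,8,5,6,1],
     Iso M23 [2,8,1,4,5,3,6,7], Iso M30 [2,8,1,3,6,4,5,7], Iso M30 [4,8,1,2,5,6,3,7],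
     Iso M23 [4,8,1,6,3,2,5,7], Iso M35 [2,6,7,3,8,4,5,1], Iso M35 [2,3,5,6,8,4,7,1],
     Iso M23 [2,8,1,6,3,4,7,5], Iso M23 [2,8,1,5,4,3,7,6], Iso M30 [2,8,1,4,7,6,3,5],
     Iso M30 [2,8,1,3,7,5,4,6]]"

definition certs_RP7a :: "cert list" where
  "certs_RP7a = [
     Iso M3 [2,3,5,1,6,8,7,4], Iso M15 [5,2,1,6,3,7,8,4], Iso M13 [6,2,1,7,3,4,5,8],
     Iso M22 [7,6,1,2,4,5,3,8], Iso M3 [2,4,5,1,6,7,8,3], Iso M9 [7,2,1,8,6,4,3,5],
     Iso M21 [7,2,1,8,6,4,3,5], Iso M15 [4,2,1,7,5,8,6,3], Iso M21 [7,2,1,6,8,4,5,3],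
     Iso M9 [6,2,1,7,8,5,4,3], Iso M14 [6,7,1,8,4,5,3,2], Iso M3 [2,4,3,1,8,7,6,5],
     Iso M15 [4,2,1,7,3,6,8,5], Iso M12 [8,2,1,4,3,7,5,6], Iso M12 [7,2,1,5,4,6,3,8],
     Iso M12 [8,2,1,5,3,6,4,7], Iso M3 [2,5,3,1,8,6,7,4], Iso M15 [3,2,1,8,5,7,6,4],
     Iso M21 [8,2,1,6,7,3,5,4], Iso M9 [6,2,1,8,7,5,3,4], Iso M29 [6,3,4,5,2,8,7,1],
     Iso M21 [6,2,1,8,7,5,3,4], Iso M34 [3,5,1,8,2,7,6,4], Iso M12 [6,2,1,4,5,7,3,8],
     Iso M22 [6,7,1,2,5,4,3,8], Iso M31 [6,7,1,2,5,4,3,8], Iso M35 [6,5,1,4,2,7,3,8],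
     Iso M29 [6,4,3,5,2,7,8,1], Iso M21 [6,2,1,7,8,5,4,3], Iso M15 [5,2,1,6,4,8,7,3],
     Iso M3 [2,3,4,1,7,8,6,5], Iso M3 [2,5,4,1,7,6,8,3], Iso M34 [4,5,1,7,2,8,6,3],
     Iso M15 [3,2,1,8,4,6,7,5], Iso M21 [8,2,1,7,6,3,4,5], Iso M29 [7,3,5,4,2,8,6,1],
     Iso M34 [3,4,1,8,2,6,7,5], Iso M12 [7,2,1,3,4,8,5,6], Iso M12 [6,2,1,3,5,8,4,7],
     Iso M22 [7,8,1,2,4,3,5,6], Iso M13 [7,2,1,8,5,3,4,6], Iso M31 [7,8,1,2,4,3,5,6],
     Iso M22 [8,7,1,2,3,4,5,6], Iso M35 [7,4,1,3,2,8,5,6], Iso M22 [6,8,1,2,5,3,4,7],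
     Iso M13 [6,2,1,8,4,3,5,7], Iso M31 [6,8,1,2,5,3,4,7], Iso M22 [8,6,1,2,3,5,4,7],
     Iso M35 [6,5,1,3,2,8,4,7]]"

definition certs_RP7b :: "cert list" where
  "certs_RP7b = [
     Iso M3 [4,8,6,5,1,7,2,3], Iso M21 [4,5,3,6,7,8,2,1], Iso M18 [6,2,1,8,5,4,3,7],
     Iso M11 [6,8,1,2,3,4,5,7], Iso M6 [1,2,4,5,3,6,8,7], Iso M23 [3,5,4,6,2,8,7,1],
     Iso M12 [3,5,4,6,2,8,7,1], Iso M12 [6,5,4,3,2,7,8,1], Iso M12 [3,4,5,6,2,7,8,1],
     Iso M19 [3,7,1,8,4,6,5,2], Iso M23 [3,4,5,6,2,7,8,1], Iso M12 [6,4,5,3,2,8,7,1],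
     Iso M18 [3,2,1,7,5,4,6,8], Iso M11 [3,7,1,2,6,4,5,8], Iso M21 [4,5,6,3,8,7,2,1],
     Iso M3 [4,7,3,5,1,8,2,6], Iso M3 [5,7,6,4,1,8,2,3], Iso M21 [5,4,3,6,8,7,2,1],
     Iso M26 [5,4,3,6,8,7,2,1], Iso M16 [7,2,1,8,6,5,4,3], Iso M32 [7,2,1,8,6,5,4,3],
     Iso M26 [4,5,3,6,7,8,2,1], Iso M29 [7,4,1,5,2,8,6,3], Iso M18 [3,2,1,8,4,5,6,7],
     Iso M11 [3,8,1,2,6,5,4,7], Iso M27 [3,2,1,8,4,5,6,7], Iso M22 [8,3,7,2,5,6,4,1],
     Iso M22 [8,6,7,2,4,3,5,1], Iso M30 [8,2,7,3,4,6,5,1], Iso M13 [3,5,4,6,2,8,7,1],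
     Iso M18 [6,5,4,3,2,7,8,1], Iso M8 [3,7,2,8,4,6,5,1], Iso M13 [3,4,5,6,2,7,8,1],
     Iso M18 [3,4,5,6,2,7,8,1], Iso M20 [5,6,3,4,2,7,8,1], Iso M10 [4,6,3,5,2,8,7,1],
     Iso M25 [6,4,1,5,8,2,7,3], Iso M20 [4,6,3,5,2,8,7,1], Iso M18 [3,5,4,6,2,8,7,1],
     Iso M28 [3,5,1,6,2,8,7,4], Iso M20 [3,4,1,5,7,2,8,6], Iso M10 [4,3,6,5,2,7,8,1],
     Iso M25 [3,4,1,5,7,2,8,6], Iso M20 [3,5,1,4,8,2,7,6], Iso M18 [6,4,5,3,2,8,7,1],
     Iso M28 [3,4,1,6,2,7,8,5], Iso M3 [5,8,3,4,1,7,2,6], Iso M21 [5,4,6,3,7,8,2,1],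
     Iso M11 [6,7,1,2,3,5,4,8], Iso M18 [6,2,1,7,4,5,3,8], Iso M22 [7,6,8,2,5,3,4,1],
     Iso M27 [3,2,1,7,5,4,6,8], Iso M22 [7,3,8,2,4,6,5,1], Iso M30 [7,2,8,3,5,6,4,1],
     Iso M26 [5,4,6,3,7,8,2,1], Iso M16 [7,2,1,8,3,4,5,6], Iso M32 [7,2,1,8,3,4,5,6],
     Iso M26 [4,5,6,3,8,7,2,1], Iso M29 [7,5,1,4,2,8,3,6]]"

definition certs_RP7c :: "cert list" where
  "certs_RP7c = [
     Iso M16 [3,5,4,6,2,8,7,1], Iso M25 [6,3,4,5,8,7,2,1], Iso M7 [2,7,1,8,6,5,3,4],
     Iso M16 [5,3,4,6,8,2,7,1], Iso M17 [3,7,1,8,4,6,5,2], Iso M8 [4,7,1,8,3,5,6,2],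
     Iso M9 [5,3,4,6,8,2,7,1], Iso M16 [4,3,6,5,2,7,8,1], Iso M9 [4,3,6,5,2,7,8,1],
     Iso M25 [4,3,6,5,2,7,8,1], Iso M8 [5,2,1,7,3,6,4,8], Iso M17 [3,2,1,7,5,4,6,8],
     Iso M7 [2,7,1,8,4,3,5,6], Iso M16 [3,5,6,4,8,2,7,1], Iso M9 [3,5,4,6,2,8,7,1],
     Iso M8 [3,7,1,8,4,6,5,2], Iso M9 [4,5,3,6,7,8,2,1], Iso M8 [3,2,1,7,5,4,6,8],
     Iso M9 [3,5,6,4,8,2,7,1], Iso M8 [4,2,1,8,3,6,5,7], Iso M9 [4,3,5,6,7,2,8,1],
     Iso M25 [5,4,3,6,8,7,2,1], Iso M16 [4,6,3,5,2,8,7,1], Iso M9 [4,6,3,5,2,8,7,1],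
     Iso M33 [4,5,1,6,7,8,2,3], Iso M25 [4,5,3,6,7,8,2,1], Iso M25 [3,5,4,6,2,8,7,1],
     Iso M33 [3,5,1,6,2,8,7,4], Iso M9 [3,6,4,5,7,8,2,1], Iso M16 [3,6,4,5,7,8,2,1],
     Iso M25 [5,3,4,6,8,2,7,1], Iso M25 [3,4,5,6,2,7,8,1], Iso M16 [3,4,5,6,2,7,8,1],
     Iso M9 [3,4,5,6,2,7,8,1], Iso M33 [3,4,1,6,2,7,8,5], Iso M25 [6,3,5,4,7,8,2,1],
     Iso M25 [5,3,6,4,2,8,7,1], Iso M33 [3,4,1,5,7,2,8,6], Iso M9 [3,4,6,5,7,2,8,1],
     Iso M16 [3,4,6,5,7,2,8,1], Iso M25 [3,4,6,5,7,2,8,1], Iso M9 [3,6,5,4,8,7,2,1],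
     Iso M9 [5,4,3,6,8,7,2,1], Iso M8 [3,2,1,8,4,5,6,7], Iso M16 [5,4,3,6,8,7,2,1],
     Iso M7 [2,7,1,8,5,6,4,3], Iso M25 [6,4,3,5,8,2,7,1], Iso M16 [4,5,3,6,7,8,2,1],
     Iso M17 [3,2,1,8,4,5,6,7], Iso M16 [3,6,5,4,8,7,2,1], Iso M7 [2,7,1,8,3,4,6,5],
     Iso M25 [4,3,5,6,7,2,8,1], Iso M16 [4,3,5,6,7,2,8,1], Iso M5 [1,2,7,8,3,6,5,4]]"

definition certs_T7 :: "cert list" where
  "certs_T7 = [
     Iso M2 [2,8,5,7,4,6,1,3], Iso M3 [4,6,3,2,8,5,7,1], Iso M3 [4,2,7,3,5,6,8,1],
     Iso M1 [1,2,3,8,5,4,7,6], Iso M3 [5,4,3,8,7,6,2,1], Iso M3 [3,7,2,4,8,6,5,1],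
     Iso M3 [3,8,7,6,2,5,4,1], Iso M3 [3,2,8,5,7,4,6,1], Iso M3 [7,4,6,3,2,8,5,1],
     Iso M3 [6,2,5,4,3,8,7,1], Iso M3 [5,3,7,2,4,8,6,1], Iso M3 [5,6,8,4,2,7,3,1],
     Iso M2 [3,6,4,7,5,8,1,2], Iso M3 [3,4,5,2,6,7,8,1], Iso M2 [2,7,3,5,6,8,1,4],
     Iso M4 [2,3,6,4,7,5,8,1], Iso M3 [6,3,2,8,5,7,4,1], Iso M3 [2,5,4,3,8,7,6,1],
     Iso M3 [4,8,6,5,3,7,2,1], Iso M3 [2,8,5,7,4,6,3,1], Iso M2 [2,6,7,8,3,4,1,5],
     Iso M4 [2,5,4,3,8,7,6,1], Iso M2 [2,3,6,4,7,5,1,8], Iso M3 [2,4,8,6,5,3,7,1],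
     Iso M4 [2,4,8,6,5,3,7,1], Iso M2 [2,4,8,6,5,3,1,7], Iso M3 [2,3,6,4,7,5,8,1],
     Iso M2 [2,5,4,3,8,7,1,6], Iso M3 [2,6,7,8,3,4,5,1], Iso M3 [4,5,2,6,7,8,3,1],
     Iso M3 [3,6,4,7,5,8,2,1], Iso M3 [2,7,3,5,6,8,4,1]]"

section \<open>Classification\<close>

text \<open>\<open>j\<close> is the dimension of \<open>L\<close> and \<open>d\<close> a bound for the vertex degrees.\<close>

definition verified :: "nat \<Rightarrow> nat \<Rightarrow> bits list \<Rightarrow> cert list \<Rightarrow> bool" where
  "verified d j L cs \<longleftrightarrow>
     list_all2 (check (In (ones (hd L)))) (keep (In (ones (hd L))) d j (cone_search L)) cs"

section \<open>Evaluation of the searches\<close>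

fun resize :: "nat \<Rightarrow> bits \<Rightarrow> bits" where
  "resize 0 x = End"
| "resize (Suc n) (In x) = In (resize n x)"
| "resize (Suc n) (Out x) = Out (resize n x)"
| "resize (Suc n) End = Out (resize n End)"

text \<open>The link of a vertex in a cycle consists of two points, placed here on the first two
  positions. The bound 8 exceeds every possible degree and so discards nothing; the same holds for
  the 3-dimensional searches below. In the surface searches the bound is the length of the
  prescribed link cycle.\<close>

lemma verified_cycle3: "verified 8 0 (map (resize 2) [vx 1, vx 2]) certs_cycle3"
  by code_simp

lemma verified_cycle4: "verified 8 0 (map (resize 3) [vx 1, vx 2]) certs_cycle4"
  by code_simp

lemma verified_cycle5: "verified 8 0 (map (resize 4) [vx 1, vx 2]) certs_cycle5"
  by code_simp

lemma verified_cycle6: "verified 8 0 (map (resize 5) [vx 1, vx 2]) certs_cycle6"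
  by code_simp

lemma verified_surface43: "verified 3 1 (map (resize 3) (cycle_list 3)) certs_surface43"
  by code_simp

lemma verified_surface53: "verified 3 1 (map (resize 4) (cycle_list 3)) certs_surface53"
  by code_simp

lemma verified_surface54: "verified 4 1 (map (resize 4) (cycle_list 4)) certs_surface54"
  by code_simp

lemma verified_surface63: "verified 3 1 (map (resize 5) (cycle_list 3)) certs_surface63"
  by code_simp

lemma verified_surface64: "verified 4 1 (map (resize 5) (cycle_list 4)) certs_surface64"
  by code_simp

lemma verified_surface65: "verified 5 1 (map (resize 5) (cycle_list 5)) certs_surface65"
  by code_simp

lemma verified_surface73: "verified 3 1 (map (resize 6) (cycle_list 3)) certs_surface73"
  by code_simp

lemma verified_surface74: "verified 4 1 (map (resize 6) (cycle_list 4)) certs_surface74"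
  by code_simp

lemma verified_surface75: "verified 5 1 (map (resize 6) (cycle_list 5)) certs_surface75"
  by code_simp

lemma verified_surface76: "verified 6 1 (map (resize 6) (cycle_list 6)) certs_surface76"
  by code_simp

lemma verified_RP6: "verified 8 2 RP6 certs_RP6"
  by code_simp

lemma verified_RP7a: "verified 8 2 RP7a certs_RP7a"
  by code_simp

lemma verified_RP7b: "verified 8 2 RP7b certs_RP7b"
  by code_simp

lemma verified_RP7c: "verified 8 2 RP7c certs_RP7c"
  by code_simp

lemma verified_T7: "verified 8 2 T7 certs_T7"
  by code_simp

lemma len_resize [simp]: "len (resize n x) = n"
  by (induction n x rule: resize.induct) auto

lemma verts_resize: "verts i (resize n x) = verts i x \<inter> {..<i + n}"
proof (induction n x arbitrary: i rule: resize.induct)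
  case (1 x)
  then show ?case using verts_less[of _ i x] by fastforce
qed auto

lemma fam_resize:
  assumes "\<Union>(fam A) \<subseteq> {1..n}"
  shows "fam (map (resize n) A) = fam A"
proof -
  have "verts 1 (resize n x) = verts 1 x" if "x \<in> set A" for x
    unfolding verts_resize using that assms by (auto simp: fam_def simp del: One_nat_def)
  then show ?thesis unfolding fam_def set_map image_image by (intro image_cong) auto
qed

lemma fam_masks:
  assumes "verts 1 z = {}" "list_all (\<lambda>vs. 0 \<notin> set vs) fs"
  shows "fam (map (face_bits z) fs) = set ` set fs"
  unfolding fam_def set_map image_image using assms by (intro image_cong verts_mask) (auto simp: list_all_iff)

lemma verts_blank [simp]: "verts i blank7 = {}" "verts i blank8 = {}"
  by (simp_all add: blank7_def blank8_def)

lemma list_all2_in_left: "list_all2 P xs ys \<Longrightarrow> x \<in> set xs \<Longrightarrow> \<exists>y\<in>set ys. P x y"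
  by (metis in_set_conv_nth list_all2_conv_all_nth)

text \<open>Applied in dimensions 1, 2 and 3 alike. The first alternative mentions the certificate
  list as well, so that it disappears whenever the list contains no \<open>Sphere\<close>, as for
  cycles and 3-pseudomanifolds.\<close>

lemma verified_sound:
  assumes ver: "verified d j L cs" and F: "normal_family (Suc (Suc j)) F"
    and v: "v \<in> \<Union>F" and card: "card (\<Union>F) = Suc m"
    and iso: "fam_iso (lk v F) (fam L)" and len: "\<And>t. t \<in> set L \<Longrightarrow> len t = m"
    and deg: "\<And>w. w \<in> \<Union>F \<Longrightarrow> card (\<Union>(lk w F)) \<le> d"
  shows "(\<exists>ms. Sphere ms \<in> set cs) \<and> triangulates (complex_of F) (sphere (0 :: real ^ 3) 1) \<or>
    (\<exists>G p. Iso G p \<in> set cs \<and> fam_iso F (fam G))"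
proof -
  obtain A where A: "A \<in> set (cone_search L)" "fam_iso F (fam A)" "\<Union>(fam A) = {1..Suc m}"
    by (rule cone_classification[OF F _ v card iso len]) simp
  have "lk v F \<noteq> {}" using v by (simp add: lk_empty_iff)
  then have "fam L \<noteq> {}" using iso unfolding fam_iso_def by (metis image_is_empty)
  then have "L \<noteq> []" by (auto simp: fam_def)
  define u where "u = In (ones (hd L))"
  have lu: "len u = Suc m" and vu: "verts 1 u = {1..len u}"
  proof -
    have "len (ones x) = len x" for x by (induction x) auto
    then show lu: "len u = Suc m" using len[of "hd L"] \<open>L \<noteq> []\<close> by (simp add: u_def)
    have "ones (ones x) = ones x" for x by (induction x) auto
    then have ou: "ones u = u" by (simp add: u_def)
    show "verts 1 u = {1..len u}"
      using verts_ones[of 1 u] unfolding ou by (simp add: atLeastLessThanSuc_atLeastAtMost)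
  qed
  obtain h where h: "inj_on h (\<Union>F)" "fam A = (`) h ` F" using A(2) unfolding fam_iso_def by metis
  have "conn_links (Suc j) (fam A)"
    using normal_family_iso[OF A(2) F] by (simp add: normal_family_def)
  moreover have "card (\<Union>(lk w (fam A))) \<le> d" if w: "w \<in> \<Union>(fam A)" for w
  proof -
    have "w \<in> h ` \<Union>F" using w unfolding h(2) Union_image_image .
    then obtain x where x: "x \<in> \<Union>F" "w = h x" by (rule imageE)
    have "\<Union>(lk w (fam A)) = h ` \<Union>(lk x F)"
      unfolding h(2) x(2) lk_image[OF h(1) x(1)] by (rule Union_image_image)
    moreover have "finite (\<Union>(lk x F))"
      by (rule finite_subset[OF Union_lk_subset]) (intro finite_Diff finite_Union_normal[OF F])
    ultimately show ?thesis using card_image_le[of "\<Union>(lk x F)" h] deg[OF x(1)] by simp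
  qed
  ultimately have "\<not> discarded u d j A" using A(3) lu by (intro discarded_sound[OF vu]) simp_all
  then have "A \<in> set (keep u d j (cone_search L))" using A(1) by (simp add: set_keep)
  then obtain c where c: "c \<in> set cs" "check u A c"
    using list_all2_in_left[OF ver[unfolded verified_def, folded u_def]] by blast
  show ?thesis
  proof (cases c)
    case (Sphere ms)
    then have t: "triangulates (complex_of (fam A)) (sphere (0 :: real ^ 3) 1)"
      using c(2) spherical_triangulates by auto
    have "triangulates (complex_of F) (sphere (0 :: real ^ 3) 1)"
      using carrier_iso[OF A(2)] t unfolding triangulates_def by (rule homeomorphic_trans)
    then show ?thesis using c(1) Sphere by blast
  next
    case (Iso G p)
    have "fam_iso (fam G) (fam A)" by (rule check_Iso[OF c(2)[unfolded Iso] vu])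
    then show ?thesis using c(1) Iso fam_iso_trans[OF A(2) fam_iso_sym] by metis
  qed
qed

section \<open>Classification in dimensions one, two and three\<close>

lemma normal_family_nonempty:
  assumes "normal_family (Suc k) F"
  shows "\<Union>F \<noteq> {}"
proof -
  have cF: "closed_family (Suc k) F" and "F \<noteq> {}" using assms by (auto simp: normal_family_def)
  then obtain f where f: "f \<in> F" by blast
  then have "f \<noteq> {}" using closed_familyD(3)[OF cF f] by auto
  then show ?thesis using f by blast
qed

lemma vertex_link_card:
  assumes F: "normal_family (Suc k) F" "1 \<le> k" and v: "v \<in> \<Union>F"
  shows "card (\<Union>(lk v F)) < card (\<Union>F)"
proof (rule psubset_card_mono)
  have "v \<notin> \<Union>(lk v F)" using Union_lk_subset[of v F] by (meson DiffD2 singletonI subsetD)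
  moreover have "\<Union>(lk v F) \<subseteq> \<Union>F" using Union_lk_subset[of v F] by (meson Diff_subset subset_trans)
  ultimately show "\<Union>(lk v F) \<subset> \<Union>F" using v by (metis psubsetI)
qed (rule finite_Union_normal[OF F(1)])

lemma normal_family_1:
  assumes F: "normal_family 1 F"
  obtains a b where "a \<noteq> b" "F = {{a}, {b}}"
proof -
  have cF: "closed_family 1 F" and "F \<noteq> {}" using F by (auto simp: normal_family_def)
  then obtain f where f: "f \<in> F" by blast
  have single: "\<exists>a. g = {a}" if "g \<in> F" for g
    using closed_familyD(3)[OF cF that] by (rule card_1_singletonE) blast
  obtain a where a: "f = {a}" using single[OF f] by blast
  have "card {g \<in> F. f - {a} \<subseteq> g} = 2" using closed_familyD(4)[OF cF f] a by simp
  then have "card F = 2" using a by simp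
  then obtain x y where xy: "F = {x, y}" "x \<noteq> y" by (meson card_2_iff)
  obtain a where "x = {a}" using single[of x] xy by auto
  moreover obtain b where "y = {b}" using single[of y] xy by auto
  ultimately show ?thesis using that[of a b] xy by simp
qed

text \<open>Six vertices suffice, since the cycles needed are vertex links of surfaces with at most
  7 vertices.\<close>

lemma cycle_classification:
  assumes F: "normal_family 2 F" and n: "card (\<Union>F) \<le> 6"
  shows "3 \<le> card (\<Union>F)" "fam_iso F (fam (cycle_list (card (\<Union>F))))"
proof -
  have F': "normal_family (Suc (Suc 0)) F" using F by (simp add: numeral_2_eq_2)
  obtain v where v: "v \<in> \<Union>F" using normal_family_nonempty[OF F'] by blast
  have "normal_family 1 (lk v F)" using normal_family_lk[OF F' _ v] by simp
  then obtain a b where ab: "a \<noteq> b" "lk v F = {{a}, {b}}" by (rule normal_family_1)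
  have "a \<in> \<Union>F - {v}" "b \<in> \<Union>F - {v}"
    using Union_lk_subset[of v F] unfolding ab(2) by (simp_all add: subset_iff)
  then have sub: "{v, a, b} \<subseteq> \<Union>F" "a \<noteq> v" "b \<noteq> v" using v by simp_all
  then have "card {v, a, b} \<le> card (\<Union>F)" using finite_Union_normal[OF F] by (intro card_mono)
  then show n3: "3 \<le> card (\<Union>F)" using sub ab by simp
  define m where "m = card (\<Union>F) - 1"
  have m: "card (\<Union>F) = Suc m" "2 \<le> m" using n3 by (auto simp: m_def)
  define L where "L = map (resize m) [vx 1, vx 2]"
  have "fam L = {{1}, {2}}"
    unfolding L_def using m by (subst fam_resize) (auto simp: fam_def verts_vx[of 1 0, simplified] numeral_2_eq_2 verts_vx[of _ 0])
  moreover have "inj_on (\<lambda>x. if x = a then 1 else 2 :: nat) (\<Union>{{a}, {b}})"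
    using ab by (auto simp: inj_on_def)
  ultimately have iso: "fam_iso (lk v F) (fam L)"
    unfolding fam_iso_def ab(2) using ab(1) by (intro exI[of _ "\<lambda>x. if x = a then 1 else 2"]) auto
  have len: "\<And>t. t \<in> set L \<Longrightarrow> len t = m" unfolding L_def by auto
  have deg: "card (\<Union>(lk w F)) \<le> 8" if "w \<in> \<Union>F" for w
    using vertex_link_card[OF F' _ that] n by simp
  have main: "fam_iso F (fam (cycle_list (card (\<Union>F))))"
    if ver: "verified 8 0 L cs" and cs: "list_all (\<lambda>c. case c of Iso G p \<Rightarrow> G = cycle_list (card (\<Union>F)) | Sphere ms \<Rightarrow> False) cs" for cs
    using verified_sound[OF ver F' v m(1) iso len deg] cs by (fastforce simp: list_all_iff)
  consider "card (\<Union>F) = 3" | "card (\<Union>F) = 4" | "card (\<Union>F) = 5" | "card (\<Union>F) = 6" using n n3 by linarith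
  then show "fam_iso F (fam (cycle_list (card (\<Union>F))))"
  proof cases
    case 1
    then show ?thesis using main[of certs_cycle3] verified_cycle3 m by (simp add: L_def certs_cycle3_def)
  next
    case 2
    then show ?thesis using main[of certs_cycle4] verified_cycle4 m by (simp add: L_def certs_cycle4_def)
  next
    case 3
    then show ?thesis using main[of certs_cycle5] verified_cycle5 m by (simp add: L_def certs_cycle5_def)
  next
    case 4
    then show ?thesis using main[of certs_cycle6] verified_cycle6 m by (simp add: L_def certs_cycle6_def)
  qed
qed

lemma Union_cycle_list: "\<Union>(fam (cycle_list n)) \<subseteq> {1..n}" if "3 \<le> n"
proof -
  have "cycle_list n = map (face_bits blank7) (map (\<lambda>i. [i, Suc i]) [1..<n] @ [[1, n]])"
    by (simp add: cycle_list_def)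
  then have "fam (cycle_list n) = set ` set (map (\<lambda>i. [i, Suc i]) [1..<n] @ [[1, n]])"
    using that by (simp only:) (rule fam_masks, auto simp: list_all_iff)
  then show ?thesis using that by auto
qed

text \<open>The apex is a vertex of maximal degree \<open>d\<close>. Its link is then the cycle with
  \<open>d\<close> vertices, and leaves with a vertex of larger degree may be discarded. This leaves
  ten pairs of vertex number and degree.\<close>

lemma surface_classification:
  assumes F: "normal_family 3 F" and n: "card (\<Union>F) \<le> 7"
  shows "triangulates (complex_of F) (sphere (0 :: real ^ 3) 1) \<or>
    (\<exists>R\<in>{RP6, RP7a, RP7b, RP7c, T7}. fam_iso F (fam R))"
proof -
  have F': "normal_family (Suc (Suc 1)) F" using F by (simp add: numeral_3_eq_3)
  have finV: "finite (\<Union>F)" using finite_Union_normal[OF F] .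
  let ?deg = "\<lambda>w. card (\<Union>(lk w F))"
  have "Max (?deg ` \<Union>F) \<in> ?deg ` \<Union>F"
    by (rule Max_in) (simp_all only: finite_imageI finV image_is_empty normal_family_nonempty[OF F'] not_False_eq_True)
  then obtain v where vF: "v \<in> \<Union>F" "Max (?deg ` \<Union>F) = ?deg v" by (rule imageE)
  note v = vF(1)
  have mx: "?deg w \<le> ?deg v" if "w \<in> \<Union>F" for w
    unfolding vF(2)[symmetric] by (rule Max_ge[OF finite_imageI[OF finV] imageI[OF that]])
  define d where "d = card (\<Union>(lk v F))"
  have dn: "d < card (\<Union>F)" unfolding d_def by (rule vertex_link_card[OF F' _ v]) simp
  have "normal_family 2 (lk v F)" using normal_family_lk[OF F' _ v] by (simp add: numeral_2_eq_2)
  note cyc = cycle_classification[OF this, folded d_def]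
  have d3: "3 \<le> d" using cyc(1) dn n by simp
  define m where "m = card (\<Union>F) - 1"
  have m: "card (\<Union>F) = Suc m" "d \<le> m" "m \<le> 6" using dn n by (auto simp: m_def)
  have "fam_iso (lk v F) (fam (cycle_list d))" using cyc(2) dn n by simp
  moreover have "fam (map (resize m) (cycle_list d)) = fam (cycle_list d)"
    using Union_cycle_list[OF d3] m by (intro fam_resize) auto
  ultimately have iso: "fam_iso (lk v F) (fam (map (resize m) (cycle_list d)))" by simp
  have main: ?thesis
    if ver: "verified d 1 (map (resize m) (cycle_list d)) cs"
      and cs: "list_all (\<lambda>c. case c of Iso G p \<Rightarrow> G \<in> {RP6, RP7a, RP7b, RP7c, T7} | _ \<Rightarrow> True) cs" for cs
    using verified_sound[OF ver F' v m(1) iso _ mx[folded d_def]] cs by (fastforce simp: list_all_iff)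
  have "m \<in> {3, 4, 5, 6}" "d \<in> {3, 4, 5, 6}" using d3 m by auto
  then consider "m = 3" "d = 3" | "m = 4" "d = 3" | "m = 4" "d = 4" | "m = 5" "d = 3" | "m = 5" "d = 4"
    | "m = 5" "d = 5" | "m = 6" "d = 3" | "m = 6" "d = 4" | "m = 6" "d = 5" | "m = 6" "d = 6"
    using m(2) by auto
  then show ?thesis
  proof cases
    assume "m = 3" "d = 3"
    then show ?thesis using main[of certs_surface43] verified_surface43 by (simp add: certs_surface43_def)
  next
    assume "m = 4" "d = 3"
    then show ?thesis using main[of certs_surface53] verified_surface53 by (simp add: certs_surface53_def)
  next
    assume "m = 4" "d = 4"
    then show ?thesis using main[of certs_surface54] verified_surface54 by (simp add: certs_surface54_def)
  next
    assume "m = 5" "d = 3"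
    then show ?thesis using main[of certs_surface63] verified_surface63 by (simp add: certs_surface63_def)
  next
    assume "m = 5" "d = 4"
    then show ?thesis using main[of certs_surface64] verified_surface64 by (simp add: certs_surface64_def)
  next
    assume "m = 5" "d = 5"
    then show ?thesis using main[of certs_surface65] verified_surface65 by (simp add: certs_surface65_def)
  next
    assume "m = 6" "d = 3"
    then show ?thesis using main[of certs_surface73] verified_surface73 by (simp add: certs_surface73_def)
  next
    assume "m = 6" "d = 4"
    then show ?thesis using main[of certs_surface74] verified_surface74 by (simp add: certs_surface74_def)
  next
    assume "m = 6" "d = 5"
    then show ?thesis using main[of certs_surface75] verified_surface75 by (simp add: certs_surface75_def)
  next
    assume "m = 6" "d = 6"
    then show ?thesis using main[of certs_surface76] verified_surface76 by (simp add: certs_surface76_def)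
  qed
qed

lemma lens_surfaces:
  "list_all (\<lambda>t. len t = 7) RP6" "list_all (\<lambda>t. len t = 7) RP7a" "list_all (\<lambda>t. len t = 7) RP7b"
  "list_all (\<lambda>t. len t = 7) RP7c" "list_all (\<lambda>t. len t = 7) T7"
  by code_simp+

lemma certs_RP6_in:
  "list_all (\<lambda>c. case c of Iso G p \<Rightarrow> G \<in> set Ms | Sphere ms \<Rightarrow> False) certs_RP6"
  by (simp add: certs_RP6_def Ms_def)

lemma certs_RP7a_in:
  "list_all (\<lambda>c. case c of Iso G p \<Rightarrow> G \<in> set Ms | Sphere ms \<Rightarrow> False) certs_RP7a"
  by (simp add: certs_RP7a_def Ms_def)

lemma certs_RP7b_in:
  "list_all (\<lambda>c. case c of Iso G p \<Rightarrow> G \<in> set Ms | Sphere ms \<Rightarrow> False) certs_RP7b"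
  by (simp add: certs_RP7b_def Ms_def)

lemma certs_RP7c_in:
  "list_all (\<lambda>c. case c of Iso G p \<Rightarrow> G \<in> set Ms | Sphere ms \<Rightarrow> False) certs_RP7c"
  by (simp add: certs_RP7c_def Ms_def)

lemma certs_T7_in:
  "list_all (\<lambda>c. case c of Iso G p \<Rightarrow> G \<in> set Ms | Sphere ms \<Rightarrow> False) certs_T7"
  by (simp add: certs_T7_def Ms_def)

text \<open>A vertex link omits its apex, so it has at most 7 vertices and falls under the
  classification of surfaces; not being a sphere, it is one of the five from which the searches
  start.\<close>

lemma pseudomanifold_classification:
  assumes F: "normal_family 4 F" and n: "card (\<Union>F) = 8"
    and v: "v \<in> \<Union>F" and ns: "\<not> triangulates (complex_of (lk v F)) (sphere (0 :: real ^ 3) 1)"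
  shows "\<exists>G\<in>set Ms. fam_iso F (fam G)"
proof -
  have F': "normal_family (Suc (Suc 2)) F" using F by (simp add: eval_nat_numeral)
  have m: "card (\<Union>F) = Suc 7" using n by simp
  have lt: "card (\<Union>(lk w F)) < 8" if "w \<in> \<Union>F" for w
    using vertex_link_card[OF F' _ that] n by simp
  have "normal_family 3 (lk v F)" using normal_family_lk[OF F' _ v] by simp
  then have "\<exists>R\<in>{RP6, RP7a, RP7b, RP7c, T7}. fam_iso (lk v F) (fam R)"
    using surface_classification ns lt[OF v] by fastforce
  then obtain R where R: "R \<in> {RP6, RP7a, RP7b, RP7c, T7}" and iso: "fam_iso (lk v F) (fam R)" by blast
  have len: "\<And>t. t \<in> set R \<Longrightarrow> len t = 7"
    using R lens_surfaces by (auto simp: list_all_iff)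
  have main: ?thesis
    if ver: "verified 8 2 R cs" and cs: "list_all (\<lambda>c. case c of Iso G p \<Rightarrow> G \<in> set Ms | Sphere ms \<Rightarrow> False) cs" for cs
  proof -
    have "card (\<Union>(lk w F)) \<le> 8" if "w \<in> \<Union>F" for w using lt[OF that] by simp
    then have "(\<exists>ms. Sphere ms \<in> set cs) \<and> triangulates (complex_of F) (sphere (0 :: real ^ 3) 1) \<or>
        (\<exists>G p. Iso G p \<in> set cs \<and> fam_iso F (fam G))"
      by (intro verified_sound[OF ver F' v m iso len]) simp_all
    then show ?thesis using cs by (fastforce simp: list_all_iff)
  qed
  show ?thesis
    using R
  proof (elim insertE emptyE)
    assume "R = RP6"
    then show ?thesis using main[of certs_RP6] verified_RP6 certs_RP6_in by simp
  next
    assume "R = RP7a"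
    then show ?thesis using main[of certs_RP7a] verified_RP7a certs_RP7a_in by simp
  next
    assume "R = RP7b"
    then show ?thesis using main[of certs_RP7b] verified_RP7b certs_RP7b_in by simp
  next
    assume "R = RP7c"
    then show ?thesis using main[of certs_RP7c] verified_RP7c certs_RP7c_in by simp
  next
    assume "R = T7"
    then show ?thesis using main[of certs_T7] verified_T7 certs_T7_in by simp
  qed
qed

section \<open>Properties of the 35 complexes\<close>

primrec linked :: "bits \<Rightarrow> bits list \<Rightarrow> bits list \<Rightarrow> bool" where
  "linked B [] seen = False"
| "linked B (r # rs) seen = or_else (and_also (\<not> sub r B) (supersets r seen \<noteq> [])) (linked B rs seen)"

text \<open>A certificate that the triangles stay connected after cutting along \<open>B\<close>:
  the list order is a construction of the surface in which every new triangle is glued to an earlier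
  one along an edge outside \<open>B\<close>.\<close>

primrec chained :: "bits \<Rightarrow> bits list \<Rightarrow> bits list \<Rightarrow> bool" where
  "chained B seen [] = True"
| "chained B seen (f # fs) = and_also (linked B (ridges f) seen) (chained B (f # seen) fs)"

definition nonseparating :: "bits \<Rightarrow> bits list \<Rightarrow> bool" where
  "nonseparating B A \<longleftrightarrow> and_also (weight B = 3) (and_also (A \<noteq> [])
     (and_also (list_all (\<lambda>f. weight f = 3) A)
     (and_also (list_all (\<lambda>r. supersets r A \<noteq> []) (ridges B)) (chained B [hd A] (tl A)))))"

lemma chained_induct:
  assumes "chained B seen fs" "\<And>g. g \<in> set seen \<Longrightarrow> P g = b"
    and "\<And>f g r. f \<in> set fs \<union> set seen \<Longrightarrow> g \<in> set fs \<union> set seen \<Longrightarrow> r \<in> set (ridges f) \<Longrightarrow>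
      \<not> sub r B \<Longrightarrow> sub r g \<Longrightarrow> P f = P g"
    and "f \<in> set fs"
  shows "P f = b"
  using assms
proof (induction fs arbitrary: seen)
  case (Cons h fs)
  have "linked B rs seen \<Longrightarrow> \<exists>r\<in>set rs. \<not> sub r B \<and> supersets r seen \<noteq> []" for rs
    by (induction rs) auto
  then obtain r where r: "r \<in> set (ridges h)" "\<not> sub r B" "supersets r seen \<noteq> []"
    using Cons.prems(1) by auto
  then have "set (supersets r seen) \<noteq> {}" by (simp only: set_empty not_False_eq_True)
  then obtain g where g: "g \<in> set seen" "sub r g" by auto
  then have h: "P h = b" using Cons.prems(2,3)[of g] Cons.prems(3)[of h g r] r by auto
  show ?case
  proof (cases "f = h")
    case False
    show ?thesis
    proof (rule Cons.IH)
      show "chained B (h # seen) fs" using Cons.prems(1) by simp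
      show "P g = b" if "g \<in> set (h # seen)" for g using that h Cons.prems(2) by auto
      show "P f = P g" if "f \<in> set fs \<union> set (h # seen)" "g \<in> set fs \<union> set (h # seen)"
        "r \<in> set (ridges f)" "\<not> sub r B" "sub r g" for f g r
        using that by (intro Cons.prems(3)) auto
      show "f \<in> set fs" using Cons.prems(4) False by simp
    qed
  qed (use h in simp)
qed simp

text \<open>Every face off the cycle lies in a triangle of the surface, and these triangles remain
  linked through edges off the cycle. So the complement of the cycle is connected.\<close>

lemma nonseparating_not_sphere:
  assumes "nonseparating B A"
  shows "\<not> triangulates (complex_of (fam A)) (sphere (0 :: real ^ 3) 1)"
proof -
  let ?K = "complex_of (fam A)" and ?B = "verts 1 B"
  define T where "T = {\<tau>. \<tau> \<noteq> {} \<and> \<tau> \<subset> ?B}"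
  have wB: "weight B = 3" and A: "A \<noteq> []" and w: "\<And>f. f \<in> set A \<Longrightarrow> weight f = 3"
    and rB: "\<And>r. r \<in> set (ridges B) \<Longrightarrow> supersets r A \<noteq> []" and ch: "chained B [hd A] (tl A)"
    using assms by (auto simp: nonseparating_def list_all_iff)
  have setA: "set A = insert (hd A) (set (tl A))" using A by (cases A) auto
  have fin: "finite \<sigma> \<and> \<sigma> \<noteq> {}" if "\<sigma> \<in> ?K" for \<sigma>
  proof -
    obtain f where "f \<in> fam A" "\<sigma> \<subseteq> f" "\<sigma> \<noteq> {}" using \<open>\<sigma> \<in> ?K\<close> unfolding complex_of_def by blast
    moreover then have "finite f" by (auto simp: fam_def)
    ultimately show ?thesis using finite_subset by blast
  qed
  have "T \<subseteq> ?K"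
  proof
    fix \<tau> assume "\<tau> \<in> T"
    then obtain b where b: "b \<in> ?B" "\<tau> \<subseteq> ?B - {b}" "\<tau> \<noteq> {}" unfolding T_def by blast
    then have "?B - {b} \<in> verts 1 ` set (ridges B)" unfolding verts_ridges by blast
    then obtain r where r: "r \<in> set (ridges B)" "verts 1 r = ?B - {b}" by auto
    then have "set (supersets r A) \<noteq> {}" using rB by (simp only: set_empty not_False_eq_True)
    then obtain f where f: "f \<in> set A" "sub r f" by auto
    then have "\<tau> \<subseteq> verts 1 f" using b r sub_iff[of r f 1] by simp
    then show "\<tau> \<in> ?K" using f b unfolding complex_of_def fam_def by blast
  qed
  have facet: "verts 1 f \<in> ?K - T" if f: "f \<in> set A" for f
  proof -
    have c: "card (verts 1 f) = 3" using w[OF f] by (simp only: card_verts)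
    then have "verts 1 f \<noteq> {}" by force
    then have "verts 1 f \<in> ?K" using f unfolding complex_of_def fam_def by blast
    moreover have "\<not> verts 1 f \<subset> ?B"
      using psubset_card_mono[of ?B "verts 1 f"] c wB card_verts by (metis finite_verts less_irrefl)
    ultimately show ?thesis by (simp add: T_def)
  qed
  have "face_connected (?K - T)"
    unfolding face_connected_def
  proof (intro allI impI)
    fix S assume S: "S \<subseteq> ?K - T" and
      "S \<noteq> {} \<and> (\<forall>\<sigma>\<in>S. \<forall>\<tau>\<in>?K - T. \<sigma> \<subseteq> \<tau> \<or> \<tau> \<subseteq> \<sigma> \<longrightarrow> \<tau> \<in> S)"
    then have ne: "S \<noteq> {}"
      and cl: "\<And>\<sigma> \<tau>. \<sigma> \<in> S \<Longrightarrow> \<tau> \<in> ?K - T \<Longrightarrow> \<sigma> \<subseteq> \<tau> \<or> \<tau> \<subseteq> \<sigma> \<Longrightarrow> \<tau> \<in> S" by blast+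
    have step: "verts 1 f \<in> S \<longleftrightarrow> verts 1 g \<in> S"
      if fg: "f \<in> set A" "g \<in> set A" "r \<in> set (ridges f)" "\<not> sub r B" "sub r g" for f g r
    proof -
      have rg: "verts 1 r \<subseteq> verts 1 g" "\<not> verts 1 r \<subseteq> ?B" using fg sub_iff[of r _ 1] by simp_all
      have "verts 1 r \<in> verts 1 ` set (ridges f)" using fg by blast
      then have rf: "verts 1 r \<subseteq> verts 1 f" unfolding verts_ridges by blast
      have "verts 1 r \<noteq> {}" using rg(2) by auto
      then have "verts 1 r \<in> ?K - T"
        using rg rf fg(1) unfolding T_def complex_of_def fam_def by auto
      then show ?thesis using cl facet[OF fg(1)] facet[OF fg(2)] rg rf by meson
    qed
    have all: "verts 1 f \<in> S \<longleftrightarrow> verts 1 (hd A) \<in> S" if "f \<in> set A" for f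
    proof (cases "f = hd A")
      case False
      show ?thesis
      proof (rule chained_induct[OF ch])
        show "f \<in> set (tl A)" using that False setA by simp
        show "(verts 1 f' \<in> S) = (verts 1 g \<in> S)" if "f' \<in> set (tl A) \<union> set [hd A]"
          "g \<in> set (tl A) \<union> set [hd A]" "r \<in> set (ridges f')" "\<not> sub r B" "sub r g" for f' g r
          using that setA by (intro step[of f' g r]) auto
      qed auto
    qed simp
    have up: "\<exists>f\<in>set A. \<sigma> \<subseteq> verts 1 f" if "\<sigma> \<in> ?K" for \<sigma>
      using that unfolding complex_of_def fam_def by blast
    obtain \<sigma> where \<sigma>: "\<sigma> \<in> S" using ne by blast
    then obtain f where f: "f \<in> set A" "\<sigma> \<subseteq> verts 1 f" using up S by blast
    then have "verts 1 f \<in> S" using cl[OF \<sigma> facet[OF f(1)]] by blast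
    then have allS: "verts 1 g \<in> S" if "g \<in> set A" for g using all[OF that] all[OF f(1)] by blast
    have "\<tau> \<in> S" if \<tau>: "\<tau> \<in> ?K - T" for \<tau>
    proof -
      obtain g where "g \<in> set A" "\<tau> \<subseteq> verts 1 g" using up \<tau> by blast
      then show ?thesis using cl[OF allS \<tau>] by blast
    qed
    then show "S = ?K - T" using S by blast
  qed
  moreover have "?K \<noteq> T" using facet[of "hd A"] A by auto
  moreover have "card ?B = 3" using wB by (simp only: card_verts)
  ultimately show ?thesis
    using nonseparating_triangle_not_sphere[OF fin _ T_def \<open>T \<subseteq> ?K\<close>] unfolding triangulates_def by blast
qed

text \<open>Each chosen triple spans three edges but is not itself a face; its boundary is a cycle
  that does not separate the surface.\<close>

lemma surfaces_nonseparating: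
  "nonseparating (face_bits blank7 [1,2,5]) RP6" "nonseparating (face_bits blank7 [2,3,6]) RP7a"
  "nonseparating (face_bits blank7 [1,2,5]) RP7b" "nonseparating (face_bits blank7 [1,2,5]) RP7c"
  "nonseparating (face_bits blank7 [1,2,5]) T7"
  by code_simp+

lemma nonspheres:
  assumes "R \<in> {RP6, RP7a, RP7b, RP7c, T7}" "fam_iso F (fam R)"
  shows "\<not> triangulates (complex_of F) (sphere (0 :: real ^ 3) 1)"
proof
  assume "triangulates (complex_of F) (sphere (0 :: real ^ 3) 1)"
  then have "triangulates (complex_of (fam R)) (sphere (0 :: real ^ 3) 1)"
    using carrier_iso[OF fam_iso_sym[OF assms(2)]] homeomorphic_trans unfolding triangulates_def by blast
  then show False using assms(1) surfaces_nonseparating[THEN nonseparating_not_sphere] by blast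
qed

section \<open>Bistellar moves as flips of facet lists\<close>

lemma bistellar_complex_of:
  assumes F: "finite F" "\<And>f. f \<in> F \<Longrightarrow> finite f \<and> card f = 4"
    and fl: "flippable \<alpha> \<beta> F" and ab: "card \<alpha> + card \<beta> = 5" "card \<alpha> \<in> {2, 3}"
  shows "bistellar \<alpha> (complex_of F) = complex_of (flip \<alpha> \<beta> F)"
proof -
  let ?M = "complex_of F"
  have fab: "finite \<alpha>" "finite \<beta>" "\<alpha> \<noteq> {}" "\<beta> \<noteq> {}" "\<alpha> \<inter> \<beta> = {}"
    and star: "{f \<in> F. \<alpha> \<subseteq> f} = (\<lambda>b. \<alpha> \<union> \<beta> - {b}) ` \<beta>" and nb: "\<And>f. f \<in> F \<Longrightarrow> \<not> \<beta> \<subseteq> f"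
    using fl by (auto simp: flippable_def)
  have faces: "faces_of_dim 3 ?M = F"
  proof (intro set_eqI iffI)
    fix s assume "s \<in> faces_of_dim 3 ?M"
    then obtain f where f: "f \<in> F" "s \<subseteq> f" "card s = 4" unfolding faces_of_dim_def complex_of_def by auto
    then have "s = f" using F(2)[OF f(1)] card_subset_eq[of f s] by simp
    then show "s \<in> F" using f by simp
  next
    fix s assume s: "s \<in> F"
    then have "card s = 4" "s \<noteq> {}" using F(2)[OF s] by auto
    then show "s \<in> faces_of_dim 3 ?M" using s unfolding faces_of_dim_def complex_of_def by auto
  qed
  have lnk: "link ?M \<alpha> = {\<tau>. \<tau> \<noteq> {} \<and> \<tau> \<subset> \<beta>}"
  proof (intro set_eqI iffI)
    fix \<tau> assume "\<tau> \<in> link ?M \<alpha>"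
    then have t: "\<tau> \<noteq> {}" "\<tau> \<inter> \<alpha> = {}" "\<exists>f\<in>F. \<tau> \<union> \<alpha> \<subseteq> f" unfolding link_def complex_of_def by auto
    then obtain f where f: "f \<in> F" "\<tau> \<union> \<alpha> \<subseteq> f" by blast
    then have "f \<in> (\<lambda>b. \<alpha> \<union> \<beta> - {b}) ` \<beta>" using star by blast
    then obtain b where "b \<in> \<beta>" "f = \<alpha> \<union> \<beta> - {b}" by blast
    then show "\<tau> \<in> {\<tau>. \<tau> \<noteq> {} \<and> \<tau> \<subset> \<beta>}" using t(1,2) f(2) by blast
  next
    fix \<tau> assume "\<tau> \<in> {\<tau>. \<tau> \<noteq> {} \<and> \<tau> \<subset> \<beta>}"
    then obtain b where b: "\<tau> \<noteq> {}" "b \<in> \<beta>" "\<tau> \<subseteq> \<beta> - {b}" by blast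
    then have f: "\<alpha> \<union> \<beta> - {b} \<in> F" using star by blast
    have "\<tau> \<union> \<alpha> \<subseteq> \<alpha> \<union> \<beta> - {b}" "\<tau> \<inter> \<alpha> = {}" using b fab by blast+
    then show "\<tau> \<in> link ?M \<alpha>" using f b(1) unfolding link_def complex_of_def by blast
  qed
  have cb: "2 \<le> card \<beta>" using ab by auto
  define i where "i = card \<beta> - 1"
  have i: "i \<in> {1, 2}" "card \<beta> = i + 1" "card \<alpha> = 3 - i + 1" using ab by (auto simp: i_def)
  obtain b where "b \<in> \<beta>" using fab by blast
  then have "\<alpha> \<union> \<beta> - {b} \<in> F" "\<alpha> \<subseteq> \<alpha> \<union> \<beta> - {b}" using star fab by blast+
  then have "\<alpha> \<in> faces_of_dim (3 - i) ?M"
    using i fab unfolding faces_of_dim_def complex_of_def by auto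
  moreover have "\<beta> \<notin> ?M" using nb unfolding complex_of_def by blast
  ultimately have adm: "admissible_move i ?M \<alpha> \<beta>"
    unfolding admissible_move_def using i lnk by simp
  \<comment> \<open>A set with at least two elements is the union of its nonempty proper subsets, so
    \<beta> can be read off from the link of \<alpha>. This makes the definite description
    determinate.\<close>
  have big: "\<Union>{\<tau>. \<tau> \<noteq> {} \<and> \<tau> \<subset> \<gamma>} = \<gamma>" if "2 \<le> card \<gamma>" for \<gamma> :: "'a set"
  proof
    show "\<gamma> \<subseteq> \<Union>{\<tau>. \<tau> \<noteq> {} \<and> \<tau> \<subset> \<gamma>}"
    proof
      fix x assume x: "x \<in> \<gamma>"
      have "{x} \<noteq> \<gamma>" using that by auto
      then have "{x} \<in> {\<tau>. \<tau> \<noteq> {} \<and> \<tau> \<subset> \<gamma>}" using x by blast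
      then show "x \<in> \<Union>{\<tau>. \<tau> \<noteq> {} \<and> \<tau> \<subset> \<gamma>}" by blast
    qed
  qed blast
  have uniq: "\<gamma> = \<beta>" if "admissible_move j ?M \<alpha> \<gamma>" for j \<gamma>
  proof -
    note A = that[unfolded admissible_move_def]
    have j: "j \<in> {1, 2}" "card \<gamma> = j + 1"
      by (rule A[THEN conjunct1], rule A[THEN conjunct2, THEN conjunct2, THEN conjunct1])
    have l: "link ?M \<alpha> = {\<tau>. \<tau> \<noteq> {} \<and> \<tau> \<subset> \<gamma>}"
      by (rule A[THEN conjunct2, THEN conjunct2, THEN conjunct2, THEN conjunct1])
    have "2 \<le> card \<gamma>" using j by auto
    then have "\<gamma> = \<Union>(link ?M \<alpha>)" unfolding l by (rule big[symmetric])
    also have "\<dots> = \<beta>" unfolding lnk by (rule big[OF cb])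
    finally show ?thesis .
  qed
  have the: "(THE \<beta>. \<exists>i. admissible_move i ?M \<alpha> \<beta>) = \<beta>"
  proof (rule the_equality)
    show "\<exists>i. admissible_move i ?M \<alpha> \<beta>" using adm by (rule exI)
    show "\<gamma> = \<beta>" if "\<exists>i. admissible_move i ?M \<alpha> \<gamma>" for \<gamma> using that by (elim exE) (rule uniq)
  qed
  have "{(\<beta> \<union> \<alpha>) - {v} |v. v \<in> \<alpha>} = (\<lambda>a. \<beta> \<union> \<alpha> - {a}) ` \<alpha>" by blast
  then show ?thesis
    unfolding bistellar_def the Let_def faces flip_def by simp
qed

definition swappable :: "nat list \<Rightarrow> nat list \<Rightarrow> bits list \<Rightarrow> bool" where
  "swappable \<alpha> \<beta> A \<longleftrightarrow> bflippable (face_bits blank8 \<alpha>) (face_bits blank8 \<beta>) A \<and> list_all (\<lambda>f. weight f = 4) A \<and>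
     weight (face_bits blank8 \<alpha>) + weight (face_bits blank8 \<beta>) = 5 \<and> weight (face_bits blank8 \<alpha>) \<in> {2, 3} \<and>
     list_all ((<) 0) \<alpha>"

lemma move_fam:
  assumes "digits n = set \<alpha>" and sw: "swappable \<alpha> \<beta> A"
  shows "move n (complex_of (fam A)) = complex_of (fam (swap \<alpha> \<beta> A))"
proof -
  let ?a = "face_bits blank8 \<alpha>" and ?b = "face_bits blank8 \<beta>"
  have a: "verts 1 ?a = digits n"
    using sw unfolding assms(1) swappable_def by (intro verts_mask) (auto simp: list_all_iff)
  have "bistellar (verts 1 ?a) (complex_of (fam A)) = complex_of (flip (verts 1 ?a) (verts 1 ?b) (fam A))"
    using sw by (intro bistellar_complex_of fam_bflip) (auto simp: swappable_def card_verts fam_def list_all_iff)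
  moreover have "fam (swap \<alpha> \<beta> A) = flip (verts 1 ?a) (verts 1 ?b) (fam A)"
    unfolding swap_def using sw by (intro fam_bflip(2)) (simp add: swappable_def)
  ultimately show ?thesis unfolding a by simp
qed

section \<open>Normality by evaluation\<close>

fun conn_check :: "bits list \<Rightarrow> bool" where
  "conn_check [] = True"
| "conn_check (f # fs) = sub (support (f # fs)) (component f fs)"

text \<open>A set \<open>T\<close> that no facet cuts and that contains the start swallows every
  facet absorbed, so absorption never leaves the component.\<close>

lemma absorb_subset:
  "verts 1 S \<subseteq> T \<Longrightarrow> (\<And>f. f \<in> set fs \<Longrightarrow> verts 1 f \<subseteq> T \<or> verts 1 f \<inter> T = {}) \<Longrightarrow> verts 1 (absorb fs S) \<subseteq> T"
proof (induction fs arbitrary: S)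
  case (Cons f fs)
  have "verts 1 (absorb_one (disj f S) f S) \<subseteq> T"
  proof (cases "disj f S")
    case False
    then have "verts 1 f \<subseteq> T" using Cons.prems disj_iff[of f S 1] by fastforce
    then show ?thesis using False Cons.prems by simp
  qed (use Cons.prems in simp)
  then show ?case using Cons by simp
qed simp

text \<open>If the facets absorbed from the first one cover all vertices, any uncut vertex set
  either contains the first facet, and hence everything, or has a complement with this
  property.\<close>

lemma conn_check_sound: "conn_check A \<Longrightarrow> conn (fam A)"
proof (cases A)
  case Nil
  then show ?thesis by (simp add: conn_def fam_def)
next
  case (Cons f fs)
  assume c: "conn_check A"
  have up: "\<Union>(fam A) \<subseteq> T" if fT: "verts 1 f \<subseteq> T" and sep: "\<And>g. g \<in> fam A \<Longrightarrow> g \<subseteq> T \<or> g \<inter> T = {}" for T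
  proof -
    have "verts 1 g \<subseteq> T \<or> verts 1 g \<inter> T = {}" if "g \<in> set fs" for g
      using sep[of "verts 1 g"] that Cons by (simp add: fam_def)
    then have "verts 1 (component f fs) \<subseteq> T"
      unfolding component_def using fT by (intro absorb_subset) auto
    then show ?thesis using c Cons sub_iff[of "support A" _ 1] by (simp add: verts_support del: support.simps One_nat_def)
  qed
  show ?thesis
    unfolding conn_def
  proof (intro allI impI)
    fix S assume S: "S \<subseteq> \<Union>(fam A)" "\<forall>g\<in>fam A. g \<subseteq> S \<or> g \<inter> S = {}"
    have "verts 1 f \<in> fam A" using Cons by (simp add: fam_def)
    then consider "verts 1 f \<subseteq> S" | "verts 1 f \<subseteq> - S" using S(2) by blast
    then show "S = {} \<or> S = \<Union>(fam A)"
    proof cases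
      case 1
      then show ?thesis using up[of S] S by simp
    next
      case 2
      have "g \<subseteq> - S \<or> g \<inter> - S = {}" if "g \<in> fam A" for g using S(2) that by blast
      then show ?thesis using up[OF 2] S(1) by blast
    qed
  qed
qed

primrec all_links :: "(bits list \<Rightarrow> bool) \<Rightarrow> bits list \<Rightarrow> bits list \<Rightarrow> bool" where
  "all_links g [] A = True"
| "all_links g (v # vs) A = and_also (g (blink v A)) (all_links g vs A)"

text \<open>All eight possible vertices are tried at each level; one that does not occur yields an
  empty link, which passes.\<close>

primrec links_check :: "nat \<Rightarrow> bits list \<Rightarrow> bool" where
  "links_check 0 A = True"
| "links_check (Suc k) A = and_also (conn_check A) (all_links (links_check k) (vertex_list 8) A)"

lemma all_links_iff: "all_links g vs A \<longleftrightarrow> (\<forall>v\<in>set vs. g (blink v A))"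
  by (induction vs) auto

lemma links_check_sound: "links_check k A \<Longrightarrow> \<Union>(fam A) \<subseteq> {1..8} \<Longrightarrow> conn_links k (fam A)"
proof (induction k arbitrary: A)
  case (Suc k)
  have "conn_links k (lk v (fam A))" if v: "v \<in> \<Union>(fam A)" for v
  proof -
    have v8: "v \<in> {1..8}" using v Suc.prems(2) by blast
    then have "vx v \<in> set (vertex_list 8)" by (simp add: vertex_list_def)
    then have "links_check k (blink (vx v) A)" using Suc.prems(1) by (simp add: all_links_iff)
    moreover have b: "fam (blink (vx v) A) = lk v (fam A)" using v8 by (intro fam_blink verts_1_vx) auto
    moreover have "\<Union>(lk v (fam A)) \<subseteq> {1..8}" using Union_lk_subset[of v "fam A"] Suc.prems(2) by (meson Diff_subset subset_trans)
    ultimately show ?thesis using Suc.IH[of "blink (vx v) A"] by simp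
  qed
  moreover have "conn (fam A)" using Suc.prems(1) by (intro conn_check_sound) simp
  ultimately show ?case unfolding conn_links.simps by blast
qed simp

fun two :: "bits list \<Rightarrow> bool" where
  "two [x, y] = (\<not> same x y)" | "two xs = False"

lemma two_iff: "two xs \<longleftrightarrow> (\<exists>x y. xs = [x, y] \<and> x \<noteq> y)"
  by (cases xs rule: two.cases) auto

primrec two_each :: "bits list \<Rightarrow> bits list \<Rightarrow> bool" where
  "two_each A [] = True"
| "two_each A (r # rs) = and_also (two (supersets r A)) (two_each A rs)"

primrec closed_check :: "bits list \<Rightarrow> bits list \<Rightarrow> bool" where
  "closed_check A [] = True"
| "closed_check A (f # fs) = and_also (two_each A (ridges f)) (closed_check A fs)"

definition normal_check :: "bits list \<Rightarrow> bool" where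
  "normal_check A \<longleftrightarrow> and_also (list_all (\<lambda>f. len f = 8) A) (and_also (list_all (\<lambda>f. weight f = 4) A)
     (and_also (closed_check A A) (and_also (sub (face_bits End [1, 2, 3, 4, 5, 6, 7, 8]) (support A)) (and_also (distinct A)
     (links_check 3 A)))))"

lemma normal_check_sound:
  assumes "normal_check A"
  shows "normal_family 4 (fam A)" "\<Union>(fam A) = {1..8}" "distinct A"
    "\<And>f. f \<in> set A \<Longrightarrow> len f = 8 \<and> weight f = 4"
proof -
  have len: "\<And>f. f \<in> set A \<Longrightarrow> len f = 8" and w: "\<And>f. f \<in> set A \<Longrightarrow> weight f = 4"
    and cc: "closed_check A A" and all: "sub (face_bits End [1, 2, 3, 4, 5, 6, 7, 8]) (support A)"
    and dis: "distinct A" and lc: "links_check 3 A"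
    using assms by (auto simp: normal_check_def list_all_iff)
  show "distinct A" by (rule dis)
  show "len f = 8 \<and> weight f = 4" if "f \<in> set A" for f using that len w by simp
  have sub8: "\<Union>(fam A) \<subseteq> {1..8}"
  proof -
    have "verts 1 f \<subseteq> {1..8}" if "f \<in> set A" for f
      using verts_subset[of 1 f] len[OF that] by auto
    then show ?thesis by (auto simp: fam_def simp del: One_nat_def)
  qed
  have m8: "verts 1 (face_bits End [1, 2, 3, 4, 5, 6, 7, 8]) = set [1, 2, 3, 4, 5, 6, 7, 8]"
    by (rule verts_mask) auto
  have "{1..8} = set [1::nat, 2, 3, 4, 5, 6, 7, 8]" by auto
  also have "\<dots> \<subseteq> \<Union>(fam A)" using all unfolding sub_iff[of _ _ 1] verts_support m8 .
  finally have "{1..8} \<subseteq> \<Union>(fam A)" .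
  then show eq: "\<Union>(fam A) = {1..8}" using sub8 by blast
  have "closed_check A fs \<Longrightarrow> f \<in> set fs \<Longrightarrow> r \<in> set (ridges f) \<Longrightarrow> two (supersets r A)" for fs f r
  proof (induction fs)
    case (Cons g fs)
    have "two_each A rs \<Longrightarrow> r \<in> set rs \<Longrightarrow> two (supersets r A)" for rs by (induction rs) auto
    then show ?case using Cons by auto
  qed simp
  note two = this[OF cc]
  have "closed_family 4 (fam A)"
    unfolding closed_family_def
  proof (intro conjI ballI)
    fix f assume "f \<in> fam A"
    then obtain x where x: "x \<in> set A" "f = verts 1 x" unfolding fam_def by blast
    then show "finite f" "card f = 4" using w by (simp_all add: card_verts)
    fix v assume "v \<in> f"
    then have "f - {v} \<in> verts 1 ` set (ridges x)" unfolding verts_ridges x(2) by blast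
    then obtain r where r: "r \<in> set (ridges x)" "verts 1 r = f - {v}" by auto
    obtain y z where yz: "supersets r A = [y, z]" "y \<noteq> z"
      using two[OF x(1) r(1)] unfolding two_iff by blast
    have "{g \<in> fam A. f - {v} \<subseteq> g} = verts 1 ` set (supersets r A)"
      unfolding fam_def set_supersets r(2)[symmetric] sub_iff[of r _ 1] by blast
    also have "\<dots> = {verts 1 y, verts 1 z}" unfolding yz by simp
    finally have eq: "{g \<in> fam A. f - {v} \<subseteq> g} = {verts 1 y, verts 1 z}" .
    have "{y, z} \<subseteq> set A" using set_supersets[of r A] yz by auto
    \<comment> \<open>The words have equal length, so different words are different facets and the
      ridge lies in exactly two.\<close>
    then have "verts 1 y \<noteq> verts 1 z" using verts_inj[of y z 1] len yz(2) by auto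
    then show "card {g \<in> fam A. f - {v} \<subseteq> g} = 2" unfolding eq by simp
  qed (simp add: fam_def)
  moreover have "fam A \<noteq> {}" using eq by auto
  moreover have "conn_links 3 (fam A)" by (rule links_check_sound[OF lc sub8])
  ultimately show "normal_family 4 (fam A)" by (simp add: normal_family_def)
qed

section \<open>An isomorphism invariant\<close>

definition pair_degree :: "'a set set \<Rightarrow> 'a \<Rightarrow> 'a \<Rightarrow> nat" where
  "pair_degree F u v = card {f \<in> F. u \<in> f \<and> v \<in> f}"

text \<open>The exponents are chosen such that this isomorphism invariant separates the 35 complexes.\<close>

definition profile :: "'a set set \<Rightarrow> int" where
  "profile F = (\<Sum>u\<in>\<Union>F. (\<Sum>v\<in>\<Union>F. int (pair_degree F u v) ^ 3) ^ 2)"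

lemma pair_degree_image:
  assumes h: "inj_on h (\<Union>F)" and uv: "u \<in> \<Union>F" "v \<in> \<Union>F"
  shows "pair_degree ((`) h ` F) (h u) (h v) = pair_degree F u v"
proof -
  have "h w \<in> h ` f \<longleftrightarrow> w \<in> f" if "f \<in> F" "w \<in> \<Union>F" for f w
    by (rule inj_on_image_mem_iff[OF h]) (use that in auto)
  then have "{g \<in> (`) h ` F. h u \<in> g \<and> h v \<in> g} = (`) h ` {f \<in> F. u \<in> f \<and> v \<in> f}"
    using uv by (auto simp del: image_iff)
  moreover have "inj_on ((`) h) {f \<in> F. u \<in> f \<and> v \<in> f}"
    using inj_on_image_family[OF h] by (rule inj_on_subset) blast
  ultimately show ?thesis unfolding pair_degree_def by (simp add: card_image)
qed

lemma profile_iso: "fam_iso F G \<Longrightarrow> profile F = profile G"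
proof -
  assume "fam_iso F G"
  then obtain h where h: "inj_on h (\<Union>F)" and G: "G = (`) h ` F" unfolding fam_iso_def by metis
  have "profile G = (\<Sum>u\<in>\<Union>F. (\<Sum>v\<in>\<Union>F. int (pair_degree G (h u) (h v)) ^ 3) ^ 2)"
    unfolding profile_def G Union_image_image by (simp add: sum.reindex[OF h])
  also have "\<dots> = profile F"
    unfolding profile_def G by (intro sum.cong refl) (simp add: pair_degree_image[OF h])
  finally show ?thesis by simp
qed

text \<open>Integers and explicit products, rather than natural numbers and powers, allow the
  evaluation to use binary arithmetic.\<close>

primrec icount :: "bits list \<Rightarrow> int" where
  "icount [] = 0" | "icount (x # xs) = 1 + icount xs"

definition cube :: "int \<Rightarrow> int" where "cube x = x * (x * x)"
definition square :: "int \<Rightarrow> int" where "square x = x * x"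

primrec cube_sum :: "bits list \<Rightarrow> bits list \<Rightarrow> int" where
  "cube_sum A [] = 0" | "cube_sum A (v # vs) = cube (icount (supersets v A)) + cube_sum A vs"

primrec square_sum :: "bits list \<Rightarrow> bits list \<Rightarrow> int" where
  "square_sum A [] = 0" | "square_sum A (u # us) = square (cube_sum (supersets u A) (vertex_list 8)) + square_sum A us"

lemma icount_conv: "icount xs = int (length xs)"
  by (induction xs) auto

lemma vertex_list_8: "vertex_list 8 = map vx [1, 2, 3, 4, 5, 6, 7, 8]"
proof -
  have "[1..<Suc 8] = [1, 2, 3, 4, 5, 6, 7, 8]" by (simp add: upt_rec)
  then show ?thesis unfolding vertex_list_def by (rule arg_cong)
qed

text \<open>List lengths count facets correctly because the words are distinct and of equal length.
  The summands with \<open>u = v\<close> count the facets through one vertex.\<close>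

lemma profile_fam:
  assumes "normal_check A"
  shows "profile (fam A) = square_sum A (vertex_list 8)"
proof -
  note A = normal_check_sound[OF assms]
  have v8: "{1..8} = set [1::nat, 2, 3, 4, 5, 6, 7, 8]" by auto
  have sup: "supersets r xs = filter (sub r) xs" for r xs by (induction xs) (auto simp: pick_if_conv)
  have deg: "int (pair_degree (fam A) u v) = icount (supersets (vx v) (supersets (vx u) A))"
    if "0 < u" "0 < v" for u v
  proof -
    have "{f \<in> fam A. u \<in> f \<and> v \<in> f} = verts 1 ` set (supersets (vx v) (supersets (vx u) A))"
      using verts_1_vx[OF that(1)] verts_1_vx[OF that(2)]
      by (auto simp: fam_def sub_iff[of _ _ 1] simp del: One_nat_def)
    moreover have "inj_on (verts 1) (set (supersets (vx v) (supersets (vx u) A)))"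
      using A(4) by (intro inj_onI) (auto intro: verts_inj simp del: One_nat_def)
    moreover have "distinct (supersets (vx v) (supersets (vx u) A))" using A(3) by (simp add: sup)
    ultimately show ?thesis
      by (simp add: pair_degree_def card_image distinct_card icount_conv del: set_supersets One_nat_def)
  qed
  have L8: "(\<Sum>v\<in>{1..8}. X v) = (\<Sum>v\<leftarrow>[1, 2, 3, 4, 5, 6, 7, 8]. X v)" for X :: "nat \<Rightarrow> int"
    unfolding v8 by (rule sum.distinct_set_conv_list) simp
  have cs: "cube_sum B (map vx vs) = (\<Sum>v\<leftarrow>vs. cube (icount (supersets (vx v) B)))" for B vs
    by (induction vs) auto
  have ss: "square_sum B (map vx vs) = (\<Sum>v\<leftarrow>vs. square (cube_sum (supersets (vx v) B) (vertex_list 8)))" for B vs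
    by (induction vs) auto
  have inner: "(\<Sum>v\<in>{1..8}. int (pair_degree (fam A) u v) ^ 3) = cube_sum (supersets (vx u) A) (vertex_list 8)" if "0 < u" for u
    unfolding L8 vertex_list_8 cs
    by (intro arg_cong[of _ _ sum_list] map_cong refl) (use that in \<open>auto simp: deg cube_def power3_eq_cube mult.assoc\<close>)
  have "profile (fam A) = (\<Sum>u\<leftarrow>[1, 2, 3, 4, 5, 6, 7, 8]. square (cube_sum (supersets (vx u) A) (vertex_list 8)))"
    unfolding profile_def A(2) L8[of "\<lambda>u. (\<Sum>v\<in>{1..8}. int (pair_degree (fam A) u v) ^ 3) ^ 2"]
    by (intro arg_cong[of _ _ sum_list] map_cong refl) (auto simp only: inner square_def power2_eq_square set_simps insert_iff empty_iff zero_less_one zero_less_numeral)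
  also have "\<dots> = square_sum A (vertex_list 8)" unfolding vertex_list_8 ss ..
  finally show ?thesis .
qed

section \<open>Identification with the defined complexes\<close>

lemma N1: "N1 = complex_of (fam M1)"
  unfolding N1_def M1_def by (subst fam_masks) (simp_all add: digits.simps insert_commute)

lemma N2: "N2 = complex_of (fam M2)"
  unfolding N2_def M2_def by (subst fam_masks) (simp_all add: digits.simps insert_commute)

lemma N3: "N3 = complex_of (fam M3)"
  unfolding N3_def M3_def by (subst fam_masks) (simp_all add: digits.simps insert_commute)

lemma N4: "N4 = complex_of (fam M4)"
  unfolding N4_def M4_def by (subst fam_masks) (simp_all add: digits.simps insert_commute)

lemma N5: "N5 = complex_of (fam M5)"
  unfolding N5_def M5_def by (subst fam_masks) (simp_all add: digits.simps insert_commute)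

lemma N6: "N6 = complex_of (fam M6)"
  unfolding N6_def M6_def by (subst fam_masks) (simp_all add: digits.simps insert_commute)

lemma N7: "N7 = complex_of (fam M7)"
  unfolding N7_def M7_def by (subst fam_masks) (simp_all add: digits.simps insert_commute)

text \<open>All conditions of the move, including that \<beta> is not a face, are settled by
  evaluation; this also shows that the value of \<open>bistellar\<close> is a genuine one. The same
  applies to the moves that follow.\<close>

lemma move_M16: "move 67 (complex_of (fam M7)) = complex_of (fam M16)"
  unfolding M16_def by (rule move_fam) (simp add: digits.simps insert_commute, code_simp)

lemma move_M25: "move 56 (complex_of (fam M16)) = complex_of (fam M25)"
  unfolding M25_def by (rule move_fam) (simp add: digits.simps insert_commute, code_simp)

lemma move_M18: "move 238 (complex_of (fam M25)) = complex_of (fam M18)"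
  unfolding M18_def by (rule move_fam) (simp add: digits.simps insert_commute, code_simp)

lemma move_M8: "move 348 (complex_of (fam M18)) = complex_of (fam M8)"
  unfolding M8_def by (rule move_fam) (simp add: digits.simps insert_commute, code_simp)

lemma move_M9: "move 235 (complex_of (fam M16)) = complex_of (fam M9)"
  unfolding M9_def by (rule move_fam) (simp add: digits.simps insert_commute, code_simp)

lemma move_M10: "move 148 (complex_of (fam M16)) = complex_of (fam M10)"
  unfolding M10_def by (rule move_fam) (simp add: digits.simps insert_commute, code_simp)

lemma move_M20: "move 56 (complex_of (fam M10)) = complex_of (fam M20)"
  unfolding M20_def by (rule move_fam) (simp add: digits.simps insert_commute, code_simp)

lemma move_M11: "move 348 (complex_of (fam M20)) = complex_of (fam M11)"
  unfolding M11_def by (rule move_fam) (simp add: digits.simps insert_commute, code_simp)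

lemma move_M23: "move 23 (complex_of (fam M9)) = complex_of (fam M23)"
  unfolding M23_def by (rule move_fam) (simp add: digits.simps insert_commute, code_simp)

lemma move_M12: "move 457 (complex_of (fam M23)) = complex_of (fam M12)"
  unfolding M12_def by (rule move_fam) (simp add: digits.simps insert_commute, code_simp)

lemma move_M13: "move 567 (complex_of (fam M23)) = complex_of (fam M13)"
  unfolding M13_def by (rule move_fam) (simp add: digits.simps insert_commute, code_simp)

lemma move_M19: "move 57 (complex_of (fam M8)) = complex_of (fam M19)"
  unfolding M19_def by (rule move_fam) (simp add: digits.simps insert_commute, code_simp)

lemma move_M14: "move 138 (complex_of (fam M19)) = complex_of (fam M14)"
  unfolding M14_def by (rule move_fam) (simp add: digits.simps insert_commute, code_simp)

lemma move_M15: "move 158 (complex_of (fam M23)) = complex_of (fam M15)"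
  unfolding M15_def by (rule move_fam) (simp add: digits.simps insert_commute, code_simp)

lemma move_M17: "move 24 (complex_of (fam M8)) = complex_of (fam M17)"
  unfolding M17_def by (rule move_fam) (simp add: digits.simps insert_commute, code_simp)

lemma move_M21: "move 12 (complex_of (fam M9)) = complex_of (fam M21)"
  unfolding M21_def by (rule move_fam) (simp add: digits.simps insert_commute, code_simp)

lemma move_M22: "move 14 (complex_of (fam M11)) = complex_of (fam M22)"
  unfolding M22_def by (rule move_fam) (simp add: digits.simps insert_commute, code_simp)

lemma move_M24: "move 38 (complex_of (fam M14)) = complex_of (fam M24)"
  unfolding M24_def by (rule move_fam) (simp add: digits.simps insert_commute, code_simp)

lemma move_M26: "move 12 (complex_of (fam M16)) = complex_of (fam M26)"
  unfolding M26_def by (rule move_fam) (simp add: digits.simps insert_commute, code_simp)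

lemma move_M27: "move 56 (complex_of (fam M17)) = complex_of (fam M27)"
  unfolding M27_def by (rule move_fam) (simp add: digits.simps insert_commute, code_simp)

lemma move_M28: "move 57 (complex_of (fam M18)) = complex_of (fam M28)"
  unfolding M28_def by (rule move_fam) (simp add: digits.simps insert_commute, code_simp)

lemma move_M29: "move 15 (complex_of (fam M18)) = complex_of (fam M29)"
  unfolding M29_def by (rule move_fam) (simp add: digits.simps insert_commute, code_simp)

lemma move_M30: "move 12 (complex_of (fam M23)) = complex_of (fam M30)"
  unfolding M30_def by (rule move_fam) (simp add: digits.simps insert_commute, code_simp)

lemma move_M31: "move 24 (complex_of (fam M22)) = complex_of (fam M31)"
  unfolding M31_def by (rule move_fam) (simp add: digits.simps insert_commute, code_simp)

lemma move_M32: "move 24 (complex_of (fam M26)) = complex_of (fam M32)"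
  unfolding M32_def by (rule move_fam) (simp add: digits.simps insert_commute, code_simp)

lemma move_M33: "move 57 (complex_of (fam M25)) = complex_of (fam M33)"
  unfolding M33_def by (rule move_fam) (simp add: digits.simps insert_commute, code_simp)

lemma move_M34: "move 45 (complex_of (fam M28)) = complex_of (fam M34)"
  unfolding M34_def by (rule move_fam) (simp add: digits.simps insert_commute, code_simp)

lemma move_M35: "move 58 (complex_of (fam M29)) = complex_of (fam M35)"
  unfolding M35_def by (rule move_fam) (simp add: digits.simps insert_commute, code_simp)

lemmas moves = move_M16 move_M25 move_M18 move_M8 move_M9 move_M10 move_M20 move_M11 move_M23 move_M12 move_M13 move_M19 move_M14 move_M15 move_M17 move_M21 move_M22 move_M24 move_M26 move_M27 move_M28 move_M29 move_M30 move_M31 move_M32 move_M33 move_M34 move_M35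

lemma N8: "N8 = complex_of (fam M8)"
  by (simp only: N8_def N7 moves)

lemma N9: "N9 = complex_of (fam M9)"
  by (simp only: N9_def N7 moves)

lemma N10: "N10 = complex_of (fam M10)"
  by (simp only: N10_def N7 moves)

lemma N11: "N11 = complex_of (fam M11)"
  by (simp only: N11_def N10 moves)

lemma N12: "N12 = complex_of (fam M12)"
  by (simp only: N12_def N9 moves)

lemma N13: "N13 = complex_of (fam M13)"
  by (simp only: N13_def N9 moves)

lemma N14: "N14 = complex_of (fam M14)"
  by (simp only: N14_def N8 moves)

lemma N15: "N15 = complex_of (fam M15)"
  by (simp only: N15_def N9 moves)

lemma N16: "N16 = complex_of (fam M16)"
  by (simp only: N16_def N7 moves)

lemma N17: "N17 = complex_of (fam M17)"
  by (simp only: N17_def N8 moves)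

lemma N18: "N18 = complex_of (fam M18)"
  by (simp only: N18_def N7 moves)

lemma N19: "N19 = complex_of (fam M19)"
  by (simp only: N19_def N8 moves)

lemma N20: "N20 = complex_of (fam M20)"
  by (simp only: N20_def N10 moves)

lemma N21: "N21 = complex_of (fam M21)"
  by (simp only: N21_def N9 moves)

lemma N22: "N22 = complex_of (fam M22)"
  by (simp only: N22_def N11 moves)

lemma N23: "N23 = complex_of (fam M23)"
  by (simp only: N23_def N9 moves)

lemma N24: "N24 = complex_of (fam M24)"
  by (simp only: N24_def N14 moves)

lemma N25: "N25 = complex_of (fam M25)"
  by (simp only: N25_def N16 moves)

lemma N26: "N26 = complex_of (fam M26)"
  by (simp only: N26_def N16 moves)

lemma N27: "N27 = complex_of (fam M27)"
  by (simp only: N27_def N17 moves)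

lemma N28: "N28 = complex_of (fam M28)"
  by (simp only: N28_def N18 moves)

lemma N29: "N29 = complex_of (fam M29)"
  by (simp only: N29_def N18 moves)

lemma N30: "N30 = complex_of (fam M30)"
  by (simp only: N30_def N23 moves)

lemma N31: "N31 = complex_of (fam M31)"
  by (simp only: N31_def N22 moves)

lemma N32: "N32 = complex_of (fam M32)"
  by (simp only: N32_def N26 moves)

lemma N33: "N33 = complex_of (fam M33)"
  by (simp only: N33_def N25 moves)

lemma N34: "N34 = complex_of (fam M34)"
  by (simp only: N34_def N28 moves)

lemma N35: "N35 = complex_of (fam M35)"
  by (simp only: N35_def N29 moves)

lemma length_Ms: "length Ms = 35"
  by (simp add: Ms_def)

lemma N_complex_fam:
  assumes "i \<in> {1..35}"
  shows "N_complex i = complex_of (fam (Ms ! (i - 1)))"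
proof -
  have "[N1, N2, N3, N4, N5, N6, N7, N8, N9, N10, N11, N12, N13, N14, N15, N16,
      N17, N18, N19, N20, N21, N22, N23, N24, N25, N26, N27, N28, N29, N30, N31,
      N32, N33, N34, N35] = map (\<lambda>A. complex_of (fam A)) Ms"
    by (simp only: Ms_def list.map N1 N2 N3 N4 N5 N6 N7 N8 N9 N10 N11 N12 N13 N14 N15 N16 N17 N18 N19 N20 N21 N22 N23 N24 N25 N26 N27 N28 N29 N30 N31 N32 N33 N34 N35)
  moreover have "i - 1 < length Ms" using assms length_Ms by auto
  ultimately show ?thesis unfolding N_complex_def by (simp only: nth_map)
qed

section \<open>Verification of the 35 lists\<close>

lemma Ms_normal: "list_all normal_check Ms"
  by code_simp

lemma Ms_profile: "distinct (map (\<lambda>A. square_sum A (vertex_list 8)) Ms)"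
  by code_simp

lemma Ms_singular:
  "list_all (\<lambda>(A, v, R, p). 0 < v \<and> check (ones blank8) (blink (vx v) A) (Iso R p)) singular_links"
  by code_simp

lemma Ms_singular_link:
  assumes "A \<in> set Ms"
  shows "\<exists>v. \<not> triangulates (complex_of (lk v (fam A))) (sphere (0 :: real ^ 3) 1) \<and> v \<in> \<Union>(fam A)"
proof -
  have "map fst singular_links = Ms" by (simp add: singular_links_def Ms_def)
  then have "A \<in> fst ` set singular_links" using assms by (metis set_map)
  then obtain v R p where sing: "(A, v, R, p) \<in> set singular_links" by force
  have "list_all (\<lambda>(A, v, R, p). R \<in> {RP6, RP7a, RP7b, RP7c, T7}) singular_links"
    by (simp add: singular_links_def)
  then have R: "R \<in> {RP6, RP7a, RP7b, RP7c, T7}" using sing unfolding list_all_iff by fast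
  have "0 < v \<and> check (ones blank8) (blink (vx v) A) (Iso R p)"
    using Ms_singular sing unfolding list_all_iff by fast
  then have v: "0 < v" and c: "check (ones blank8) (blink (vx v) A) (Iso R p)" by blast+
  have "verts 1 (ones blank8) = {1..len (ones blank8)}"
    using verts_ones[of 1 blank8] by (simp add: blank7_def blank8_def atLeastLessThanSuc_atLeastAtMost)
  then have "fam_iso (fam R) (lk v (fam A))"
    using check_Iso[OF c] fam_blink[OF verts_1_vx[OF v]] by simp
  then have iso: "fam_iso (lk v (fam A)) (fam R)" by (rule fam_iso_sym)
  have "R \<noteq> []" using R lens_surfaces by (auto simp: RP6_def RP7a_def RP7b_def RP7c_def T7_def)
  then have "fam R \<noteq> {}" by (simp add: fam_def)
  then have "lk v (fam A) \<noteq> {}" using iso unfolding fam_iso_def by (metis image_is_empty)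
  then have "v \<in> \<Union>(fam A)" by (simp only: lk_empty_iff not_not)
  then show ?thesis using nonspheres[OF R iso] by blast
qed

text \<open>An isomorphism is injective on vertices and so preserves the number of vertices of a
  face; it therefore carries top-dimensional faces, the facets, to facets.\<close>

lemma isomorphic_imp_fam_iso:
  assumes F: "closed_family (Suc d) F" and G: "closed_family (Suc d) G"
    and iso: "isomorphic (complex_of F) (complex_of G)"
  shows "fam_iso F G"
proof -
  obtain h where h: "bij_betw h (\<Union>F) (\<Union>G)" and im: "(\<lambda>\<sigma>. h ` \<sigma>) ` complex_of F = complex_of G"
    using iso unfolding isomorphic_def vertices_complex_of by metis
  have inj: "inj_on h (\<Union>F)" using h by (rule bij_betw_imp_inj_on)
  have c: "card (h ` \<sigma>) = card \<sigma>" if "\<sigma> \<in> complex_of F" for \<sigma>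
  proof -
    have "\<sigma> \<subseteq> \<Union>F" using that unfolding complex_of_def by blast
    then show ?thesis using inj inj_on_subset card_image by metis
  qed
  have "faces_of_dim d ((\<lambda>\<sigma>. h ` \<sigma>) ` complex_of F) = (\<lambda>\<sigma>. h ` \<sigma>) ` faces_of_dim d (complex_of F)"
    unfolding faces_of_dim_def using c by (auto simp del: image_iff)
  then have "G = (\<lambda>\<sigma>. h ` \<sigma>) ` F"
    unfolding im complex_of_closed_family(2)[OF F] complex_of_closed_family(2)[OF G] .
  then show ?thesis using inj unfolding fam_iso_def by blast
qed

lemma non_combinatorial_iff:
  assumes "normal_family 4 F"
  shows "\<not> combinatorial_3_manifold (complex_of F) \<longleftrightarrow>
    (\<exists>v\<in>\<Union>F. \<not> triangulates (complex_of (lk v F)) (sphere (0 :: real ^ 3) 1))"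
proof -
  have "normal_pseudomanifold 3 (complex_of F)" unfolding normal_pseudomanifold_3_iff using assms by blast
  then show ?thesis unfolding combinatorial_3_manifold_def vertices_complex_of link_complex_of by blast
qed

theorem corollary4:
  shows
    "(\<forall>i\<in>{1..35}.
        normal_pseudomanifold 3 (N_complex i) \<and> vertices (N_complex i) = {1..8} \<and>
        \<not> combinatorial_3_manifold (N_complex i)) \<and>
     (\<forall>i\<in>{1..35}. \<forall>j\<in>{1..35}. i \<noteq> j \<longrightarrow> \<not> isomorphic (N_complex i) (N_complex j)) \<and>
     (\<forall>K :: 'a set set.
        normal_pseudomanifold 3 K \<and> card (vertices K) = 8 \<and> \<not> combinatorial_3_manifold K \<longrightarrow>
        (\<exists>i\<in>{1..35}. isomorphic K (N_complex i)))"
proof (intro conjI ballI allI impI)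
  note len = length_Ms
  have check: "normal_check A" if "A \<in> set Ms" for A
    using Ms_normal that unfolding list_all_iff by blast
  have mem: "Ms ! (i - 1) \<in> set Ms" if "i \<in> {1..35}" for i
    using that len by (intro nth_mem) auto
  {
    fix i :: nat assume i: "i \<in> {1..35}"
    note A = normal_check_sound[OF check[OF mem[OF i]]]
    show "normal_pseudomanifold 3 (N_complex i)"
      unfolding N_complex_fam[OF i] normal_pseudomanifold_3_iff using A(1) by blast
    show "vertices (N_complex i) = {1..8}"
      unfolding N_complex_fam[OF i] vertices_complex_of by (rule A(2))
    show "\<not> combinatorial_3_manifold (N_complex i)"
      unfolding N_complex_fam[OF i] non_combinatorial_iff[OF A(1)]
      using Ms_singular_link[OF mem[OF i]] by blast
  next
    fix i j :: nat assume i: "i \<in> {1..35}" and j: "j \<in> {1..35}" and ij: "i \<noteq> j"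
    let ?A = "Ms ! (i - 1)" and ?B = "Ms ! (j - 1)"
    note A = check[OF mem[OF i]] and B = check[OF mem[OF j]]
    have il: "i - 1 < 35" and jl: "j - 1 < 35" using i j by auto
    show "\<not> isomorphic (N_complex i) (N_complex j)"
    proof
      assume "isomorphic (N_complex i) (N_complex j)"
      then have "fam_iso (fam ?A) (fam ?B)"
        using normal_check_sound(1)[OF A] normal_check_sound(1)[OF B]
        unfolding N_complex_fam[OF i] N_complex_fam[OF j] normal_family_def
        by (intro isomorphic_imp_fam_iso[of 3]) simp_all
      then have "square_sum ?A (vertex_list 8) = square_sum ?B (vertex_list 8)"
        using profile_iso profile_fam[OF A] profile_fam[OF B] by metis
      then have "map (\<lambda>A. square_sum A (vertex_list 8)) Ms ! (i - 1) = map (\<lambda>A. square_sum A (vertex_list 8)) Ms ! (j - 1)"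
        using il jl by (simp add: len)
      then have "i - 1 = j - 1"
        using nth_eq_iff_index_eq[OF Ms_profile, of "i - 1" "j - 1"] il jl by (simp add: len)
      \<comment> \<open>Both indices are at least 1, so the truncated subtraction does not merge
        them.\<close>
      then show False using i j ij by auto
    qed
  next
    fix K :: "'a set set"
    assume K: "normal_pseudomanifold 3 K \<and> card (vertices K) = 8 \<and> \<not> combinatorial_3_manifold K"
    then obtain F where F: "normal_family 4 F" "K = complex_of F"
      unfolding normal_pseudomanifold_3_iff by blast
    have n: "card (\<Union>F) = 8" using K unfolding F(2) vertices_complex_of by blast
    obtain v where "v \<in> \<Union>F" "\<not> triangulates (complex_of (lk v F)) (sphere (0 :: real ^ 3) 1)"
      using K unfolding F(2) non_combinatorial_iff[OF F(1)] by blast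
    then obtain G where G: "G \<in> set Ms" "fam_iso F (fam G)"
      using pseudomanifold_classification[OF F(1) n] by blast
    then obtain k where k: "k < length Ms" "G = Ms ! k" by (auto simp: in_set_conv_nth)
    have i: "Suc k \<in> {1..35}" using k len by simp
    have "isomorphic K (N_complex (Suc k))"
      unfolding F(2) N_complex_fam[OF i] using isomorphic_complex_of[OF G(2)] k by simp
    then show "\<exists>i\<in>{1..35}. isomorphic K (N_complex i)" using i by (rule bexI)
  }
qed

end
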